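(* Let $(A,\mathbb{R},\sigma)$ be a C*-dynamical system with $A$ a unital C*-algebra. Let $\mu$, $\nu$, $\lambda$ be positive linear functionals (PLFs) on $A$ with $N_\lambda\subseteq N_\mu$ and $N_\lambda\subseteq N_\nu$, and suppose that $\lambda$ is a KMS-PLF for $(A,\mathbb{R},\sigma)$. Then: (i) $AC[\lambda]$ is a positive hereditary cone; (ii) $SG[\lambda]$ is a positive hereditary cone; (iii) $(\mu+\nu)_{ac}=\mu_{ac}+\nu_{ac}$ with respect to $\lambda$; (iv) $(\mu+\nu)_s=\mu_s+\nu_s$ with respect to $\lambda$; (v) if $\mu\le\nu$, then $\mu_{ac}\le\nu_{ac}$ and $\mu_s\le\nu_s$; (vi) the weak* Lebesgue decomposition $\mu=\mu_{wc}+\mu_{ws}$ with respect to $\lambda$ and the Arveson–Gheondea–Kavruk Lebesgue (AGKL) decomposition $\mu=\mu_{ac}+\mu_s$ with respect to $\lambda$ are the same, i.e. $\mu_{wc}=\mu_{ac}$ and $\mu_{ws}=\mu_s$.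
   Context: A PLF on a unital C*-algebra $A$ is a positive linear functional $A\to\mathbb{C}$; $A^*_+$ is the cone of PLFs, and $\nu\le\mu$ means $\mu-\nu$ is positive. For a PLF $\tau$, $N_\tau=\{a\in A:\tau(a^*a)=0\}$. A sub-cone $\mathcal{S}$ of a positive cone $\mathcal{C}$ (here $\mathcal{C}=A^*_+$) is hereditary if $s\in\mathcal{S}$, $c\in\mathcal{C}$ and $c\le s$ imply $c\in\mathcal{S}$. C*-dynamical system $(A,\mathbb{R},\sigma)$: a C*-algebra $A$ and a group homomorphism $\sigma:\mathbb{R}\to\mathrm{Aut}(A)$, $t\mapsto\sigma_t$, into the group of $*$-automorphisms such that $(t,a)\mapsto\sigma_t(a)$ is continuous (norm topology on $A$). KMS-PLF: a PLF $\lambda$ on $A$ is a KMS-PLF for $(A,\mathbb{R},\sigma)$ if (1) for each $a\in A$ the map $\mathbb{R}\to A$, $t\mapsto\sigma_t(a)$, has an analytic extension $f_a$ to the strip $\{z\in\mathbb{C}:0<\mathrm{Im}(z)<1\}$ (with continuous boundary values on the closed strip, agreeing with $\sigma_t(a)$ on $\mathbb{R}$), and one writes $\sigma_z(a):=f_a(z)$; (2) $\lambda(ab)=\lambda(b\,\sigma_i(a))$ for all $a,b\in A$; (3) $\lambda\circ\sigma_t=\lambda$ for all $t\in\mathbb{R}$. Absolute continuity and singularity (Gheondea–Kavruk). For a PLF $\mu$ on $A$ with $N_\lambda\subseteq N_\mu$: - $\mu\ll\lambda$ if there is an increasing sequence $(\mu_n)_{n\in\mathbb{N}}$ of PLFs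 with $\mu_n\uparrow\mu$ pointwise, and for each $n$ there is $t_n>0$ with $\mu_n\le t_n\lambda$. $AC[\lambda]$ is the set of all such $\mu$. - $\mu\perp\lambda$ if the only PLF majorized by both $\mu$ and $\lambda$ is $0$. $SG[\lambda]$ is the set of all such $\mu$. - The AGKL decomposition of $\mu$ with respect to $\lambda$ is $\mu=\mu_{ac}+\mu_s$, where $\mu_{ac}$ is the largest PLF that is absolutely continuous with respect to $\lambda$ and majorized by $\mu$, and $\mu_s=\mu-\mu_{ac}$, which is singular with respect to $\lambda$ (its existence is a known theorem of Gheondea and Kavruk). Weak* notions. Let $(\pi_\lambda,L^2(\lambda),\xi_\lambda)$ be the GNS representation of $\lambda$, with $\xi_\lambda=1+N_\lambda$. Put $L^\infty(\lambda)=\pi_\lambda(A)''\subseteq\mathscr{B}(L^2(\lambda))$, with the weak* topology coming from its predual. If $N_\lambda\subseteq N_\mu$, an extension of $\mu$ to $L^\infty(\lambda)$ is a PLF $\hat\mu$ on $L^\infty(\lambda)$ with $\hat\mu(\pi_\lambda(a))=\mu(a)$ for all $a\in A$. Then $\mu$ is weak* continuous with respect to $\lambda$ if it has a weak*-continuous such extension. It is weak* singular with respect to $\lambda$ if no such extension majorizes a non-zero weak*-continuous PLF on $L^\infty(\lambda)$. (The zero functional is regarded as both.) The weak* Lebesgue decomposition of $\mu$ with respect to $\lambda$ is the unique decomposition $\mu=\mu_{wc}+\mu_{ws}$ into PLFs with $\mu_{wc}$ weak* continuous, $\mu_{ws}$ weak* singular, and $\mu_{wc}$ the maximal weak* continuous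 PLF majorized by $\mu$. *)

theory Defs
  imports "HOL-Analysis.Analysis"
begin

section \<open>Unital C*-algebras and positive linear functionals\<close>

class unital_cstar_algebra = real_normed_algebra_1 + banach +
  fixes scaleC :: "complex \<Rightarrow> 'a \<Rightarrow> 'a"  (infixr \<open>*\<^sub>C\<close> 75)
    and star :: "'a \<Rightarrow> 'a"
  assumes scaleC_add_right: "c *\<^sub>C (x + y) = c *\<^sub>C x + c *\<^sub>C y"
    and scaleC_add_left: "(c + d) *\<^sub>C x = c *\<^sub>C x + d *\<^sub>C x"
    and scaleC_scaleC: "c *\<^sub>C (d *\<^sub>C x) = (c * d) *\<^sub>C x"
    and scaleC_of_real: "complex_of_real r *\<^sub>C x = r *\<^sub>R x"
    and norm_scaleC: "norm (c *\<^sub>C x) = cmod c * norm x"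
    and mult_scaleC_left: "(c *\<^sub>C x) * y = c *\<^sub>C (x * y)"
    and mult_scaleC_right: "x * (c *\<^sub>C y) = c *\<^sub>C (x * y)"
    and star_star: "star (star x) = x"
    and star_add: "star (x + y) = star x + star y"
    and star_scaleC: "star (c *\<^sub>C x) = cnj c *\<^sub>C star x"
    and star_mult: "star (x * y) = star y * star x"
    and cstar_identity: "norm (star x * x) = (norm x)\<^sup>2"

definition is_plf :: "('a::unital_cstar_algebra \<Rightarrow> complex) \<Rightarrow> bool" where
  "is_plf \<phi> \<longleftrightarrow>
     (\<forall>a b. \<phi> (a + b) = \<phi> a + \<phi> b) \<and>
     (\<forall>c a. \<phi> (c *\<^sub>C a) = c * \<phi> a) \<and>
     (\<forall>a. \<phi> (star a * a) \<in> \<real>\<^sub>\<ge>\<^sub>0)"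

definition plf_le :: "('a::unital_cstar_algebra \<Rightarrow> complex) \<Rightarrow> ('a \<Rightarrow> complex) \<Rightarrow> bool"
    (infix \<open>\<preceq>\<^sub>+\<close> 50) where
  "\<nu> \<preceq>\<^sub>+ \<mu> \<longleftrightarrow> is_plf (\<lambda>a. \<mu> a - \<nu> a)"

definition plf_null :: "('a::unital_cstar_algebra \<Rightarrow> complex) \<Rightarrow> 'a set" where
  "plf_null \<tau> = {a. \<tau> (star a * a) = 0}"

definition positive_cone :: "('a::unital_cstar_algebra \<Rightarrow> complex) set \<Rightarrow> bool" where
  "positive_cone S \<longleftrightarrow>
     S \<subseteq> {\<phi>. is_plf \<phi>} \<and>
     (\<lambda>_. 0) \<in> S \<and>
     (\<forall>\<phi>\<in>S. \<forall>\<psi>\<in>S. (\<lambda>a. \<phi> a + \<psi> a) \<in> S) \<and>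
     (\<forall>r::real. \<forall>\<phi>\<in>S. r \<ge> 0 \<longrightarrow> (\<lambda>a. complex_of_real r * \<phi> a) \<in> S)"

definition hereditary :: "('a::unital_cstar_algebra \<Rightarrow> complex) set \<Rightarrow> bool" where
  "hereditary S \<longleftrightarrow> (\<forall>\<phi>\<in>S. \<forall>\<psi>. is_plf \<psi> \<and> \<psi> \<preceq>\<^sub>+ \<phi> \<longrightarrow> \<psi> \<in> S)"


section \<open>C*-dynamical systems and KMS functionals\<close>

definition star_automorphism :: "('a::unital_cstar_algebra \<Rightarrow> 'a) \<Rightarrow> bool" where
  "star_automorphism \<alpha> \<longleftrightarrow>
     bij \<alpha> \<and>
     (\<forall>a b. \<alpha> (a + b) = \<alpha> a + \<alpha> b) \<and>
     (\<forall>c a. \<alpha> (c *\<^sub>C a) = c *\<^sub>C \<alpha> a) \<and>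
     (\<forall>a b. \<alpha> (a * b) = \<alpha> a * \<alpha> b) \<and>
     (\<forall>a. \<alpha> (star a) = star (\<alpha> a))"

definition cstar_dynamical_system :: "(real \<Rightarrow> 'a::unital_cstar_algebra \<Rightarrow> 'a) \<Rightarrow> bool" where
  "cstar_dynamical_system \<sigma> \<longleftrightarrow>
     (\<forall>t. star_automorphism (\<sigma> t)) \<and>
     (\<forall>s t. \<sigma> (s + t) = \<sigma> s \<circ> \<sigma> t) \<and>
     continuous_on UNIV (\<lambda>(t, a). \<sigma> t a)"

text \<open>Analyticity on the open strip is norm-holomorphy: the Frechet derivative exists and is
  complex linear, i.e. of the form \<open>h \<mapsto> h *\<^sub>C D\<close>.\<close>

definition strip_extension ::
    "(real \<Rightarrow> 'a::unital_cstar_algebra \<Rightarrow> 'a) \<Rightarrow> 'a \<Rightarrow> (complex \<Rightarrow> 'a) \<Rightarrow> bool" where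
  "strip_extension \<sigma> a f \<longleftrightarrow>
     continuous_on {z. 0 \<le> Im z \<and> Im z \<le> 1} f \<and>
     (\<forall>z. 0 < Im z \<and> Im z < 1 \<longrightarrow> (\<exists>D. (f has_derivative (\<lambda>h. h *\<^sub>C D)) (at z))) \<and>
     (\<forall>t. f (complex_of_real t) = \<sigma> t a)"

text \<open>The extension is unique on the closed strip, so \<open>f \<i>\<close> below is \<open>\<sigma>\<^sub>i(a)\<close>.\<close>

definition is_kms_plf ::
    "(real \<Rightarrow> 'a::unital_cstar_algebra \<Rightarrow> 'a) \<Rightarrow> ('a \<Rightarrow> complex) \<Rightarrow> bool" where
  "is_kms_plf \<sigma> lam \<longleftrightarrow>
     is_plf lam \<and>
     (\<forall>a. \<exists>f. strip_extension \<sigma> a f \<and> (\<forall>b. lam (a * b) = lam (b * f \<i>))) \<and>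
     (\<forall>t a. lam (\<sigma> t a) = lam a)"


section \<open>Absolute continuity, singularity and the AGKL decomposition\<close>

definition AC :: "('a::unital_cstar_algebra \<Rightarrow> complex) \<Rightarrow> ('a \<Rightarrow> complex) set" where
  "AC lam = {\<mu>. is_plf \<mu> \<and> plf_null lam \<subseteq> plf_null \<mu> \<and>
     (\<exists>(m :: nat \<Rightarrow> 'a \<Rightarrow> complex) (t :: nat \<Rightarrow> real).
        (\<forall>n. is_plf (m n)) \<and>
        (\<forall>n. m n \<preceq>\<^sub>+ m (Suc n)) \<and>
        (\<forall>a. (\<lambda>n. m n a) \<longlonglongrightarrow> \<mu> a) \<and>
        (\<forall>n. t n > 0 \<and> m n \<preceq>\<^sub>+ (\<lambda>a. complex_of_real (t n) * lam a)))}"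

definition SG :: "('a::unital_cstar_algebra \<Rightarrow> complex) \<Rightarrow> ('a \<Rightarrow> complex) set" where
  "SG lam = {\<mu>. is_plf \<mu> \<and> plf_null lam \<subseteq> plf_null \<mu> \<and>
     (\<forall>\<rho>. is_plf \<rho> \<and> \<rho> \<preceq>\<^sub>+ \<mu> \<and> \<rho> \<preceq>\<^sub>+ lam \<longrightarrow> \<rho> = (\<lambda>_. 0))}"

text \<open>The greatest element below exists whenever \<open>\<mu>\<close> is a PLF with \<open>plf_null lam \<subseteq> plf_null \<mu>\<close>
  (Gheondea and Kavruk), and is unique because \<open>\<preceq>\<^sub>+\<close> is antisymmetric; only in that case
  is \<open>ac_part\<close> meaningful.\<close>

definition ac_part ::
    "('a::unital_cstar_algebra \<Rightarrow> complex) \<Rightarrow> ('a \<Rightarrow> complex) \<Rightarrow> 'a \<Rightarrow> complex" where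
  "ac_part lam \<mu> =
     (THE \<rho>. \<rho> \<in> AC lam \<and> \<rho> \<preceq>\<^sub>+ \<mu> \<and> (\<forall>\<rho>'\<in>AC lam. \<rho>' \<preceq>\<^sub>+ \<mu> \<longrightarrow> \<rho>' \<preceq>\<^sub>+ \<rho>))"

definition s_part ::
    "('a::unital_cstar_algebra \<Rightarrow> complex) \<Rightarrow> ('a \<Rightarrow> complex) \<Rightarrow> 'a \<Rightarrow> complex" where
  "s_part lam \<mu> = (\<lambda>a. \<mu> a - ac_part lam \<mu> a)"


section \<open>Operators on a Hilbert space with explicit carrier\<close>

text \<open>The Hilbert space of the GNS construction depends on the functional, so it is a carrier set
  with operations rather than a type. Inner products are linear in the first argument; operators
  are functions that are \<open>undefined\<close> outside the carrier.\<close>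

record 'h hilb =
  hcarrier :: "'h set"
  hplus :: "'h \<Rightarrow> 'h \<Rightarrow> 'h"
  hscale :: "complex \<Rightarrow> 'h \<Rightarrow> 'h"
  hinner :: "'h \<Rightarrow> 'h \<Rightarrow> complex"

definition hnorm :: "'h hilb \<Rightarrow> 'h \<Rightarrow> real" where
  "hnorm H h = sqrt (Re (hinner H h h))"

definition bounded_ops :: "'h hilb \<Rightarrow> ('h \<Rightarrow> 'h) set" where
  "bounded_ops H = {T \<in> hcarrier H \<rightarrow>\<^sub>E hcarrier H.
     (\<forall>h\<in>hcarrier H. \<forall>k\<in>hcarrier H. T (hplus H h k) = hplus H (T h) (T k)) \<and>
     (\<forall>c. \<forall>h\<in>hcarrier H. T (hscale H c h) = hscale H c (T h)) \<and>
     (\<exists>K. \<forall>h\<in>hcarrier H. hnorm H (T h) \<le> K * hnorm H h)}"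

definition op_plus :: "'h hilb \<Rightarrow> ('h \<Rightarrow> 'h) \<Rightarrow> ('h \<Rightarrow> 'h) \<Rightarrow> 'h \<Rightarrow> 'h" where
  "op_plus H S T = (\<lambda>h\<in>hcarrier H. hplus H (S h) (T h))"

definition op_scale :: "'h hilb \<Rightarrow> complex \<Rightarrow> ('h \<Rightarrow> 'h) \<Rightarrow> 'h \<Rightarrow> 'h" where
  "op_scale H c T = (\<lambda>h\<in>hcarrier H. hscale H c (T h))"

definition is_adjoint :: "'h hilb \<Rightarrow> ('h \<Rightarrow> 'h) \<Rightarrow> ('h \<Rightarrow> 'h) \<Rightarrow> bool" where
  "is_adjoint H S T \<longleftrightarrow>
     (\<forall>h\<in>hcarrier H. \<forall>k\<in>hcarrier H. hinner H (S h) k = hinner H h (T k))"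

definition commutant :: "'h hilb \<Rightarrow> ('h \<Rightarrow> 'h) set \<Rightarrow> ('h \<Rightarrow> 'h) set" where
  "commutant H M =
     {T \<in> bounded_ops H. \<forall>S\<in>M. compose (hcarrier H) T S = compose (hcarrier H) S T}"

text \<open>Positive linear functionals on a *-closed algebra \<open>M\<close> of operators; only the values on \<open>M\<close>
  matter.\<close>

definition op_plf :: "'h hilb \<Rightarrow> ('h \<Rightarrow> 'h) set \<Rightarrow> (('h \<Rightarrow> 'h) \<Rightarrow> complex) \<Rightarrow> bool" where
  "op_plf H M \<phi> \<longleftrightarrow>
     (\<forall>S\<in>M. \<forall>T\<in>M. \<phi> (op_plus H S T) = \<phi> S + \<phi> T) \<and>
     (\<forall>c. \<forall>T\<in>M. \<phi> (op_scale H c T) = c * \<phi> T) \<and>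
     (\<forall>S\<in>M. \<forall>T\<in>M. is_adjoint H S T \<longrightarrow> \<phi> (compose (hcarrier H) S T) \<in> \<real>\<^sub>\<ge>\<^sub>0)"

text \<open>The predual of a von Neumann algebra on \<open>H\<close> consists of the restrictions of the functionals
  \<open>T \<mapsto> tr (\<rho> T)\<close> with \<open>\<rho>\<close> trace class, which are exactly the functionals
  \<open>T \<mapsto> (\<Sum>n. \<langle>T h\<^sub>n, k\<^sub>n\<rangle>)\<close> with \<open>h\<close> and \<open>k\<close> square summable.\<close>

definition square_summable :: "'h hilb \<Rightarrow> (nat \<Rightarrow> 'h) \<Rightarrow> bool" where
  "square_summable H h \<longleftrightarrow> range h \<subseteq> hcarrier H \<and> summable (\<lambda>n. (hnorm H (h n))\<^sup>2)"

definition predual :: "'h hilb \<Rightarrow> (('h \<Rightarrow> 'h) \<Rightarrow> complex) set" where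
  "predual H = {(\<lambda>T. \<Sum>n. hinner H (T (h n)) (k n)) | h k.
     square_summable H h \<and> square_summable H k}"

definition weak_star_topology :: "'h hilb \<Rightarrow> ('h \<Rightarrow> 'h) set \<Rightarrow> ('h \<Rightarrow> 'h) topology" where
  "weak_star_topology H M =
     topology_generated_by {{T \<in> M. \<omega> T \<in> U} | \<omega> U. \<omega> \<in> predual H \<and> open U}"


section \<open>The GNS representation\<close>

definition gns_seminorm :: "('a::unital_cstar_algebra \<Rightarrow> complex) \<Rightarrow> 'a \<Rightarrow> real" where
  "gns_seminorm lam a = sqrt (Re (lam (star a * a)))"

definition gns_cauchy :: "('a::unital_cstar_algebra \<Rightarrow> complex) \<Rightarrow> (nat \<Rightarrow> 'a) set" where
  "gns_cauchy lam =
     {X. \<forall>e>0. \<exists>N. \<forall>m\<ge>N. \<forall>n\<ge>N. gns_seminorm lam (X m - X n) < e}"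

definition gns_rel :: "('a::unital_cstar_algebra \<Rightarrow> complex) \<Rightarrow> ((nat \<Rightarrow> 'a) \<times> (nat \<Rightarrow> 'a)) set" where
  "gns_rel lam = {(X, Y). X \<in> gns_cauchy lam \<and> Y \<in> gns_cauchy lam \<and>
     (\<lambda>n. gns_seminorm lam (X n - Y n)) \<longlonglongrightarrow> 0}"

definition gns_rep :: "(nat \<Rightarrow> 'a) set \<Rightarrow> nat \<Rightarrow> 'a" where
  "gns_rep C = (SOME X. X \<in> C)"

text \<open>\<open>L\<^sup>2(\<lambda>)\<close>, the completion of \<open>A / N\<^sub>\<lambda>\<close> under \<open>\<langle>a, b\<rangle> = \<lambda>(b\<^sup>* a)\<close>: Cauchy sequences in \<open>A\<close>
  modulo sequences that are null for the seminorm, which also divides out \<open>N\<^sub>\<lambda>\<close>. The operations do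
  not depend on the representatives.\<close>

definition L2 :: "('a::unital_cstar_algebra \<Rightarrow> complex) \<Rightarrow> (nat \<Rightarrow> 'a) set hilb" where
  "L2 lam = \<lparr>
     hcarrier = gns_cauchy lam // gns_rel lam,
     hplus = (\<lambda>C D. gns_rel lam `` {\<lambda>n. gns_rep C n + gns_rep D n}),
     hscale = (\<lambda>c C. gns_rel lam `` {\<lambda>n. c *\<^sub>C gns_rep C n}),
     hinner = (\<lambda>C D. lim (\<lambda>n. lam (star (gns_rep D n) * gns_rep C n)))\<rparr>"

definition gns_pi ::
    "('a::unital_cstar_algebra \<Rightarrow> complex) \<Rightarrow> 'a \<Rightarrow> (nat \<Rightarrow> 'a) set \<Rightarrow> (nat \<Rightarrow> 'a) set" where
  "gns_pi lam a = (\<lambda>C\<in>hcarrier (L2 lam). gns_rel lam `` {\<lambda>n. a * gns_rep C n})"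

definition Linf ::
    "('a::unital_cstar_algebra \<Rightarrow> complex) \<Rightarrow> ((nat \<Rightarrow> 'a) set \<Rightarrow> (nat \<Rightarrow> 'a) set) set" where
  "Linf lam = commutant (L2 lam) (commutant (L2 lam) (range (gns_pi lam)))"


section \<open>Weak* continuity, weak* singularity and the weak* Lebesgue decomposition\<close>

definition Linf_plf ::
    "('a::unital_cstar_algebra \<Rightarrow> complex) \<Rightarrow>
     (((nat \<Rightarrow> 'a) set \<Rightarrow> (nat \<Rightarrow> 'a) set) \<Rightarrow> complex) \<Rightarrow> bool" where
  "Linf_plf lam \<phi> \<longleftrightarrow> op_plf (L2 lam) (Linf lam) \<phi>"

definition Linf_extension ::
    "('a::unital_cstar_algebra \<Rightarrow> complex) \<Rightarrow> ('a \<Rightarrow> complex) \<Rightarrow>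
     (((nat \<Rightarrow> 'a) set \<Rightarrow> (nat \<Rightarrow> 'a) set) \<Rightarrow> complex) \<Rightarrow> bool" where
  "Linf_extension lam \<mu> \<phi> \<longleftrightarrow> Linf_plf lam \<phi> \<and> (\<forall>a. \<phi> (gns_pi lam a) = \<mu> a)"

definition Linf_weak_star_continuous ::
    "('a::unital_cstar_algebra \<Rightarrow> complex) \<Rightarrow>
     (((nat \<Rightarrow> 'a) set \<Rightarrow> (nat \<Rightarrow> 'a) set) \<Rightarrow> complex) \<Rightarrow> bool" where
  "Linf_weak_star_continuous lam \<phi> \<longleftrightarrow>
     continuous_map (weak_star_topology (L2 lam) (Linf lam)) euclidean \<phi>"

definition weak_star_cont ::
    "('a::unital_cstar_algebra \<Rightarrow> complex) \<Rightarrow> ('a \<Rightarrow> complex) \<Rightarrow> bool" where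
  "weak_star_cont lam \<mu> \<longleftrightarrow> is_plf \<mu> \<and> plf_null lam \<subseteq> plf_null \<mu> \<and>
     (\<exists>\<phi>. Linf_extension lam \<mu> \<phi> \<and> Linf_weak_star_continuous lam \<phi>)"

definition weak_star_sing ::
    "('a::unital_cstar_algebra \<Rightarrow> complex) \<Rightarrow> ('a \<Rightarrow> complex) \<Rightarrow> bool" where
  "weak_star_sing lam \<mu> \<longleftrightarrow> is_plf \<mu> \<and> plf_null lam \<subseteq> plf_null \<mu> \<and>
     \<not> (\<exists>\<phi> \<omega>. Linf_extension lam \<mu> \<phi> \<and>
          Linf_plf lam \<omega> \<and> Linf_weak_star_continuous lam \<omega> \<and> (\<exists>T\<in>Linf lam. \<omega> T \<noteq> 0) \<and>
          Linf_plf lam (\<lambda>T. \<phi> T - \<omega> T))"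

definition weak_star_decomposition ::
    "('a::unital_cstar_algebra \<Rightarrow> complex) \<Rightarrow> ('a \<Rightarrow> complex) \<Rightarrow>
     ('a \<Rightarrow> complex) \<Rightarrow> ('a \<Rightarrow> complex) \<Rightarrow> bool" where
  "weak_star_decomposition lam \<mu> \<mu>\<^sub>1 \<mu>\<^sub>2 \<longleftrightarrow>
     \<mu> = (\<lambda>a. \<mu>\<^sub>1 a + \<mu>\<^sub>2 a) \<and>
     weak_star_cont lam \<mu>\<^sub>1 \<and> weak_star_sing lam \<mu>\<^sub>2 \<and>
     (\<forall>\<rho>. weak_star_cont lam \<rho> \<and> \<rho> \<preceq>\<^sub>+ \<mu> \<longrightarrow> \<rho> \<preceq>\<^sub>+ \<mu>\<^sub>1)"

definition wc_part ::
    "('a::unital_cstar_algebra \<Rightarrow> complex) \<Rightarrow> ('a \<Rightarrow> complex) \<Rightarrow> 'a \<Rightarrow> complex" where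
  "wc_part lam \<mu> = (THE \<mu>\<^sub>1. \<exists>\<mu>\<^sub>2. weak_star_decomposition lam \<mu> \<mu>\<^sub>1 \<mu>\<^sub>2)"

definition ws_part ::
    "('a::unital_cstar_algebra \<Rightarrow> complex) \<Rightarrow> ('a \<Rightarrow> complex) \<Rightarrow> 'a \<Rightarrow> complex" where
  "ws_part lam \<mu> = (THE \<mu>\<^sub>2. \<exists>\<mu>\<^sub>1. weak_star_decomposition lam \<mu> \<mu>\<^sub>1 \<mu>\<^sub>2)"

end

theory Submission
  imports Defs
begin

text \<open>The KMS condition enters only through the existence, for every \<open>a\<close>, of some \<open>a'\<close> with
  \<open>lam (a b) = lam (b a')\<close> for all \<open>b\<close>. By the open mapping theorem \<open>a'\<close> can be chosen with
  \<open>\<parallel>a'\<parallel> \<le> K \<parallel>a\<parallel>\<close>, and log-convexity of the moments of \<open>a \<mapsto> a'\<close> in \<open>L\<^sup>2(lam)\<close> gives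
  \<open>lam (a a\<^sup>*) \<le> K lam (a\<^sup>* a)\<close>: the involution and all right multiplications are bounded on
  \<open>L\<^sup>2(lam)\<close>.

  The absolutely continuous part of \<open>\<mu>\<close> is the limit of the parallel sums \<open>\<mu> : (n lam)\<close>. Using the bounded
  involution, \<open>\<mu> \<lless> lam\<close> is equivalent to an \<open>\<epsilon>\<close>-\<open>\<delta>\<close> condition on contractions, which is evidently
  inherited by smaller functionals, and singularity is equivalent to the existence of \<open>b\<close> close to \<open>1\<close> in
  \<open>L\<^sup>2(\<mu>)\<close> and to \<open>0\<close> in \<open>L\<^sup>2(lam)\<close>. Given such \<open>b\<^sub>1, b\<^sub>2\<close> for \<open>\<mu>, \<nu>\<close>, the element
  \<open>p (\<eta> + p)\<^sup>-\<^sup>1\<close> with \<open>p = b\<^sub>1 b\<^sub>1\<^sup>* + b\<^sub>2 b\<^sub>2\<^sup>*\<close> serves both. So singular functionals form a cone;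
  as absolutely continuous ones form a hereditary cone, decompositions are unique and additive.

  Weak* continuous functionals satisfy the \<open>\<epsilon>\<close>-\<open>\<delta>\<close> condition because \<open>a h \<rightarrow> 0\<close> for every
  \<open>h \<in> L\<^sup>2(lam)\<close> as the contraction \<open>a\<close> tends to \<open>0\<close> in \<open>L\<^sup>2(lam)\<close>. Conversely an absolutely
  continuous functional is a series of vector functionals, hence extends to an element of the predual.\<close>

section \<open>Positive linear functionals on a unital C*-algebra\<close>

text \<open>The seminorm \<open>gns_norm lam\<close> is adapted to left multiplication. For a
  general \<open>lam\<close>, smallness of \<open>gns_norm lam b\<close> says nothing about
  \<open>gns_norm lam (star b)\<close>, and this is the obstacle to heredity of
  \<open>AC lam\<close>, to sums in \<open>SG lam\<close> and to the comparison with weak*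
  continuity. The \<epsilon>-\<delta> condition is applied to an element built from
  \<open>star x * x - 1\<close> with \<open>x = 1 - b\<close>, and this difference contains
  \<open>star b\<close>. The treatment of singular sums involves \<open>b * star b\<close>. That
  \<open>a\<close> applied to a fixed vector is small requires \<open>a * b\<close> to be small for
  fixed \<open>b\<close>, which is a statement about right multiplication. Each time an adjoint has
  to be estimated in the seminorm of \<open>lam\<close>. The order of the factors in
  \<open>b * star b\<close> is forced. If \<open>b * star b \<le> \<eta> p\<close>, an approximate
  inverse \<open>q\<close> of \<open>1 + p\<close> makes \<open>q * b\<close> small in every GNS
  seminorm, which serves \<open>\<mu>\<close>; applied to \<open>q * b * star b\<close> the same
  estimate leaves only \<open>star b\<close> to be bounded in the seminorm of
  \<open>lam\<close>.\<close>

lemma scaleC_one [simp]: "1 *\<^sub>C x = (x :: 'a::unital_cstar_algebra)"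
  using scaleC_of_real[of 1 x] by simp

lemma scaleC_minus_one [simp]: "(-1) *\<^sub>C x = - (x :: 'a::unital_cstar_algebra)"
  using scaleC_of_real[of "-1" x] by simp

lemma scaleC_zero_left [simp]: "0 *\<^sub>C x = (0 :: 'a::unital_cstar_algebra)"
  using scaleC_of_real[of 0 x] by simp

lemma star_scaleR: "star (r *\<^sub>R (x :: 'a::unital_cstar_algebra)) = r *\<^sub>R star x"
  by (simp flip: scaleC_of_real add: star_scaleC)

lemma star_zero [simp]: "star (0 :: 'a::unital_cstar_algebra) = 0"
  using star_scaleR[of 0 0] by simp

lemma star_minus: "star (- x) = - star (x :: 'a::unital_cstar_algebra)"
  using star_scaleR[of "-1" x] by simp

lemma star_diff: "star (x - y) = star x - star (y :: 'a::unital_cstar_algebra)"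
  using star_add[of x "- y"] star_minus[of y] by simp

lemma star_one [simp]: "star (1 :: 'a::unital_cstar_algebra) = 1"
  by (metis star_mult star_star mult_1_left mult_1_right)

lemma star_power: "star (x ^ n) = star (x :: 'a::unital_cstar_algebra) ^ n"
  by (induction n) (auto simp: star_mult power_commutes)

lemma norm_star [simp]: "norm (star x) = norm (x :: 'a::unital_cstar_algebra)"
proof -
  have le: "norm y \<le> norm (star y)" for y :: 'a
  proof (cases "y = 0")
    case False
    have "norm y * norm y = norm (star y * y)"
      by (simp add: cstar_identity power2_eq_square)
    also have "\<dots> \<le> norm (star y) * norm y"
      by (rule norm_mult_ineq)
    finally show ?thesis
      using False by simp
  qed simp
  show ?thesis
    using le[of x] le[of "star x"] star_star[of x] by simp
qed

lemmas star_simps = star_mult star_star star_add star_diff star_minus star_scaleC star_scaleR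

lemma bounded_linear_star: "bounded_linear (star :: 'a::unital_cstar_algebra \<Rightarrow> 'a)"
  by (rule bounded_linear_intro[of _ 1]) (auto simp: star_add star_scaleR)

text \<open>Writing \<open>c = 1 - y\<close> turns \<open>c * c = 1 - h\<close> into the fixed point
  equation \<open>y = (1/2) *\<^sub>R (h + y * y)\<close>, which Banach's theorem solves among the
  self-adjoint elements.\<close>

lemma selfadjoint_sqrt:
  fixes h :: "'a::unital_cstar_algebra"
  assumes "star h = h" "norm h < 1"
  obtains c where "star c = c" "c * c = 1 - h"
proof -
  \<comment> \<open>\<open>r\<close> is the smaller root of
    \<open>norm h + r\<^sup>2 = 2 * r\<close>: the map \<open>f\<close> below then sends the ball of
    radius \<open>r\<close> to itself, with Lipschitz constant \<open>r < 1\<close>.\<close>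
  define r where "r = 1 - sqrt (1 - norm h)"
  have r: "0 \<le> r" "r < 1" "norm h + r\<^sup>2 = 2 * r"
    using assms(2) by (auto simp: r_def power2_eq_square algebra_simps)
  define S where "S = {y::'a. star y = y} \<inter> cball 0 r"
  define f where "f y = (1/2) *\<^sub>R (h + y * y)" for y
  have "closed {y::'a. star y = y}"
    by (intro closed_Collect_eq linear_continuous_on bounded_linear_star continuous_on_id)
  then have "complete S"
    by (simp add: S_def complete_eq_closed closed_Int)
  moreover have "S \<noteq> {}"
    using r by (auto simp: S_def set_eq_iff intro!: exI[of _ 0])
  moreover have "f ` S \<subseteq> S"
  proof
    fix z assume "z \<in> f ` S"
    then obtain y where y: "z = f y" "star y = y" "norm y \<le> r"
      by (auto simp: S_def)
    have "norm z \<le> (norm h + norm y * norm y) / 2"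
      using norm_triangle_ineq[of h "y * y"] norm_mult_ineq[of y y] by (simp add: y(1) f_def)
    also have "\<dots> \<le> (norm h + r\<^sup>2) / 2"
      using y(3) mult_mono[OF y(3) y(3)] r(1) by (simp add: power2_eq_square)
    finally show "z \<in> S"
      using y r(3) assms(1) by (simp add: S_def f_def star_simps)
  qed
  moreover have "dist (f x) (f y) \<le> r * dist x y" if "x \<in> S" "y \<in> S" for x y
  proof -
    have "f x - f y = (1/2) *\<^sub>R (x * (x - y) + (x - y) * y)"
      by (simp add: f_def algebra_simps)
    then have "dist (f x) (f y) \<le> (norm x * norm (x - y) + norm (x - y) * norm y) / 2"
      using norm_triangle_ineq[of "x * (x - y)" "(x - y) * y"] norm_mult_ineq[of x "x - y"]
        norm_mult_ineq[of "x - y" y] by (simp add: dist_norm)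
    also have "\<dots> \<le> (r * norm (x - y) + norm (x - y) * r) / 2"
      using that r(1) by (intro divide_right_mono add_mono mult_mono) (auto simp: S_def)
    finally show ?thesis
      by (simp add: dist_norm)
  qed
  ultimately have "\<exists>!y\<in>S. f y = y"
    using r by (intro Banach_fix) auto
  then obtain y where y: "star y = y" "f y = y"
    by (auto simp: S_def)
  have "h + y * y = 2 *\<^sub>R f y"
    by (simp add: f_def)
  then have "h + y * y = y + y"
    by (simp add: y(2) scaleR_2)
  then have "(1 - y) * (1 - y) = 1 - h"
    by (simp add: algebra_simps)
  then show thesis
    using that[of "1 - y"] y(1) by (simp add: star_simps)
qed

section \<open>The GNS seminorm of a functional and its Cauchy-Schwarz inequality\<close>

abbreviation gns_norm :: "('a::unital_cstar_algebra \<Rightarrow> complex) \<Rightarrow> 'a \<Rightarrow> real" where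
  "gns_norm \<equiv> gns_seminorm"

lemma is_plfI:
  assumes "\<And>a b. \<phi> (a + b) = \<phi> a + \<phi> b" "\<And>c a. \<phi> (c *\<^sub>C a) = c * \<phi> a"
    "\<And>a. Im (\<phi> (star a * a)) = 0" "\<And>a. 0 \<le> Re (\<phi> (star a * a))"
  shows "is_plf \<phi>"
  using assms by (auto simp: is_plf_def complex_nonneg_Reals_iff)

context
  fixes \<phi> :: "'a::unital_cstar_algebra \<Rightarrow> complex"
  assumes plf: "is_plf \<phi>"
begin

lemma plf_add: "\<phi> (a + b) = \<phi> a + \<phi> b"
  using plf by (simp add: is_plf_def)

lemma plf_scaleC: "\<phi> (c *\<^sub>C a) = c * \<phi> a"
  using plf by (simp add: is_plf_def)

lemma plf_scaleR: "\<phi> (r *\<^sub>R a) = of_real r * \<phi> a"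
  by (simp flip: scaleC_of_real add: plf_scaleC)

lemma plf_zero: "\<phi> 0 = 0"
  using plf_scaleR[of 0 0] by simp

lemma plf_minus: "\<phi> (- a) = - \<phi> a"
  using plf_scaleR[of "-1" a] by simp

lemma plf_diff: "\<phi> (a - b) = \<phi> a - \<phi> b"
  using plf_add[of a "- b"] plf_minus[of b] by simp

lemmas plf_linear = plf_add plf_diff plf_minus plf_scaleC plf_scaleR plf_zero

lemma plf_Re_pos: "0 \<le> Re (\<phi> (star a * a))"
  and plf_Im_pos: "Im (\<phi> (star a * a)) = 0"
  using plf by (auto simp: is_plf_def complex_nonneg_Reals_iff)

lemma plf_star_mult_self: "\<phi> (star a * a) = of_real ((gns_norm \<phi> a)\<^sup>2)"
  using plf_Re_pos[of a] plf_Im_pos[of a] by (simp add: gns_seminorm_def complex_eq_iff)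

lemma gns_norm_sq: "(gns_norm \<phi> a)\<^sup>2 = Re (\<phi> (star a * a))"
  using plf_Re_pos[of a] by (simp add: gns_seminorm_def)

lemma gns_norm_nonneg: "0 \<le> gns_norm \<phi> a"
  using plf_Re_pos[of a] by (simp add: gns_seminorm_def)

text \<open>Polarization: \<open>\<phi>\<close> is real on the squares of \<open>a + b\<close> and
  of \<open>\<i> *\<^sub>C a + b\<close>, which settles the imaginary and the real part
  respectively.\<close>

lemma plf_hermitian: "\<phi> (star b * a) = cnj (\<phi> (star a * b))"
proof -
  have 1: "Im (\<phi> (star b * a) + \<phi> (star a * b)) = 0"
    using plf_Im_pos[of "a + b"] plf_Im_pos[of a] plf_Im_pos[of b]
    by (simp add: star_simps algebra_simps plf_linear)
  have "Im (\<phi> (star (\<i> *\<^sub>C a + b) * (\<i> *\<^sub>C a + b))) = 0"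
    by (rule plf_Im_pos)
  then have 2: "Re (\<phi> (star b * a)) = Re (\<phi> (star a * b))"
    using plf_Im_pos[of a] plf_Im_pos[of b]
    by (simp add: star_simps distrib_left distrib_right plf_linear mult_scaleC_left
        mult_scaleC_right scaleC_scaleC)
  show ?thesis
    using 1 2 by (simp add: complex_eq_iff)
qed

lemma gns_norm_add_sq:
  "(gns_norm \<phi> (a + b))\<^sup>2 = (gns_norm \<phi> a)\<^sup>2 + 2 * Re (\<phi> (star b * a)) + (gns_norm \<phi> b)\<^sup>2"
  using plf_hermitian[of a b] by (simp add: gns_norm_sq star_simps algebra_simps plf_linear)

lemma gns_norm_scaleC: "gns_norm \<phi> (c *\<^sub>C a) = cmod c * gns_norm \<phi> a"
proof -
  have "\<phi> (star (c *\<^sub>C a) * (c *\<^sub>C a)) = of_real ((cmod c)\<^sup>2) * \<phi> (star a * a)"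
    unfolding complex_norm_square
    by (simp add: star_simps mult_scaleC_left mult_scaleC_right scaleC_scaleC plf_linear mult.assoc)
  then have "(gns_norm \<phi> (c *\<^sub>C a))\<^sup>2 = (cmod c * gns_norm \<phi> a)\<^sup>2"
    by (simp add: gns_norm_sq power_mult_distrib)
  then show ?thesis
    using gns_norm_nonneg by (simp add: power2_eq_iff_nonneg)
qed

lemma gns_norm_scaleR: "gns_norm \<phi> (r *\<^sub>R a) = \<bar>r\<bar> * gns_norm \<phi> a"
  by (simp flip: scaleC_of_real add: gns_norm_scaleC)

lemma gns_norm_minus: "gns_norm \<phi> (- a) = gns_norm \<phi> a"
  using gns_norm_scaleR[of "-1" a] by simp

lemma gns_norm_minus_commute: "gns_norm \<phi> (a - b) = gns_norm \<phi> (b - a)"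
  using gns_norm_minus[of "a - b"] by simp

lemma gns_norm_zero: "gns_norm \<phi> 0 = 0"
  using gns_norm_scaleR[of 0 0] by simp

lemma plf_Cauchy_Schwarz: "cmod (\<phi> (star b * a)) \<le> gns_norm \<phi> b * gns_norm \<phi> a"
proof -
  have *: "Re (\<phi> (star b * a)) \<le> gns_norm \<phi> b * gns_norm \<phi> a" for a b
  proof -
    let ?x = "gns_norm \<phi> a" and ?y = "gns_norm \<phi> b" and ?z = "Re (\<phi> (star b * a))"
    have q: "0 \<le> s\<^sup>2 * ?x\<^sup>2 - 2 * s * t * ?z + t\<^sup>2 * ?y\<^sup>2" for s t
    proof -
      have "0 \<le> (gns_norm \<phi> (s *\<^sub>R a + (-t) *\<^sub>R b))\<^sup>2"
        by simp
      also have "\<dots> = s\<^sup>2 * ?x\<^sup>2 - 2 * s * t * ?z + t\<^sup>2 * ?y\<^sup>2"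
        unfolding gns_norm_add_sq gns_norm_scaleR
        by (simp add: star_scaleR star_minus plf_scaleR plf_minus power_mult_distrib)
      finally show ?thesis .
    qed
    \<comment> \<open>The quadratic form is evaluated at \<open>s = ?y + e\<close> and
      \<open>t = ?x + e\<close>; the shift by \<open>e\<close> permits the division even where a
      seminorm vanishes.\<close>
    have pos: "?z \<le> (?x + e) * (?y + e)" if "e > 0" for e
    proof -
      let ?X = "?x + e" and ?Y = "?y + e"
      have XY: "0 < ?X" "0 < ?Y"
        using gns_norm_nonneg[of a] gns_norm_nonneg[of b] that by linarith+
      have "2 * ?Y * ?X * ?z \<le> ?Y\<^sup>2 * ?x\<^sup>2 + ?X\<^sup>2 * ?y\<^sup>2"
        using q[of ?Y ?X] by simp
      also have "\<dots> \<le> ?Y\<^sup>2 * ?X\<^sup>2 + ?X\<^sup>2 * ?Y\<^sup>2"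
        using gns_norm_nonneg[of a] gns_norm_nonneg[of b] that
        by (intro add_mono mult_left_mono power_mono) auto
      finally have "(?Y * ?X) * ?z \<le> (?Y * ?X) * (?X * ?Y)"
        by (simp add: power2_eq_square algebra_simps)
      then show ?thesis
        using XY by (simp add: mult_le_cancel_left_pos)
    qed
    have "((\<lambda>e. (?x + e) * (?y + e)) \<longlongrightarrow> (?x + 0) * (?y + 0)) (at_right 0)"
      by (intro tendsto_intros)
    then have "?z \<le> (?x + 0) * (?y + 0)"
      by (rule tendsto_lowerbound)
        (auto intro!: eventually_at_rightI[of 0 1] pos)
    then show ?thesis
      by (simp add: mult.commute)
  qed
  \<comment> \<open>A phase that rotates the value onto the nonnegative axis reduces the modulus to
    the real part.\<close>
  obtain u where u: "cmod u = 1" "u * \<phi> (star b * a) = of_real (cmod (\<phi> (star b * a)))"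
  proof (cases "\<phi> (star b * a) = 0")
    case False
    then show thesis
      by (intro that[of "of_real (cmod (\<phi> (star b * a))) / \<phi> (star b * a)"])
        (auto simp: norm_divide)
  qed (auto intro: that[of 1])
  show ?thesis
    using *[of b "u *\<^sub>C a"] u by (simp add: mult_scaleC_right plf_linear gns_norm_scaleC)
qed

lemma gns_norm_triangle: "gns_norm \<phi> (a + b) \<le> gns_norm \<phi> a + gns_norm \<phi> b"
proof (rule power2_le_imp_le)
  have "Re (\<phi> (star b * a)) \<le> gns_norm \<phi> b * gns_norm \<phi> a"
    using plf_Cauchy_Schwarz[of b a] complex_Re_le_cmod order_trans by blast
  then show "(gns_norm \<phi> (a + b))\<^sup>2 \<le> (gns_norm \<phi> a + gns_norm \<phi> b)\<^sup>2"
    unfolding gns_norm_add_sq by (simp add: power2_sum algebra_simps)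
qed (use gns_norm_nonneg[of a] gns_norm_nonneg[of b] in simp)

lemma gns_norm_triangle_diff: "gns_norm \<phi> (a - b) \<le> gns_norm \<phi> a + gns_norm \<phi> b"
  using gns_norm_triangle[of a "- b"] by (simp add: gns_norm_minus)

lemma gns_norm_sum: "gns_norm \<phi> (sum f I) \<le> (\<Sum>i\<in>I. gns_norm \<phi> (f i))"
proof (induction I rule: infinite_finite_induct)
  case (insert x F)
  then show ?case
    using gns_norm_triangle[of "f x" "sum f F"] by simp
qed (auto simp: gns_norm_zero)

lemma gns_norm_parallelogram:
  "(gns_norm \<phi> (a + b))\<^sup>2 + (gns_norm \<phi> (a - b))\<^sup>2 = 2 * (gns_norm \<phi> a)\<^sup>2 + 2 * (gns_norm \<phi> b)\<^sup>2"
  by (simp add: gns_norm_sq star_simps algebra_simps plf_linear)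

lemma plf_norm_le: "cmod (\<phi> a) \<le> gns_norm \<phi> 1 * gns_norm \<phi> a"
  using plf_Cauchy_Schwarz[of 1 a] by simp

lemma gns_norm_one_sq: "(gns_norm \<phi> 1)\<^sup>2 = Re (\<phi> 1)"
  using gns_norm_sq[of 1] by simp

lemma plf_compress: "is_plf (\<lambda>a. \<phi> (star c * a * c))"
proof (rule is_plfI)
  fix a
  have "star c * (star a * a) * c = star (a * c) * (a * c)"
    by (simp add: star_simps mult.assoc)
  then show "Im (\<phi> (star c * (star a * a) * c)) = 0" "0 \<le> Re (\<phi> (star c * (star a * a) * c))"
    using plf_Im_pos plf_Re_pos by auto
qed (auto simp: algebra_simps plf_linear mult_scaleC_left mult_scaleC_right)

text \<open>For \<open>R > norm h\<close> the element \<open>1 - (1/R) *\<^sub>R h\<close> is the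
  square of a self-adjoint element, so \<open>\<phi>\<close> is nonnegative there; then
  \<open>R\<close> tends to \<open>norm h\<close>. The norm bounds for functionals rest on
  this.\<close>

lemma plf_Re_selfadjoint_le:
  assumes "star h = h"
  shows "Re (\<phi> h) \<le> norm h * Re (\<phi> 1)"
proof -
  have le: "Re (\<phi> h) \<le> R * Re (\<phi> 1)" if "norm h < R" for R
  proof -
    have R: "0 < R"
      using that norm_ge_zero[of h] by linarith
    have "norm ((1/R) *\<^sub>R h) < 1"
      using that R by (simp add: field_simps)
    then obtain c where c: "star c = c" "c * c = 1 - (1/R) *\<^sub>R h"
      using selfadjoint_sqrt[of "(1/R) *\<^sub>R h"] assms by (auto simp: star_simps)
    have "0 \<le> Re (\<phi> (star c * c))"
      by (rule plf_Re_pos)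
    then have "0 \<le> Re (\<phi> 1) - Re (\<phi> h) / R"
      by (simp only: c(1)) (simp add: c(2) plf_linear)
    then show ?thesis
      using R by (simp add: field_simps)
  qed
  have "((\<lambda>e. (norm h + e) * Re (\<phi> 1)) \<longlongrightarrow> (norm h + 0) * Re (\<phi> 1)) (at_right 0)"
    by (intro tendsto_intros)
  then have "Re (\<phi> h) \<le> (norm h + 0) * Re (\<phi> 1)"
    by (rule tendsto_lowerbound)
      (auto intro!: eventually_at_rightI[of 0 1] le)
  then show ?thesis by simp
qed

lemma gns_norm_le: "gns_norm \<phi> a \<le> norm a * gns_norm \<phi> 1"
proof (rule power2_le_imp_le)
  show "(gns_norm \<phi> a)\<^sup>2 \<le> (norm a * gns_norm \<phi> 1)\<^sup>2"
    using plf_Re_selfadjoint_le[of "star a * a"]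
    by (simp add: gns_norm_sq star_simps power_mult_distrib gns_norm_one_sq cstar_identity)
qed (simp add: gns_norm_nonneg)

lemma plf_bound: "cmod (\<phi> a) \<le> Re (\<phi> 1) * norm a"
proof -
  have "cmod (\<phi> a) \<le> gns_norm \<phi> 1 * (norm a * gns_norm \<phi> 1)"
    using plf_norm_le[of a] gns_norm_le[of a] gns_norm_nonneg[of 1]
    by (meson mult_left_mono order_trans)
  also have "\<dots> = (gns_norm \<phi> 1)\<^sup>2 * norm a"
    by (simp add: power2_eq_square algebra_simps)
  finally show ?thesis
    by (simp add: gns_norm_one_sq)
qed

lemma bounded_linear_plf: "bounded_linear \<phi>"
  by (rule bounded_linear_intro[of _ "Re (\<phi> 1)"])
    (auto simp: plf_linear scaleR_conv_of_real[where 'a=complex] plf_bound mult.commute[of _ "Re (\<phi> 1)"])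

end

text \<open>This is \<open>gns_norm_le\<close> for the functional
  \<open>x \<mapsto> \<phi> (star a * x * a)\<close>, whose seminorm at \<open>y\<close> is
  \<open>gns_norm \<phi> (y * a)\<close>.\<close>

lemma gns_norm_mult_le:
  assumes "is_plf \<phi>"
  shows "gns_norm \<phi> (c * a) \<le> norm c * gns_norm \<phi> a"
proof -
  have "gns_norm (\<lambda>x. \<phi> (star a * x * a)) y = gns_norm \<phi> (y * a)" for y
    by (simp add: gns_seminorm_def star_simps mult.assoc)
  then show ?thesis
    using gns_norm_le[OF plf_compress[OF assms, of a], of c] by (metis mult_1_left)
qed

lemma plf_eq_zero:
  fixes \<phi> :: "'a::unital_cstar_algebra \<Rightarrow> complex"
  assumes "is_plf \<phi>" "Re (\<phi> 1) \<le> 0"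
  shows "\<phi> = (\<lambda>_. 0)"
proof
  fix a :: 'a
  have "Re (\<phi> 1) * norm a \<le> 0"
    using assms(2) by (simp add: mult_nonpos_nonneg)
  then show "\<phi> a = 0"
    using plf_bound[OF assms(1), of a] by (metis norm_le_zero_iff order_trans)
qed

lemma is_plf_zero: "is_plf (\<lambda>_. 0)"
  by (simp add: is_plf_def)

lemma is_plf_plus: "is_plf \<phi> \<Longrightarrow> is_plf \<psi> \<Longrightarrow> is_plf (\<lambda>a. \<phi> a + \<psi> a)"
  by (rule is_plfI) (auto simp: plf_linear plf_Im_pos plf_Re_pos algebra_simps)

lemma is_plf_times: "is_plf \<phi> \<Longrightarrow> 0 \<le> r \<Longrightarrow> is_plf (\<lambda>a. complex_of_real r * \<phi> a)"
  by (rule is_plfI) (auto simp: plf_linear plf_Im_pos plf_Re_pos algebra_simps)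

lemma is_plf_limit:
  fixes \<mu> :: "'a::unital_cstar_algebra \<Rightarrow> complex"
  assumes "\<And>n. is_plf (m n)" "\<And>a. (\<lambda>n. m n a) \<longlonglongrightarrow> \<mu> a"
  shows "is_plf \<mu>"
proof (rule is_plfI)
  fix a b :: 'a and c
  have "(\<lambda>n. m n (a + b)) \<longlonglongrightarrow> \<mu> a + \<mu> b" "(\<lambda>n. m n (c *\<^sub>C a)) \<longlonglongrightarrow> c * \<mu> a"
    using assms by (auto simp: plf_linear intro!: tendsto_intros)
  then show "\<mu> (a + b) = \<mu> a + \<mu> b" "\<mu> (c *\<^sub>C a) = c * \<mu> a"
    using assms(2) LIMSEQ_unique by blast+
  have "(\<lambda>n. Im (m n (star a * a))) \<longlonglongrightarrow> Im (\<mu> (star a * a))"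
    "(\<lambda>n. Re (m n (star a * a))) \<longlonglongrightarrow> Re (\<mu> (star a * a))"
    using assms(2) by (auto intro!: tendsto_intros)
  then show "Im (\<mu> (star a * a)) = 0" "0 \<le> Re (\<mu> (star a * a))"
    using plf_Im_pos[OF assms(1)] plf_Re_pos[OF assms(1)]
    by (auto intro: LIMSEQ_le_const simp: LIMSEQ_const_iff)
qed

subsection \<open>The order on functionals\<close>

lemma plf_leI:
  assumes "is_plf \<mu>" "is_plf \<nu>" "\<And>a. Re (\<nu> (star a * a)) \<le> Re (\<mu> (star a * a))"
  shows "\<nu> \<preceq>\<^sub>+ \<mu>"
  unfolding plf_le_def
  by (rule is_plfI) (use assms in \<open>auto simp: plf_linear plf_Im_pos algebra_simps\<close>)

lemma plf_le_Re: "\<nu> \<preceq>\<^sub>+ \<mu> \<Longrightarrow> Re (\<nu> (star a * a)) \<le> Re (\<mu> (star a * a))"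
  using plf_Re_pos[of "\<lambda>a. \<mu> a - \<nu> a" a] by (simp add: plf_le_def)

lemma plf_le_gns_norm: "\<nu> \<preceq>\<^sub>+ \<mu> \<Longrightarrow> gns_norm \<nu> a \<le> gns_norm \<mu> a"
  using plf_le_Re[of \<nu> \<mu> a] by (simp add: gns_seminorm_def)

lemma plf_le_trans: "\<mu> \<preceq>\<^sub>+ \<nu> \<Longrightarrow> \<nu> \<preceq>\<^sub>+ \<rho> \<Longrightarrow> \<mu> \<preceq>\<^sub>+ \<rho>"
  using is_plf_plus[of "\<lambda>a. \<nu> a - \<mu> a" "\<lambda>a. \<rho> a - \<nu> a"] by (simp add: plf_le_def)

lemma plf_le_refl: "\<mu> \<preceq>\<^sub>+ \<mu>"
  by (simp add: plf_le_def is_plf_zero)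

lemma plf_le_antisym:
  assumes "\<mu> \<preceq>\<^sub>+ \<nu>" "\<nu> \<preceq>\<^sub>+ \<mu>"
  shows "\<mu> = \<nu>"
proof -
  have "(\<lambda>a. \<nu> a - \<mu> a) = (\<lambda>_. 0)"
    using assms plf_le_Re[OF assms(2), of 1] by (intro plf_eq_zero) (auto simp: plf_le_def)
  then show ?thesis
    by (auto simp: fun_eq_iff)
qed

lemma plf_le_plus: "\<mu> \<preceq>\<^sub>+ \<mu>' \<Longrightarrow> \<nu> \<preceq>\<^sub>+ \<nu>' \<Longrightarrow> (\<lambda>a. \<mu> a + \<nu> a) \<preceq>\<^sub>+ (\<lambda>a. \<mu>' a + \<nu>' a)"
  using is_plf_plus[of "\<lambda>a. \<mu>' a - \<mu> a" "\<lambda>a. \<nu>' a - \<nu> a"]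
  by (simp add: plf_le_def add_diff_add)

lemma plf_le_times:
  "\<mu> \<preceq>\<^sub>+ \<nu> \<Longrightarrow> 0 \<le> r \<Longrightarrow> (\<lambda>a. complex_of_real r * \<mu> a) \<preceq>\<^sub>+ (\<lambda>a. complex_of_real r * \<nu> a)"
  using is_plf_times[of "\<lambda>a. \<nu> a - \<mu> a" r] by (simp add: plf_le_def right_diff_distrib)

lemma plf_le_add_left: "is_plf \<nu> \<Longrightarrow> \<mu> \<preceq>\<^sub>+ (\<lambda>a. \<mu> a + \<nu> a)"
  by (simp add: plf_le_def)

lemma zero_plf_le: "is_plf \<mu> \<Longrightarrow> (\<lambda>_. 0) \<preceq>\<^sub>+ \<mu>"
  by (simp add: plf_le_def)

lemma times_plf_le_mono:
  "is_plf \<mu> \<Longrightarrow> r \<le> s \<Longrightarrow> (\<lambda>a. complex_of_real r * \<mu> a) \<preceq>\<^sub>+ (\<lambda>a. complex_of_real s * \<mu> a)"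
  unfolding plf_le_def using is_plf_times[of \<mu> "s - r"] by (simp add: algebra_simps)

lemma plf_null_iff: "is_plf \<phi> \<Longrightarrow> a \<in> plf_null \<phi> \<longleftrightarrow> gns_norm \<phi> a = 0"
  by (simp add: plf_null_def plf_star_mult_self)

lemma plf_null_mono:
  assumes "is_plf \<nu>" "is_plf \<mu>" "\<nu> \<preceq>\<^sub>+ \<mu>"
  shows "plf_null \<mu> \<subseteq> plf_null \<nu>"
proof
  fix a assume "a \<in> plf_null \<mu>"
  then show "a \<in> plf_null \<nu>"
    using plf_le_gns_norm[OF assms(3), of a] gns_norm_nonneg[OF assms(1), of a]
    by (simp add: plf_null_iff assms)
qed

lemma plf_null_plus:
  assumes "is_plf \<mu>" "is_plf \<nu>"
  shows "plf_null \<mu> \<inter> plf_null \<nu> \<subseteq> plf_null (\<lambda>a. \<mu> a + \<nu> a)"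
  by (auto simp: plf_null_def)

section \<open>Riesz representation and parallel sums\<close>

lemma gns_cauchyD: "X \<in> gns_cauchy \<tau> \<Longrightarrow> 0 < e \<Longrightarrow> \<exists>N. \<forall>m\<ge>N. \<forall>n\<ge>N. gns_norm \<tau> (X m - X n) < e"
  unfolding gns_cauchy_def by blast

lemma gns_cauchyI:
  "(\<And>e. 0 < e \<Longrightarrow> \<exists>N. \<forall>m\<ge>N. \<forall>n\<ge>N. gns_norm \<tau> (X m - X n) < e) \<Longrightarrow> X \<in> gns_cauchy \<tau>"
  unfolding gns_cauchy_def by blast

lemma gns_cauchy_bounded:
  assumes "is_plf \<tau>" "X \<in> gns_cauchy \<tau>"
  obtains B where "0 < B" "\<And>n. gns_norm \<tau> (X n) \<le> B"
proof -
  obtain N where N: "\<And>m n. m \<ge> N \<Longrightarrow> n \<ge> N \<Longrightarrow> gns_norm \<tau> (X m - X n) < 1"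
    using gns_cauchyD[OF assms(2), of 1] by auto
  define B where "B = Max ((\<lambda>n. gns_norm \<tau> (X n)) ` {..N}) + 1"
  have *: "gns_norm \<tau> (X n) \<le> B - 1" if "n \<le> N" for n
    using that by (simp add: B_def)
  have "gns_norm \<tau> (X n) \<le> B" for n
  proof (cases "n \<le> N")
    case False
    have "gns_norm \<tau> (X n) \<le> gns_norm \<tau> (X n - X N) + gns_norm \<tau> (X N)"
      using gns_norm_triangle[OF assms(1), of "X n - X N" "X N"] by simp
    then show ?thesis
      using N[of n N] *[of N] False by simp
  qed (use *[of n] in simp)
  moreover have "0 < B"
    using *[of 0] gns_norm_nonneg[OF assms(1), of "X 0"] by simp
  ultimately show thesis
    using that by blast
qed

text \<open>Variational proof of the Riesz theorem: a minimizing sequence of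
  \<open>(gns_norm \<tau> b)\<^sup>2 - 2 * Re (f b)\<close> is Cauchy by the parallelogram law, and
  the vanishing first variation identifies the functional. The representing vector stays a Cauchy
  sequence in the algebra, so that no completion is involved.\<close>

lemma plf_Riesz:
  fixes f :: "'a::unital_cstar_algebra \<Rightarrow> complex"
  assumes \<tau>: "is_plf \<tau>"
    and add: "\<And>a b. f (a + b) = f a + f b"
    and scale: "\<And>c a. f (c *\<^sub>C a) = c * f a"
    and bound: "\<And>a. cmod (f a) \<le> C * gns_norm \<tau> a"
  obtains b where "b \<in> gns_cauchy \<tau>" "\<And>a. (\<lambda>n. \<tau> (star (b n) * a)) \<longlonglongrightarrow> f a"
proof -
  have scaleR: "f (r *\<^sub>R a) = of_real r * f a" for r a
    by (simp flip: scaleC_of_real add: scale)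
  define G where "G b = (gns_norm \<tau> b)\<^sup>2 - 2 * Re (f b)" for b
  have G_ge: "- C\<^sup>2 \<le> G b" for b
  proof -
    have "Re (f b) \<le> C * gns_norm \<tau> b"
      using bound[of b] complex_Re_le_cmod order_trans by blast
    moreover have "0 \<le> (gns_norm \<tau> b - C)\<^sup>2"
      by simp
    ultimately show ?thesis
      unfolding G_def by (simp add: power2_diff algebra_simps)
  qed
  define I where "I = (INF b. G b)"
  have bdd: "bdd_below (range G)"
    using G_ge by (intro bdd_belowI[of _ "- C\<^sup>2"]) auto
  have I_le: "I \<le> G b" for b
    unfolding I_def by (rule cINF_lower[OF bdd]) simp
  define \<epsilon> where "\<epsilon> n = 1 / (real n + 1)" for n
  have \<epsilon>_pos: "0 < \<epsilon> n" for n
    by (simp add: \<epsilon>_def)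
  have \<epsilon>_lim: "\<epsilon> \<longlonglongrightarrow> 0"
    unfolding \<epsilon>_def using LIMSEQ_inverse_real_of_nat by (simp add: inverse_eq_divide add.commute)
  have "\<exists>b. G b < I + \<epsilon> n" for n
    using \<epsilon>_pos[of n] cINF_less_iff[OF _ bdd, of "I + \<epsilon> n"] by (auto simp: I_def)
  then obtain b where b: "\<And>n. G (b n) < I + \<epsilon> n"
    by metis
  have diff: "(gns_norm \<tau> (b m - b n))\<^sup>2 \<le> 2 * \<epsilon> m + 2 * \<epsilon> n" for m n
  proof -
    let ?m = "(1/2) *\<^sub>R (b m + b n)"
    have "(gns_norm \<tau> (b m + b n))\<^sup>2 = 4 * (gns_norm \<tau> ?m)\<^sup>2" "Re (f (b m)) + Re (f (b n)) = 2 * Re (f ?m)"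
      using add[of "b m" "b n"] by (auto simp: gns_norm_scaleR[OF \<tau>] power_divide scaleR)
    then show ?thesis
      using gns_norm_parallelogram[OF \<tau>, of "b m" "b n"] I_le[of ?m] b[of m] b[of n]
      unfolding G_def by linarith
  qed
  have "b \<in> gns_cauchy \<tau>"
  proof (rule gns_cauchyI)
    fix e :: real assume e: "0 < e"
    then have "\<forall>\<^sub>F n in sequentially. \<epsilon> n < e\<^sup>2 / 4"
      by (intro order_tendstoD[OF \<epsilon>_lim]) simp
    then obtain N where N: "\<And>n. n \<ge> N \<Longrightarrow> \<epsilon> n < e\<^sup>2 / 4"
      by (auto simp: eventually_sequentially)
    have "gns_norm \<tau> (b m - b n) < e" if "m \<ge> N" "n \<ge> N" for m n
      using diff[of m n] N[OF that(1)] N[OF that(2)] e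
      by (intro power2_less_imp_less[of _ e]) auto
    then show "\<exists>N. \<forall>m\<ge>N. \<forall>n\<ge>N. gns_norm \<tau> (b m - b n) < e"
      by blast
  qed
  moreover have "(\<lambda>n. \<tau> (star (b n) * a)) \<longlonglongrightarrow> f a" for a
  proof -
    have Re_lim: "(\<lambda>n. Re (\<tau> (star (b n) * a) - f a)) \<longlonglongrightarrow> 0" for a
    proof -
      \<comment> \<open>First variation: \<open>b n\<close> is minimal up to
        \<open>\<epsilon> n\<close>, so \<open>G\<close> cannot drop by more than that along
        \<open>b n + t *\<^sub>R a\<close>.\<close>
      have D: "- \<epsilon> n \<le> t\<^sup>2 * (gns_norm \<tau> a)\<^sup>2 + 2 * t * Re (\<tau> (star (b n) * a) - f a)" for n t
      proof -
        have "G (b n + t *\<^sub>R a) = G (b n) + t\<^sup>2 * (gns_norm \<tau> a)\<^sup>2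
            + 2 * t * Re (\<tau> (star (b n) * a) - f a)"
          using plf_hermitian[OF \<tau>, of a "b n"]
          by (simp add: G_def add scaleR gns_norm_add_sq[OF \<tau>] gns_norm_scaleR[OF \<tau>]
              power_mult_distrib star_simps plf_linear[OF \<tau>] algebra_simps)
        then show ?thesis
          using I_le[of "b n + t *\<^sub>R a"] b[of n] by linarith
      qed
      \<comment> \<open>Choosing \<open>t\<close> as plus or minus
        \<open>sqrt (\<epsilon> n)\<close> balances the defect \<open>\<epsilon> n\<close> against
        the quadratic term.\<close>
      have A: "norm (Re (\<tau> (star (b n) * a) - f a)) \<le> sqrt (\<epsilon> n) * (1 + (gns_norm \<tau> a)\<^sup>2) / 2" for n
      proof -
        let ?s = "sqrt (\<epsilon> n)" and ?d = "Re (\<tau> (star (b n) * a) - f a)" and ?x = "(gns_norm \<tau> a)\<^sup>2"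
        have s: "0 < ?s" "?s\<^sup>2 = \<epsilon> n"
          using \<epsilon>_pos[of n] by auto
        have "0 \<le> ?s * (?s * (1 + ?x) + 2 * ?d)" "0 \<le> ?s * (?s * (1 + ?x) - 2 * ?d)"
          using D[of n ?s] D[of n "- ?s"] s(2) by (auto simp: power2_eq_square algebra_simps)
        then have "0 \<le> ?s * (1 + ?x) + 2 * ?d" "0 \<le> ?s * (1 + ?x) - 2 * ?d"
          using s(1) by (auto simp: zero_le_mult_iff)
        then show ?thesis
          unfolding real_norm_def by linarith
      qed
      have B: "(\<lambda>n. sqrt (\<epsilon> n) * (1 + (gns_norm \<tau> a)\<^sup>2) / 2) \<longlonglongrightarrow> sqrt 0 * (1 + (gns_norm \<tau> a)\<^sup>2) / 2"
        by (intro tendsto_intros \<epsilon>_lim) simp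
      show ?thesis
        by (rule Lim_null_comparison[OF always_eventually[OF allI[OF A]]]) (use B in simp)
    qed
    \<comment> \<open>Real parts at \<open>\<i> *\<^sub>C a\<close> are, up to sign, the imaginary
      parts at \<open>a\<close>.\<close>
    have "(\<lambda>n. \<tau> (star (b n) * a) - f a) \<longlonglongrightarrow> 0"
      using Re_lim[of a] Re_lim[of "\<i> *\<^sub>C a"] unfolding tendsto_complex_iff
      by (simp add: mult_scaleC_right plf_scaleC[OF \<tau>] scale) (use tendsto_minus in fastforce)
    then show ?thesis
      by (rule LIM_zero_cancel)
  qed
  ultimately show thesis
    using that by blast
qed

text \<open>By Cauchy-Schwarz the functionals given by \<open>X n\<close> and \<open>X m\<close>
  differ by at most \<open>gns_norm \<tau> (X n - X m)\<close> on the unit ball of the seminorm, so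
  the convergence is uniform there.\<close>

lemma gns_cauchy_uniform:
  assumes \<tau>: "is_plf \<tau>" and X: "X \<in> gns_cauchy \<tau>"
    and lim: "\<And>a. (\<lambda>n. \<tau> (star (X n) * a)) \<longlonglongrightarrow> f a" and "0 < e"
  shows "\<exists>N. \<forall>n\<ge>N. \<forall>a. cmod (\<tau> (star (X n) * a) - f a) \<le> e * gns_norm \<tau> a"
proof -
  obtain N where N: "\<And>m n. m \<ge> N \<Longrightarrow> n \<ge> N \<Longrightarrow> gns_norm \<tau> (X m - X n) < e"
    using gns_cauchyD[OF X \<open>0 < e\<close>] by auto
  have "cmod (\<tau> (star (X n) * a) - f a) \<le> e * gns_norm \<tau> a" if n: "n \<ge> N" for n a
  proof (rule LIMSEQ_le_const2)
    show "(\<lambda>m. cmod (\<tau> (star (X n) * a) - \<tau> (star (X m) * a))) \<longlonglongrightarrow> cmod (\<tau> (star (X n) * a) - f a)"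
      by (intro tendsto_intros lim)
    have "cmod (\<tau> (star (X n) * a) - \<tau> (star (X m) * a)) \<le> e * gns_norm \<tau> a" if m: "m \<ge> N" for m
    proof -
      have "\<tau> (star (X n) * a) - \<tau> (star (X m) * a) = \<tau> (star (X n - X m) * a)"
        by (simp add: star_simps plf_linear[OF \<tau>] algebra_simps)
      then have "cmod (\<tau> (star (X n) * a) - \<tau> (star (X m) * a)) \<le> gns_norm \<tau> (X n - X m) * gns_norm \<tau> a"
        using plf_Cauchy_Schwarz[OF \<tau>] by simp
      also have "\<dots> \<le> e * gns_norm \<tau> a"
        using N[OF n m] gns_norm_nonneg[OF \<tau>] by (intro mult_right_mono) auto
      finally show ?thesis .
    qed
    then show "\<exists>N. \<forall>m\<ge>N. cmod (\<tau> (star (X n) * a) - \<tau> (star (X m) * a)) \<le> e * gns_norm \<tau> a"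
      by blast
  qed
  then show ?thesis
    by blast
qed

text \<open>Lets the argument move with \<open>n\<close>, as is necessary when \<open>w n\<close> is
  itself built from \<open>X n\<close>, for instance in expressions quadratic in
  \<open>X\<close>.\<close>

lemma gns_cauchy_uniform_lim:
  assumes \<tau>: "is_plf \<tau>" and X: "X \<in> gns_cauchy \<tau>"
    and lim: "\<And>a. (\<lambda>n. \<tau> (star (X n) * a)) \<longlonglongrightarrow> f a"
    and B: "\<And>n. gns_norm \<tau> (w n) \<le> B"
  shows "(\<lambda>n. \<tau> (star (X n) * w n) - f (w n)) \<longlonglongrightarrow> 0"
proof (rule LIMSEQ_I)
  fix r :: real assume r: "0 < r"
  have B0: "0 \<le> B"
    using B[of 0] gns_norm_nonneg[OF \<tau>, of "w 0"] by linarith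
  then have "0 < r / (B + 1)"
    using r by simp
  then obtain N where N: "\<And>n a. n \<ge> N \<Longrightarrow> cmod (\<tau> (star (X n) * a) - f a) \<le> r / (B + 1) * gns_norm \<tau> a"
    using gns_cauchy_uniform[OF \<tau> X lim] by meson
  have "cmod (\<tau> (star (X n) * w n) - f (w n) - 0) < r" if "n \<ge> N" for n
  proof -
    have "cmod (\<tau> (star (X n) * w n) - f (w n)) \<le> r / (B + 1) * B"
      using N[OF that, of "w n"] B[of n] r B0
      by (meson divide_nonneg_nonneg mult_left_mono order_trans less_imp_le add_nonneg_nonneg zero_le_one)
    also have "\<dots> < r"
      using r B0 by (simp add: field_simps)
    finally show ?thesis by simp
  qed
  then show "\<exists>N. \<forall>n\<ge>N. cmod (\<tau> (star (X n) * w n) - f (w n) - 0) < r"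
    by blast
qed

lemma gns_cauchy_bounded_image:
  assumes X: "X \<in> gns_cauchy \<tau>" and C: "0 \<le> C"
    and le: "\<And>m n. gns_norm \<phi> (Y m - Y n) \<le> C * gns_norm \<tau> (X m - X n)"
  shows "Y \<in> gns_cauchy \<phi>"
proof (rule gns_cauchyI)
  fix e :: real assume e: "0 < e"
  then obtain N where N: "\<And>m n. m \<ge> N \<Longrightarrow> n \<ge> N \<Longrightarrow> gns_norm \<tau> (X m - X n) < e / (C + 1)"
    using gns_cauchyD[OF X, of "e / (C + 1)"] C by auto
  have "gns_norm \<phi> (Y m - Y n) < e" if "m \<ge> N" "n \<ge> N" for m n
  proof -
    have "gns_norm \<phi> (Y m - Y n) \<le> C * (e / (C + 1))"
      using le[of m n] mult_left_mono[OF less_imp_le[OF N[OF that]] C] by linarith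
    also have "\<dots> < e"
      using e C by (simp add: field_simps)
    finally show ?thesis .
  qed
  then show "\<exists>N. \<forall>m\<ge>N. \<forall>n\<ge>N. gns_norm \<phi> (Y m - Y n) < e"
    by blast
qed

lemma gns_cauchy_const: "is_plf \<tau> \<Longrightarrow> (\<lambda>_. a) \<in> gns_cauchy \<tau>"
  by (rule gns_cauchyI) (simp add: gns_norm_zero)

lemma gns_inner_diff_le:
  assumes \<tau>: "is_plf \<tau>"
  shows "cmod (\<tau> (star y * x) - \<tau> (star y' * x')) \<le>
    gns_norm \<tau> y * gns_norm \<tau> (x - x') + gns_norm \<tau> (y - y') * gns_norm \<tau> x'"
proof -
  have "\<tau> (star y * x) - \<tau> (star y' * x') = \<tau> (star y * (x - x')) + \<tau> (star (y - y') * x')"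
    by (simp add: star_simps algebra_simps plf_linear[OF \<tau>])
  then show ?thesis
    using norm_triangle_ineq[of "\<tau> (star y * (x - x'))" "\<tau> (star (y - y') * x')"]
      plf_Cauchy_Schwarz[OF \<tau>, of y "x - x'"] plf_Cauchy_Schwarz[OF \<tau>, of "y - y'" x'] by simp
qed

lemma gns_inner_convergent:
  assumes \<tau>: "is_plf \<tau>" and X: "X \<in> gns_cauchy \<tau>" and Y: "Y \<in> gns_cauchy \<tau>"
  shows "convergent (\<lambda>n. \<tau> (star (Y n) * X n))"
proof (intro Cauchy_convergent CauchyI)
  fix e :: real assume e: "0 < e"
  obtain B where B: "0 < B" "\<And>n. gns_norm \<tau> (X n) \<le> B"
    using gns_cauchy_bounded[OF \<tau> X] by blast
  obtain C where C: "0 < C" "\<And>n. gns_norm \<tau> (Y n) \<le> C"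
    using gns_cauchy_bounded[OF \<tau> Y] by blast
  have pos: "0 < e / (2 * C)" "0 < e / (2 * B)"
    using e B C by auto
  obtain M where M: "\<And>m n. m \<ge> M \<Longrightarrow> n \<ge> M \<Longrightarrow> gns_norm \<tau> (X m - X n) < e / (2 * C)"
    using gns_cauchyD[OF X pos(1)] by blast
  obtain N where N: "\<And>m n. m \<ge> N \<Longrightarrow> n \<ge> N \<Longrightarrow> gns_norm \<tau> (Y m - Y n) < e / (2 * B)"
    using gns_cauchyD[OF Y pos(2)] by blast
  have "cmod (\<tau> (star (Y m) * X m) - \<tau> (star (Y n) * X n)) < e"
    if "m \<ge> max M N" "n \<ge> max M N" for m n
  proof -
    have "cmod (\<tau> (star (Y m) * X m) - \<tau> (star (Y n) * X n))
      \<le> gns_norm \<tau> (Y m) * gns_norm \<tau> (X m - X n) + gns_norm \<tau> (Y m - Y n) * gns_norm \<tau> (X n)"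
      by (rule gns_inner_diff_le[OF \<tau>])
    also have "\<dots> \<le> C * gns_norm \<tau> (X m - X n) + gns_norm \<tau> (Y m - Y n) * B"
      by (intro add_mono mult_mono B C gns_norm_nonneg \<tau> order_refl less_imp_le[OF C(1)])
    also have "\<dots> < C * (e / (2 * C)) + e / (2 * B) * B"
      using M[of m n] N[of m n] that B C
      by (intro add_strict_mono mult_strict_left_mono mult_strict_right_mono) auto
    also have "\<dots> = e"
      using B C by simp
    finally show ?thesis .
  qed
  then show "\<exists>N. \<forall>m\<ge>N. \<forall>n\<ge>N. cmod (\<tau> (star (Y m) * X m) - \<tau> (star (Y n) * X n)) < e"
    by blast
qed

text \<open>In the GNS space of \<open>\<tau> = \<phi> + \<psi>\<close> let \<open>b\<close> be the
  vector that represents \<open>\<phi>\<close>. Over all \<open>c\<close>, the cost \<open>(gns_norm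
  \<phi> (a - c))\<^sup>2 + (gns_norm \<psi> c)\<^sup>2\<close> is minimal at \<open>a * b\<close>,
  and the minimum is \<open>\<psi> (star b * (star a * a))\<close>. It is therefore linear in
  \<open>star a * a\<close>, which makes the infimum a functional. Everything is done along a
  sequence that converges to \<open>b\<close>.\<close>

lemma parallel_sum_exists:
  fixes \<phi> \<psi> :: "'a::unital_cstar_algebra \<Rightarrow> complex"
  assumes \<phi>: "is_plf \<phi>" and \<psi>: "is_plf \<psi>"
  shows "\<exists>L. is_plf L \<and>
    (\<forall>a c. Re (L (star a * a)) \<le> (gns_norm \<phi> (a - c))\<^sup>2 + (gns_norm \<psi> c)\<^sup>2) \<and>
    (\<forall>a e. 0 < e \<longrightarrow> (\<exists>c. (gns_norm \<phi> (a - c))\<^sup>2 + (gns_norm \<psi> c)\<^sup>2 < Re (L (star a * a)) + e))"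
proof -
  define \<tau> where "\<tau> = (\<lambda>a. \<phi> a + \<psi> a)"
  have \<tau>: "is_plf \<tau>"
    unfolding \<tau>_def by (rule is_plf_plus[OF \<phi> \<psi>])
  have \<phi>\<tau>: "gns_norm \<phi> a \<le> gns_norm \<tau> a" and \<psi>\<tau>: "gns_norm \<psi> a \<le> gns_norm \<tau> a" for a
    using plf_Re_pos[OF \<phi>, of a] plf_Re_pos[OF \<psi>, of a] by (auto simp: gns_seminorm_def \<tau>_def)
  have bound: "cmod (\<phi> a) \<le> gns_norm \<phi> 1 * gns_norm \<tau> a" for a
    using plf_norm_le[OF \<phi>, of a] mult_left_mono[OF \<phi>\<tau>[of a] gns_norm_nonneg[OF \<phi>, of 1]] by linarith
  obtain b where b: "b \<in> gns_cauchy \<tau>" "\<And>a. (\<lambda>n. \<tau> (star (b n) * a)) \<longlonglongrightarrow> \<phi> a"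
    using plf_Riesz[of \<tau> \<phi>, OF \<tau> plf_add[OF \<phi>] plf_scaleC[OF \<phi>] bound] by blast
  obtain B where B: "0 < B" "\<And>n. gns_norm \<tau> (b n) \<le> B"
    using gns_cauchy_bounded[OF \<tau> b(1)] by blast
  have "b \<in> gns_cauchy \<psi>"
    by (rule gns_cauchy_bounded_image[OF b(1), of 1]) (simp_all add: \<psi>\<tau>)
  then have "convergent (\<lambda>n. \<psi> (star (b n) * a))" for a
    by (rule gns_inner_convergent[OF \<psi> gns_cauchy_const[OF \<psi>]])
  then obtain L where L: "\<And>a. (\<lambda>n. \<psi> (star (b n) * a)) \<longlonglongrightarrow> L a"
    unfolding convergent_def by metis
  define F where "F a c = (gns_norm \<phi> (a - c))\<^sup>2 + (gns_norm \<psi> c)\<^sup>2" for a c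
  have F_lim: "(\<lambda>n. complex_of_real (F a (a * b n))) \<longlonglongrightarrow> L (star a * a)" for a
  proof -
    define w where "w n = star a * a * b n" for n
    have w: "gns_norm \<tau> (w n) \<le> norm (star a * a) * B" for n
      using gns_norm_mult_le[OF \<tau>, of "star a * a" "b n"] B(2)[of n]
      by (simp add: w_def) (meson mult_left_mono norm_ge_zero order_trans)
    \<comment> \<open>The first bracket vanishes in the limit by the choice of \<open>b\<close>, the
      last one by uniformity of that limit; what survives is the middle term.\<close>
    have eq: "complex_of_real (F a (a * b n)) = (\<phi> (star a * a) - \<tau> (star (b n) * (star a * a)))
      + \<psi> (star (b n) * (star a * a)) + (\<tau> (star (b n) * w n) - \<phi> (w n))" for n
      unfolding F_def of_real_add plf_star_mult_self[OF \<phi>, symmetric] plf_star_mult_self[OF \<psi>, symmetric]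
      by (simp add: \<tau>_def w_def star_simps plf_linear[OF \<phi>] plf_linear[OF \<psi>] algebra_simps)
    have "(\<lambda>n. (\<phi> (star a * a) - \<tau> (star (b n) * (star a * a)))
      + \<psi> (star (b n) * (star a * a)) + (\<tau> (star (b n) * w n) - \<phi> (w n)))
      \<longlonglongrightarrow> (\<phi> (star a * a) - \<phi> (star a * a)) + L (star a * a) + 0"
      by (intro tendsto_intros b(2) L gns_cauchy_uniform_lim[OF \<tau> b w])
    then show ?thesis
      unfolding eq by simp
  qed
  have F_lim': "(\<lambda>n. F a (a * b n)) \<longlonglongrightarrow> Re (L (star a * a))" for a
    using tendsto_Re[OF F_lim[of a]] by simp
  have "is_plf L"
  proof (rule is_plfI)
    fix a a' c
    have "(\<lambda>n. \<psi> (star (b n) * (a + a'))) \<longlonglongrightarrow> L a + L a'" "(\<lambda>n. \<psi> (star (b n) * (c *\<^sub>C a))) \<longlonglongrightarrow> c * L a"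
      by (auto simp: distrib_left plf_linear[OF \<psi>] mult_scaleC_right intro!: tendsto_intros L)
    then show "L (a + a') = L a + L a'" "L (c *\<^sub>C a) = c * L a"
      using L LIMSEQ_unique by blast+
    show "Im (L (star a * a)) = 0"
      using tendsto_Im[OF F_lim[of a]] by (simp add: LIMSEQ_const_iff)
    have "0 \<le> F a (a * b n)" for n
      by (simp add: F_def)
    then show "0 \<le> Re (L (star a * a))"
      using F_lim'[of a] by (intro LIMSEQ_le_const) auto
  qed
  moreover have "Re (L (star a * a)) \<le> F a c" for a c
  proof -
    define d where "d n = c - a * b n" for n
    define e where "e n = \<tau> (star (b n) * (star a * d n)) - \<phi> (star a * d n)" for n
    have "gns_norm \<tau> (star a * d n) \<le> norm a * (gns_norm \<tau> c + norm a * B)" for n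
    proof -
      have "gns_norm \<tau> (star a * d n) \<le> norm a * gns_norm \<tau> (d n)"
        using gns_norm_mult_le[OF \<tau>, of "star a" "d n"] by simp
      also have "\<dots> \<le> norm a * (gns_norm \<tau> c + gns_norm \<tau> (a * b n))"
        unfolding d_def by (intro mult_left_mono gns_norm_triangle_diff[OF \<tau>]) simp
      also have "\<dots> \<le> norm a * (gns_norm \<tau> c + norm a * B)"
        using gns_norm_mult_le[OF \<tau>, of a "b n"] mult_left_mono[OF B(2)[of n] norm_ge_zero[of a]]
        by (intro mult_left_mono add_mono) auto
      finally show ?thesis .
    qed
    then have e_lim: "e \<longlonglongrightarrow> 0"
      unfolding e_def by (rule gns_cauchy_uniform_lim[OF \<tau> b])
    have "F a (a * b n) + 2 * Re (e n) \<le> F a c" for n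
    proof -
      \<comment> \<open>Completing the square around \<open>a * b n\<close>: \<open>e n\<close> is
        the first variation in direction \<open>d n\<close>, which would be zero at the exact
        minimizer.\<close>
      have "F a c = F a (a * b n) + 2 * Re (e n) + (gns_norm \<tau> (d n))\<^sup>2"
        using plf_hermitian[OF \<phi>, of a c] plf_hermitian[OF \<phi>, of "a * b n" c]
          plf_hermitian[OF \<psi>, of "a * b n" c] plf_hermitian[OF \<phi>, of a "a * b n"]
        by (simp add: F_def e_def d_def \<tau>_def gns_norm_sq \<phi> \<psi> is_plf_plus star_simps plf_linear[OF \<phi>]
            plf_linear[OF \<psi>] algebra_simps)
      then show ?thesis by simp
    qed
    moreover have "(\<lambda>n. F a (a * b n) + 2 * Re (e n)) \<longlonglongrightarrow> Re (L (star a * a)) + 2 * Re 0"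
      by (intro tendsto_intros F_lim' e_lim)
    ultimately show ?thesis
      by (intro LIMSEQ_le_const2[of "\<lambda>n. F a (a * b n) + 2 * Re (e n)"]) auto
  qed
  moreover have "\<exists>c. F a c < Re (L (star a * a)) + e" if "0 < e" for a e
  proof -
    have "\<forall>\<^sub>F n in sequentially. F a (a * b n) < Re (L (star a * a)) + e"
      by (rule order_tendstoD[OF F_lim']) (use that in simp)
    then show ?thesis
      by (auto simp: eventually_sequentially)
  qed
  ultimately show ?thesis
    unfolding F_def by blast
qed

text \<open>The parallel sum known from electrical networks: the last two clauses say that the
  quadratic form of \<open>L\<close> is the infimal convolution of those of \<open>\<phi>\<close>
  and \<open>\<psi>\<close>.\<close>

definition parallel_sum ::
    "('a::unital_cstar_algebra \<Rightarrow> complex) \<Rightarrow> ('a \<Rightarrow> complex) \<Rightarrow> 'a \<Rightarrow> complex" where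
  "parallel_sum \<phi> \<psi> = (SOME L. is_plf L \<and>
    (\<forall>a c. Re (L (star a * a)) \<le> (gns_norm \<phi> (a - c))\<^sup>2 + (gns_norm \<psi> c)\<^sup>2) \<and>
    (\<forall>a e. 0 < e \<longrightarrow> (\<exists>c. (gns_norm \<phi> (a - c))\<^sup>2 + (gns_norm \<psi> c)\<^sup>2 < Re (L (star a * a)) + e)))"

context
  fixes \<phi> \<psi> :: "'a::unital_cstar_algebra \<Rightarrow> complex"
  assumes plfs: "is_plf \<phi>" "is_plf \<psi>"
begin

lemma is_plf_parallel_sum: "is_plf (parallel_sum \<phi> \<psi>)"
  and parallel_sum_upper:
    "Re (parallel_sum \<phi> \<psi> (star a * a)) \<le> (gns_norm \<phi> (a - c))\<^sup>2 + (gns_norm \<psi> c)\<^sup>2"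
  and parallel_sum_approx:
    "0 < e \<Longrightarrow> \<exists>c. (gns_norm \<phi> (a - c))\<^sup>2 + (gns_norm \<psi> c)\<^sup>2 < Re (parallel_sum \<phi> \<psi> (star a * a)) + e"
  using someI_ex[OF parallel_sum_exists[OF plfs]] unfolding parallel_sum_def by blast+

lemma parallel_sum_greatest:
  assumes "\<And>c. x \<le> (gns_norm \<phi> (a - c))\<^sup>2 + (gns_norm \<psi> c)\<^sup>2"
  shows "x \<le> Re (parallel_sum \<phi> \<psi> (star a * a))"
proof (rule field_le_epsilon)
  fix e :: real assume "0 < e"
  then show "x \<le> Re (parallel_sum \<phi> \<psi> (star a * a)) + e"
    using parallel_sum_approx[of e a] assms by (meson less_imp_le order_trans)
qed

lemma parallel_sum_le_left: "parallel_sum \<phi> \<psi> \<preceq>\<^sub>+ \<phi>"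
  using parallel_sum_upper[of _ 0]
  by (intro plf_leI plfs is_plf_parallel_sum) (simp add: gns_norm_zero plfs gns_norm_sq)

lemma parallel_sum_le_right: "parallel_sum \<phi> \<psi> \<preceq>\<^sub>+ \<psi>"
proof (intro plf_leI plfs is_plf_parallel_sum)
  fix a
  show "Re (parallel_sum \<phi> \<psi> (star a * a)) \<le> Re (\<psi> (star a * a))"
    using parallel_sum_upper[of a a] by (simp add: gns_norm_zero plfs gns_norm_sq)
qed

end

lemma parallel_sum_mono:
  assumes "is_plf \<phi>" "is_plf \<psi>" "is_plf \<phi>'" "is_plf \<psi>'" "\<phi> \<preceq>\<^sub>+ \<phi>'" "\<psi> \<preceq>\<^sub>+ \<psi>'"
  shows "parallel_sum \<phi> \<psi> \<preceq>\<^sub>+ parallel_sum \<phi>' \<psi>'"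
proof (intro plf_leI is_plf_parallel_sum parallel_sum_greatest assms)
  fix a c
  have "(gns_norm \<phi> (a - c))\<^sup>2 + (gns_norm \<psi> c)\<^sup>2 \<le> (gns_norm \<phi>' (a - c))\<^sup>2 + (gns_norm \<psi>' c)\<^sup>2"
    using assms by (intro add_mono power_mono plf_le_gns_norm gns_norm_nonneg)
  then show "Re (parallel_sum \<phi> \<psi> (star a * a)) \<le> (gns_norm \<phi>' (a - c))\<^sup>2 + (gns_norm \<psi>' c)\<^sup>2"
    using parallel_sum_upper[OF assms(1,2), of a c] by linarith
qed

text \<open>The parallel sum of \<open>r\<close> and \<open>k r\<close> is
  \<open>k / (1 + k)\<close> times \<open>r\<close>, and parallel sums are monotone. For large
  \<open>k\<close> nothing of \<open>r\<close> is lost, which is how the limit of parallel sums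
  comes to dominate absolutely continuous functionals.\<close>

lemma parallel_sum_lower_bound:
  assumes "is_plf r" "is_plf \<phi>" "is_plf \<psi>" "r \<preceq>\<^sub>+ \<phi>" "0 < k"
    and "(\<lambda>a. complex_of_real k * r a) \<preceq>\<^sub>+ \<psi>"
  shows "k / (1 + k) * Re (r (star a * a)) \<le> Re (parallel_sum \<phi> \<psi> (star a * a))"
proof (rule parallel_sum_greatest[OF assms(2,3)])
  fix c
  let ?x = "gns_norm r (a - c)" and ?y = "gns_norm r c"
  have "gns_norm r a \<le> ?x + ?y"
    using gns_norm_triangle[OF assms(1), of "a - c" c] by simp
  then have "(gns_norm r a)\<^sup>2 \<le> (?x + ?y)\<^sup>2"
    by (intro power_mono gns_norm_nonneg assms)
  moreover have "(1 + k) * (?x\<^sup>2 + k * ?y\<^sup>2) - k * (?x + ?y)\<^sup>2 = (?x - k * ?y)\<^sup>2"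
    by (simp add: power2_eq_square algebra_simps)
  then have "k * (?x + ?y)\<^sup>2 \<le> (1 + k) * (?x\<^sup>2 + k * ?y\<^sup>2)"
    by (metis diff_ge_0_iff_ge zero_le_power2)
  ultimately have "k * (gns_norm r a)\<^sup>2 \<le> (1 + k) * (?x\<^sup>2 + k * ?y\<^sup>2)"
    using assms(5) by (meson less_imp_le mult_left_mono order_trans)
  then have "k / (1 + k) * (gns_norm r a)\<^sup>2 \<le> ?x\<^sup>2 + k * ?y\<^sup>2"
    using assms(5) by (simp add: field_simps)
  moreover have "?x\<^sup>2 \<le> (gns_norm \<phi> (a - c))\<^sup>2"
    using assms by (intro power_mono plf_le_gns_norm gns_norm_nonneg)
  moreover have "k * ?y\<^sup>2 \<le> (gns_norm \<psi> c)\<^sup>2"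
    using plf_le_Re[OF assms(6), of c] by (simp add: gns_norm_sq assms)
  ultimately show "k / (1 + k) * Re (r (star a * a)) \<le> (gns_norm \<phi> (a - c))\<^sup>2 + (gns_norm \<psi> c)\<^sup>2"
    by (simp add: gns_norm_sq[OF assms(1)])
qed

section \<open>Existence of the AGKL decomposition\<close>

lemma ACD_plf: "\<mu> \<in> AC lam \<Longrightarrow> is_plf \<mu>" and ACD_null: "\<mu> \<in> AC lam \<Longrightarrow> plf_null lam \<subseteq> plf_null \<mu>"
  by (auto simp: AC_def)

lemma ACE:
  assumes "\<mu> \<in> AC lam"
  obtains m t where "\<And>n. is_plf (m n)" "\<And>n. m n \<preceq>\<^sub>+ m (Suc n)" "\<And>a. (\<lambda>n. m n a) \<longlonglongrightarrow> \<mu> a"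
    "\<And>n. 0 < t n" "\<And>n. m n \<preceq>\<^sub>+ (\<lambda>a. complex_of_real (t n) * lam a)" "\<And>n. m n \<preceq>\<^sub>+ \<mu>"
proof -
  obtain m and t :: "nat \<Rightarrow> real"
    where m: "\<And>n. is_plf (m n)" "\<And>n. m n \<preceq>\<^sub>+ m (Suc n)" "\<And>a. (\<lambda>n. m n a) \<longlonglongrightarrow> \<mu> a"
    and t: "\<And>n. 0 < t n" "\<And>n. m n \<preceq>\<^sub>+ (\<lambda>a. complex_of_real (t n) * lam a)"
    using assms unfolding AC_def by blast
  have "m n \<preceq>\<^sub>+ \<mu>" for n
  proof (intro plf_leI ACD_plf[OF assms] m)
    fix a
    have "incseq (\<lambda>n. Re (m n (star a * a)))"
      by (intro incseq_SucI plf_le_Re m)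
    then show "Re (m n (star a * a)) \<le> Re (\<mu> (star a * a))"
      by (intro incseq_le[of "\<lambda>n. Re (m n (star a * a))"] tendsto_Re m)
  qed
  then show thesis
    using that m t by blast
qed

lemma zero_in_AC: "is_plf lam \<Longrightarrow> (\<lambda>_. 0) \<in> AC lam"
  unfolding AC_def
  by (auto simp: is_plf_zero plf_null_def plf_le_refl intro!: exI[of _ "\<lambda>_ _. 0"] exI[of _ "\<lambda>_. 1"] zero_plf_le)

lemma AC_plus:
  assumes "\<mu> \<in> AC lam" "\<nu> \<in> AC lam"
  shows "(\<lambda>a. \<mu> a + \<nu> a) \<in> AC lam"
proof -
  obtain m s where m: "\<And>n. is_plf (m n)" "\<And>n. m n \<preceq>\<^sub>+ m (Suc n)" "\<And>a. (\<lambda>n. m n a) \<longlonglongrightarrow> \<mu> a"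
    "\<And>n. 0 < s n" "\<And>n. m n \<preceq>\<^sub>+ (\<lambda>a. complex_of_real (s n) * lam a)"
    using ACE[OF assms(1)] by metis
  obtain m' t where m': "\<And>n. is_plf (m' n)" "\<And>n. m' n \<preceq>\<^sub>+ m' (Suc n)" "\<And>a. (\<lambda>n. m' n a) \<longlonglongrightarrow> \<nu> a"
    "\<And>n. 0 < t n" "\<And>n. m' n \<preceq>\<^sub>+ (\<lambda>a. complex_of_real (t n) * lam a)"
    using ACE[OF assms(2)] by metis
  have "(\<lambda>a. m n a + m' n a) \<preceq>\<^sub>+ (\<lambda>a. complex_of_real (s n + t n) * lam a)" for n
    using plf_le_plus[OF m(5)[of n] m'(5)[of n]] by (simp add: distrib_right)
  then show ?thesis
    using ACD_null[OF assms(1)] ACD_null[OF assms(2)] plf_null_plus[OF ACD_plf[OF assms(1)] ACD_plf[OF assms(2)]] m m'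
    unfolding AC_def
    by (auto intro!: is_plf_plus ACD_plf[OF assms(1)] ACD_plf[OF assms(2)]
        exI[of _ "\<lambda>n a. m n a + m' n a"] exI[of _ "\<lambda>n. s n + t n"] plf_le_plus tendsto_intros add_pos_pos)
qed

lemma AC_times:
  assumes "\<mu> \<in> AC lam" "is_plf lam" "0 \<le> r"
  shows "(\<lambda>a. complex_of_real r * \<mu> a) \<in> AC lam"
proof (cases "r = 0")
  case False
  then have r: "0 < r"
    using assms(3) by simp
  obtain m t where m: "\<And>n. is_plf (m n)" "\<And>n. m n \<preceq>\<^sub>+ m (Suc n)" "\<And>a. (\<lambda>n. m n a) \<longlonglongrightarrow> \<mu> a"
    "\<And>n. 0 < t n" "\<And>n. m n \<preceq>\<^sub>+ (\<lambda>a. complex_of_real (t n) * lam a)"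
    using ACE[OF assms(1)] by metis
  have "(\<lambda>a. complex_of_real r * m n a) \<preceq>\<^sub>+ (\<lambda>a. complex_of_real (r * t n) * lam a)" for n
    using plf_le_times[OF m(5)[of n], of r] r by (simp add: mult.assoc)
  moreover have "plf_null lam \<subseteq> plf_null (\<lambda>a. complex_of_real r * \<mu> a)"
    using ACD_null[OF assms(1)] by (auto simp: plf_null_def)
  ultimately show ?thesis
    using m r unfolding AC_def
    by (auto intro!: is_plf_times ACD_plf[OF assms(1)] exI[of _ "\<lambda>n a. complex_of_real r * m n a"]
        exI[of _ "\<lambda>n. r * t n"] plf_le_times tendsto_intros mult_pos_pos)
qed (simp add: zero_in_AC assms)

text \<open>A positive difference is bounded by its value at \<open>1\<close>, so the bounded
  increasing sequence of values at \<open>1\<close> forces convergence at every element.\<close>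

lemma incseq_plf_convergent:
  fixes m :: "nat \<Rightarrow> 'a::unital_cstar_algebra \<Rightarrow> complex"
  assumes "\<And>n. is_plf (m n)" "\<And>n. m n \<preceq>\<^sub>+ m (Suc n)" "\<And>n. Re (m n 1) \<le> C"
  obtains \<rho> where "is_plf \<rho>" "\<And>a. (\<lambda>n. m n a) \<longlonglongrightarrow> \<rho> a"
proof -
  have mono: "m k \<preceq>\<^sub>+ m n" if "k \<le> n" for k n
    using that by (induction n rule: dec_induct) (auto intro: plf_le_refl plf_le_trans assms(2))
  have diff: "cmod (m n a - m k a) \<le> norm a * \<bar>Re (m n 1) - Re (m k 1)\<bar>" for k n a
  proof -
    have "cmod (m n a - m k a) \<le> norm a * \<bar>Re (m n 1) - Re (m k 1)\<bar>" if "k \<le> n" for k n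
      using plf_bound[of "\<lambda>a. m n a - m k a" a] mono[OF that]
      by (simp add: plf_le_def mult.commute) (meson abs_ge_self mult_left_mono norm_ge_zero order_trans)
    from this[of k n] this[of n k] show ?thesis
      by (cases "k \<le> n") (auto simp: norm_minus_commute abs_minus_commute)
  qed
  have "incseq (\<lambda>n. Re (m n 1))"
    using plf_le_Re[OF assms(2), of _ 1] by (intro incseq_SucI) simp
  then have Cauchy1: "Cauchy (\<lambda>n. Re (m n 1))"
    using assms(3) by (meson convergent_Cauchy convergent_def incseq_convergent)
  have "convergent (\<lambda>n. m n a)" for a
  proof (intro Cauchy_convergent CauchyI)
    fix e :: real assume e: "0 < e"
    have pos: "0 < norm a + 1"
      by (simp add: add_nonneg_pos)
    then obtain N where N: "\<And>k n. k \<ge> N \<Longrightarrow> n \<ge> N \<Longrightarrow> \<bar>Re (m k 1) - Re (m n 1)\<bar> < e / (norm a + 1)"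
      using CauchyD[OF Cauchy1, of "e / (norm a + 1)"] e by auto
    have "cmod (m k a - m n a) < e" if "k \<ge> N" "n \<ge> N" for k n
    proof -
      have "cmod (m k a - m n a) \<le> (norm a + 1) * \<bar>Re (m k 1) - Re (m n 1)\<bar>"
        using diff[of k a n] by (simp add: distrib_right)
      also have "\<dots> < (norm a + 1) * (e / (norm a + 1))"
        using N[OF that] pos by (intro mult_strict_left_mono)
      finally show ?thesis
        using pos by simp
    qed
    then show "\<exists>N. \<forall>k\<ge>N. \<forall>n\<ge>N. cmod (m k a - m n a) < e"
      by blast
  qed
  then obtain \<rho> where "\<And>a. (\<lambda>n. m n a) \<longlonglongrightarrow> \<rho> a"
    unfolding convergent_def by metis
  with is_plf_limit[OF assms(1) this] show thesis
    using that by blast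
qed

text \<open>The limit \<open>\<rho>\<close> of the parallel sums is absolutely continuous because
  each of them is below a multiple of \<open>lam\<close>. It is greatest because each approximant
  \<open>r n\<close> of a competitor lies below \<open>\<mu>\<close> and below a multiple of
  \<open>lam\<close>, so \<open>parallel_sum_lower_bound\<close> applies with constants tending to
  infinity. The limit at \<open>1\<close> is recorded for the criterion
  \<open>AC_if_parallel_sums_tendsto\<close>.\<close>

lemma greatest_AC_exists:
  assumes \<mu>: "is_plf \<mu>" and lam: "is_plf lam" and null: "plf_null lam \<subseteq> plf_null \<mu>"
  shows "\<exists>\<rho>. ((\<lambda>n. Re (parallel_sum \<mu> (\<lambda>a. complex_of_real (real (Suc n)) * lam a) 1)) \<longlonglongrightarrow> Re (\<rho> 1)) \<and>
    \<rho> \<in> AC lam \<and> \<rho> \<preceq>\<^sub>+ \<mu> \<and> (\<forall>\<rho>'\<in>AC lam. \<rho>' \<preceq>\<^sub>+ \<mu> \<longrightarrow> \<rho>' \<preceq>\<^sub>+ \<rho>)"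
proof -
  define l where "l n = (\<lambda>a. complex_of_real (real (Suc n)) * lam a)" for n
  define m where "m n = parallel_sum \<mu> (l n)" for n
  have l: "is_plf (l n)" for n
    unfolding l_def by (rule is_plf_times[OF lam]) simp
  have l_mono: "l n \<preceq>\<^sub>+ l (Suc n)" for n
    unfolding l_def by (rule times_plf_le_mono[OF lam]) simp
  have m: "is_plf (m n)" "m n \<preceq>\<^sub>+ \<mu>" "m n \<preceq>\<^sub>+ l n" "m n \<preceq>\<^sub>+ m (Suc n)" for n
    unfolding m_def
    by (auto intro!: is_plf_parallel_sum parallel_sum_le_left parallel_sum_le_right parallel_sum_mono
        \<mu> l l_mono plf_le_refl)
  have "Re (m n 1) \<le> Re (\<mu> 1)" for n
    using plf_le_Re[OF m(2), of n 1] by simp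
  then obtain \<rho> where \<rho>: "is_plf \<rho>" "\<And>a. (\<lambda>n. m n a) \<longlonglongrightarrow> \<rho> a"
    using incseq_plf_convergent[of m, OF m(1,4)] by blast
  have \<rho>\<mu>: "\<rho> \<preceq>\<^sub>+ \<mu>"
  proof (intro plf_leI \<mu> \<rho>)
    fix a
    show "Re (\<rho> (star a * a)) \<le> Re (\<mu> (star a * a))"
      using plf_le_Re[OF m(2)] by (intro LIMSEQ_le_const2[OF tendsto_Re[OF \<rho>(2)[of "star a * a"]]]) auto
  qed
  have "\<rho> \<in> AC lam"
    using m \<rho> null plf_null_mono[OF \<rho>(1) \<mu> \<rho>\<mu>] unfolding AC_def l_def
    by (auto intro!: exI[of _ m] exI[of _ "\<lambda>n. real (Suc n)"] simp del: of_nat_Suc)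
  moreover have "\<rho>' \<preceq>\<^sub>+ \<rho>" if \<rho>': "\<rho>' \<in> AC lam" "\<rho>' \<preceq>\<^sub>+ \<mu>" for \<rho>'
  proof -
    obtain r t where r: "\<And>n. is_plf (r n)" "\<And>a. (\<lambda>n. r n a) \<longlonglongrightarrow> \<rho>' a"
      "\<And>n. 0 < t n" "\<And>n. r n \<preceq>\<^sub>+ (\<lambda>a. complex_of_real (t n) * lam a)" "\<And>n. r n \<preceq>\<^sub>+ \<rho>'"
      using ACE[OF \<rho>'(1)] by metis
    have "Re (r n (star a * a)) \<le> Re (\<rho> (star a * a))" for n a
    proof (rule LIMSEQ_le)
      \<comment> \<open>This factor turns the bound \<open>t n\<close> for \<open>r n\<close> into
        the bound \<open>real (Suc j)\<close> of \<open>l j\<close>.\<close>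
      define k where "k j = real (Suc j) / t n" for j
      have k: "0 < k j" for j
        using r(3) by (simp add: k_def)
      have "(\<lambda>a. complex_of_real (k j) * r n a) \<preceq>\<^sub>+ l j" for j
      proof -
        have "complex_of_real (k j) * (complex_of_real (t n) * x) = complex_of_real (real (Suc j)) * x" for x
          using r(3)[of n] by (simp add: k_def)
        then have "(\<lambda>a. complex_of_real (k j) * (complex_of_real (t n) * lam a)) = l j"
          unfolding l_def by (rule ext)
        then show ?thesis
          using plf_le_times[OF r(4)[of n], of "k j"] k[of j] by simp
      qed
      then have "k j / (1 + k j) * Re (r n (star a * a)) \<le> Re (m j (star a * a))" for j
        unfolding m_def using plf_le_trans[OF r(5) \<rho>'(2)]
        by (intro parallel_sum_lower_bound k r \<mu> l)
      then show "\<exists>N. \<forall>j\<ge>N. k j / (1 + k j) * Re (r n (star a * a)) \<le> Re (m j (star a * a))"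
        by blast
      have "filterlim k at_top sequentially"
        unfolding k_def
        by (rule filterlim_at_top_mult_tendsto_pos[of "\<lambda>_. 1 / t n" "1 / t n", simplified])
          (use r(3) in \<open>auto simp: divide_inverse intro!: filterlim_compose[OF filterlim_real_sequentially filterlim_Suc] simp del: of_nat_Suc\<close>)
      then have "(\<lambda>j. 1 - 1 / (1 + k j)) \<longlonglongrightarrow> 1 - 0"
        by (intro tendsto_intros tendsto_divide_0[OF tendsto_const] filterlim_at_top_imp_at_infinity
            filterlim_tendsto_add_at_top[OF tendsto_const])
      moreover have "1 - 1 / (1 + k j) = k j / (1 + k j)" for j
        using k[of j] by (simp add: field_simps)
      ultimately show "(\<lambda>j. k j / (1 + k j) * Re (r n (star a * a))) \<longlonglongrightarrow> Re (r n (star a * a))"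
        using tendsto_mult[of "\<lambda>j. k j / (1 + k j)" 1 sequentially "\<lambda>_. Re (r n (star a * a))"] by simp
      show "(\<lambda>j. Re (m j (star a * a))) \<longlonglongrightarrow> Re (\<rho> (star a * a))"
        by (intro tendsto_Re \<rho>)
    qed
    then show ?thesis
      using \<rho> ACD_plf[OF \<rho>'(1)]
      by (intro plf_leI LIMSEQ_le_const2[OF tendsto_Re[OF r(2)]]) auto
  qed
  moreover have "(\<lambda>n. Re (m n 1)) \<longlonglongrightarrow> Re (\<rho> 1)"
    by (intro tendsto_Re \<rho>)
  ultimately show ?thesis
    using \<rho>\<mu> unfolding m_def l_def by blast
qed

context
  fixes \<mu> lam :: "'a::unital_cstar_algebra \<Rightarrow> complex"
  assumes plfs: "is_plf \<mu>" "is_plf lam" and null: "plf_null lam \<subseteq> plf_null \<mu>"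
begin

lemma ac_part_AC: "ac_part lam \<mu> \<in> AC lam"
  and ac_part_le: "ac_part lam \<mu> \<preceq>\<^sub>+ \<mu>"
  and ac_part_greatest: "\<rho> \<in> AC lam \<Longrightarrow> \<rho> \<preceq>\<^sub>+ \<mu> \<Longrightarrow> \<rho> \<preceq>\<^sub>+ ac_part lam \<mu>"
proof -
  have "\<exists>!\<rho>. \<rho> \<in> AC lam \<and> \<rho> \<preceq>\<^sub>+ \<mu> \<and> (\<forall>\<rho>'\<in>AC lam. \<rho>' \<preceq>\<^sub>+ \<mu> \<longrightarrow> \<rho>' \<preceq>\<^sub>+ \<rho>)"
    using greatest_AC_exists[OF plfs null] by (blast intro: plf_le_antisym)
  from theI'[OF this] show "ac_part lam \<mu> \<in> AC lam" "ac_part lam \<mu> \<preceq>\<^sub>+ \<mu>"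
    "\<rho> \<in> AC lam \<Longrightarrow> \<rho> \<preceq>\<^sub>+ \<mu> \<Longrightarrow> \<rho> \<preceq>\<^sub>+ ac_part lam \<mu>"
    unfolding ac_part_def by blast+
qed

text \<open>The limit functional is below \<open>\<mu>\<close>, and a positive difference vanishes
  as soon as it vanishes at \<open>1\<close>; hence only this one value has to be
  controlled.\<close>

lemma AC_if_parallel_sums_tendsto:
  assumes "(\<lambda>n. Re (parallel_sum \<mu> (\<lambda>a. complex_of_real (real (Suc n)) * lam a) 1)) \<longlonglongrightarrow> Re (\<mu> 1)"
  shows "\<mu> \<in> AC lam"
proof -
  obtain \<rho> where \<rho>: "(\<lambda>n. Re (parallel_sum \<mu> (\<lambda>a. complex_of_real (real (Suc n)) * lam a) 1)) \<longlonglongrightarrow> Re (\<rho> 1)"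
    "\<rho> \<in> AC lam" "\<rho> \<preceq>\<^sub>+ \<mu>"
    using greatest_AC_exists[OF plfs null] by blast
  have "Re (\<rho> 1) = Re (\<mu> 1)"
    using LIMSEQ_unique[OF \<rho>(1) assms] .
  then have "\<mu> \<preceq>\<^sub>+ \<rho>"
    using plf_eq_zero[of "\<lambda>a. \<mu> a - \<rho> a"] \<rho>(3) by (auto simp: plf_le_def fun_eq_iff is_plf_zero)
  then show ?thesis
    using plf_le_antisym \<rho> by blast
qed

end

section \<open>Singular functionals and the singular part\<close>

lemma AC_SG_eq_zero:
  assumes "is_plf lam" "\<rho> \<in> AC lam" "\<rho> \<in> SG lam"
  shows "\<rho> = (\<lambda>_. 0)"
proof -
  obtain m t where m: "\<And>n. is_plf (m n)" "\<And>a. (\<lambda>n. m n a) \<longlonglongrightarrow> \<rho> a"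
    "\<And>n. 0 < t n" "\<And>n. m n \<preceq>\<^sub>+ (\<lambda>a. complex_of_real (t n) * lam a)" "\<And>n. m n \<preceq>\<^sub>+ \<rho>"
    using ACE[OF assms(2)] by metis
  have "m n a = 0" for n a
  proof -
    \<comment> \<open>Scaling by this factor brings \<open>m n\<close> below \<open>\<rho>\<close>
      and below \<open>lam\<close> at the same time, so singularity annihilates it.\<close>
    define c where "c = 1 / max 1 (t n)"
    have c: "0 < c" "c \<le> 1" "c * t n \<le> 1"
      using m(3)[of n] by (auto simp: c_def field_simps)
    have 1: "(\<lambda>a. complex_of_real c * m n a) \<preceq>\<^sub>+ \<rho>"
      using times_plf_le_mono[OF m(1)[of n] c(2)] m(5)[of n] by (auto intro: plf_le_trans)
    have "(\<lambda>a. complex_of_real c * m n a) \<preceq>\<^sub>+ (\<lambda>a. complex_of_real (c * t n) * lam a)"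
      using plf_le_times[OF m(4)[of n], of c] c by (simp add: mult.assoc)
    then have 2: "(\<lambda>a. complex_of_real c * m n a) \<preceq>\<^sub>+ lam"
      using times_plf_le_mono[OF assms(1) c(3)] by (auto intro: plf_le_trans)
    have "(\<lambda>a. complex_of_real c * m n a) = (\<lambda>_. 0)"
      using assms(3) 1 2 is_plf_times[OF m(1)[of n], of c] c by (auto simp: SG_def)
    then show ?thesis
      using c(1) by (auto simp: fun_eq_iff)
  qed
  then show ?thesis
    using m(2) by (auto simp: LIMSEQ_const_iff)
qed

lemma SGD_plf: "\<mu> \<in> SG lam \<Longrightarrow> is_plf \<mu>" and SGD_null: "\<mu> \<in> SG lam \<Longrightarrow> plf_null lam \<subseteq> plf_null \<mu>"
  by (auto simp: SG_def)

lemma hereditary_SG: "hereditary (SG lam)"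
proof (unfold hereditary_def, intro ballI allI impI, elim conjE)
  fix \<phi> \<psi>
  assume \<phi>: "\<phi> \<in> SG lam" and \<psi>: "is_plf \<psi>" "\<psi> \<preceq>\<^sub>+ \<phi>"
  have "plf_null lam \<subseteq> plf_null \<psi>"
    using SGD_null[OF \<phi>] plf_null_mono[OF \<psi>(1) SGD_plf[OF \<phi>] \<psi>(2)] by blast
  moreover have "\<rho> = (\<lambda>_. 0)" if "is_plf \<rho>" "\<rho> \<preceq>\<^sub>+ \<psi>" "\<rho> \<preceq>\<^sub>+ lam" for \<rho>
    using \<phi> that plf_le_trans[OF that(2) \<psi>(2)] by (simp add: SG_def)
  ultimately show "\<psi> \<in> SG lam"
    using \<psi>(1) by (simp add: SG_def)
qed

lemma zero_in_SG: "(\<lambda>_. 0) \<in> SG lam"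
  unfolding SG_def by (auto simp: is_plf_zero plf_null_def intro: plf_le_antisym zero_plf_le)

lemma SG_times:
  assumes "\<mu> \<in> SG lam" "0 \<le> r"
  shows "(\<lambda>a. complex_of_real r * \<mu> a) \<in> SG lam"
proof (cases "r = 0")
  case False
  then have r: "0 < r"
    using assms(2) by simp
  have "\<rho> = (\<lambda>_. 0)"
    if \<rho>: "is_plf \<rho>" "\<rho> \<preceq>\<^sub>+ (\<lambda>a. complex_of_real r * \<mu> a)" "\<rho> \<preceq>\<^sub>+ lam" for \<rho>
  proof -
    define c where "c = 1 / max 1 r"
    have c: "0 < c" "c \<le> 1" "c * r \<le> 1"
      using r by (auto simp: c_def field_simps)
    have 1: "(\<lambda>a. complex_of_real c * \<rho> a) \<preceq>\<^sub>+ lam"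
      using times_plf_le_mono[OF \<rho>(1) c(2)] \<rho>(3) by (auto intro: plf_le_trans)
    have "(\<lambda>a. complex_of_real c * \<rho> a) \<preceq>\<^sub>+ (\<lambda>a. complex_of_real (c * r) * \<mu> a)"
      using plf_le_times[OF \<rho>(2), of c] c by (simp add: mult.assoc)
    then have 2: "(\<lambda>a. complex_of_real c * \<rho> a) \<preceq>\<^sub>+ \<mu>"
      using times_plf_le_mono[OF SGD_plf[OF assms(1)] c(3)] by (auto intro: plf_le_trans)
    have "(\<lambda>a. complex_of_real c * \<rho> a) = (\<lambda>_. 0)"
      using assms(1) 1 2 is_plf_times[OF \<rho>(1), of c] c by (auto simp: SG_def)
    then show ?thesis
      using c(1) by (auto simp: fun_eq_iff)
  qed
  moreover have "plf_null lam \<subseteq> plf_null (\<lambda>a. complex_of_real r * \<mu> a)"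
    using SGD_null[OF assms(1)] by (auto simp: plf_null_def)
  ultimately show ?thesis
    using is_plf_times[OF SGD_plf[OF assms(1)] assms(2)] by (auto simp: SG_def)
qed (simp add: zero_in_SG)

text \<open>A functional below both the remainder and \<open>lam\<close> is absolutely continuous;
  added to \<open>ac_part lam \<mu>\<close> it stays below \<open>\<mu>\<close>, so maximality makes
  it zero.\<close>

lemma s_part_SG:
  assumes "is_plf \<mu>" "is_plf lam" "plf_null lam \<subseteq> plf_null \<mu>"
  shows "s_part lam \<mu> \<in> SG lam"
proof -
  let ?\<rho> = "ac_part lam \<mu>"
  have plf: "is_plf (s_part lam \<mu>)"
    using ac_part_le[OF assms] by (simp add: plf_le_def s_part_def)
  have le: "s_part lam \<mu> \<preceq>\<^sub>+ \<mu>"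
    using ACD_plf[OF ac_part_AC[OF assms]] by (simp add: plf_le_def s_part_def)
  have "\<rho> = (\<lambda>_. 0)" if \<rho>: "is_plf \<rho>" "\<rho> \<preceq>\<^sub>+ s_part lam \<mu>" "\<rho> \<preceq>\<^sub>+ lam" for \<rho>
  proof -
    have "\<rho> \<in> AC lam"
      using \<rho> plf_null_mono[OF \<rho>(1) assms(2) \<rho>(3)] unfolding AC_def
      by (auto intro!: exI[of _ "\<lambda>_. \<rho>"] exI[of _ "\<lambda>_. 1"] plf_le_refl)
    then have "(\<lambda>a. ?\<rho> a + \<rho> a) \<in> AC lam"
      by (rule AC_plus[OF ac_part_AC[OF assms]])
    moreover have "(\<lambda>a. ?\<rho> a + \<rho> a) \<preceq>\<^sub>+ \<mu>"
      using \<rho>(2) by (simp add: plf_le_def s_part_def diff_diff_eq)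
    ultimately have "(\<lambda>a. ?\<rho> a + \<rho> a) \<preceq>\<^sub>+ ?\<rho>"
      by (rule ac_part_greatest[OF assms])
    then show ?thesis
      using plf_le_antisym[OF plf_le_add_left[OF \<rho>(1), of ?\<rho>]] by (auto simp: fun_eq_iff)
  qed
  then show ?thesis
    using plf assms(3) plf_null_mono[OF plf assms(1) le] by (auto simp: SG_def)
qed

section \<open>The KMS condition makes the involution bounded\<close>

text \<open>The element \<open>a'\<close> is determined only modulo \<open>plf_null lam\<close>, so
  there is no map to which an open mapping theorem could be applied. Its proof is run on the linear
  relation \<open>G\<close> instead: Baire category yields approximate solutions with a norm bound,
  and these are summed to exact ones.\<close>

lemma kms_open_mapping:
  fixes lam :: "'a::unital_cstar_algebra \<Rightarrow> complex"
  assumes lam: "is_plf lam" and kms: "\<And>a. \<exists>a'. \<forall>b. lam (a * b) = lam (b * a')"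
  obtains K where "0 < K" "\<And>a. \<exists>a'. (\<forall>b. lam (a * b) = lam (b * a')) \<and> norm a' \<le> K * norm a"
proof -
  define G where "G a a' \<longleftrightarrow> (\<forall>b. lam (a * b) = lam (b * a'))" for a a'
  have G_diff: "G (u - v) (u' - v')" if "G u u'" "G v v'" for u v u' v'
    using that by (simp add: G_def left_diff_distrib right_diff_distrib plf_diff[OF lam])
  have G_scaleR: "G (r *\<^sub>R u) (r *\<^sub>R u')" if "G u u'" for r u u'
    using that by (simp add: G_def plf_scaleR[OF lam])
  define E where "E n = {a. \<exists>a'. G a a' \<and> norm a' \<le> real n}" for n
  have "(\<Union>n. closure (E n)) = UNIV"
  proof -
    have "\<exists>n. a \<in> E n" for a
    proof -
      obtain a' where "G a a'"
        using kms[of a] by (auto simp: G_def)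
      then show ?thesis
        using real_arch_simple[of "norm a'"] by (auto simp: E_def)
    qed
    then show ?thesis
      using closure_subset by blast
  qed
  then have "euclidean interior_of \<Union>(range (\<lambda>n. closure (E n))) \<noteq> {}"
    by simp
  then have "\<exists>n. interior (closure (E n)) \<noteq> {}"
    using Baire_category_alt[of "euclidean :: 'a topology" "range (\<lambda>n. closure (E n))"]
      completely_metrizable_space_euclidean by auto
  then obtain n x r where r: "0 < r" "ball x r \<subseteq> closure (E n)"
    by (metis all_not_in_conv mem_interior)
  define K0 where "K0 = 4 * real n / r"
  have K0: "0 \<le> K0"
    using r by (simp add: K0_def)
  have step: "\<exists>z z'. G z z' \<and> norm (y - z) \<le> norm y / 2 \<and> norm z' \<le> K0 * norm y" for y
  proof (cases "y = 0")
    case True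
    have "G 0 0"
      by (simp add: G_def)
    then show ?thesis
      using True by (intro exI[of _ 0]) auto
  next
    case False
    \<comment> \<open>With \<open>k * norm y = r / 2\<close> the point
      \<open>x + k *\<^sub>R y\<close> remains in the ball. The two approximation errors of
      \<open>r / 8\<close> add up to \<open>r / 4\<close>, which after division by \<open>k\<close>
      is \<open>norm y / 2\<close>.\<close>
    define k where "k = r / (2 * norm y)"
    have k: "0 < k" "k * norm y = r / 2"
      using False r by (auto simp: k_def)
    have "x + k *\<^sub>R y \<in> closure (E n)" "x \<in> closure (E n)"
      using r k by (auto intro!: subsetD[OF r(2)] simp: dist_norm)
    then obtain u v where "u \<in> E n" "dist u (x + k *\<^sub>R y) < r / 8" "v \<in> E n" "dist v x < r / 8"
      using r(1) by (meson closure_approachable divide_pos_pos zero_less_numeral)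
    then obtain u' v' where u: "G u u'" "norm u' \<le> real n" "norm (u - (x + k *\<^sub>R y)) < r / 8"
      and v: "G v v'" "norm v' \<le> real n" "norm (v - x) < r / 8"
      by (auto simp: E_def dist_norm)
    define z where "z = (1 / k) *\<^sub>R (u - v)"
    define z' where "z' = (1 / k) *\<^sub>R (u' - v')"
    define w where "w = (v - x) - (u - (x + k *\<^sub>R y))"
    have "norm w \<le> r / 4"
      using norm_triangle_ineq4[of "v - x" "u - (x + k *\<^sub>R y)"] u v by (simp add: w_def)
    moreover have "y - z = (1 / k) *\<^sub>R w"
      using k(1) by (simp add: z_def w_def algebra_simps)
    ultimately have "norm (y - z) \<le> (r / 4) / k"
      using k(1) divide_right_mono[of "norm w" "r / 4" k] by simp
    also have "\<dots> = norm y / 2"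
      using k r(1) by (simp add: field_simps)
    finally have "norm (y - z) \<le> norm y / 2" .
    moreover have "norm z' \<le> 2 * real n / k"
      using norm_triangle_ineq4[of u' v'] u v k(1) by (simp add: z'_def divide_right_mono)
    then have "norm z' \<le> K0 * norm y"
      using False r by (simp add: K0_def k_def field_simps)
    moreover have "G z z'"
      unfolding z_def z'_def by (intro G_scaleR G_diff u v)
    ultimately show ?thesis
      by blast
  qed
  then obtain Z Z' where Z: "\<And>y. G (Z y) (Z' y)" "\<And>y. norm (y - Z y) \<le> norm y / 2" "\<And>y. norm (Z' y) \<le> K0 * norm y"
    by metis
  have "\<exists>a'. (\<forall>b. lam (a * b) = lam (b * a')) \<and> norm a' \<le> (2 * K0 + 1) * norm a" for a
  proof -
    \<comment> \<open>\<open>Y k\<close> is the residual after \<open>k\<close> corrections; each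
      correction halves the bound on its norm, so the partners \<open>Z' (Y k)\<close> form a
      geometrically dominated series.\<close>
    define Y where "Y = rec_nat a (\<lambda>_ y. y - Z y)"
    have Y: "Y 0 = a" "Y (Suc k) = Y k - Z (Y k)" for k
      by (auto simp: Y_def)
    have Y_norm: "norm (Y k) \<le> norm a * (1/2) ^ k" for k
    proof (induction k)
      case (Suc k)
      then show ?case
        using Z(2)[of "Y k"] by (simp add: Y)
    qed (simp add: Y)
    have Z'_norm: "norm (Z' (Y k)) \<le> K0 * norm a * (1/2) ^ k" for k
      using Z(3)[of "Y k"] mult_left_mono[OF Y_norm K0, of k] by simp
    have geo: "(\<lambda>k. K0 * norm a * (1/2) ^ k) sums (K0 * norm a * 2)"
      using geometric_sums[of "1/2 :: real"] by (intro sums_mult) simp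
    have summ: "summable (\<lambda>k. Z' (Y k))"
      by (rule summable_comparison_test[OF _ sums_summable[OF geo]]) (use Z'_norm in blast)
    define a' where "a' = (\<Sum>k. Z' (Y k))"
    have "norm a' \<le> K0 * norm a * 2"
      unfolding a'_def using norm_suminf_le[OF Z'_norm sums_summable[OF geo]] sums_unique[OF geo] by simp
    then have norm_a': "norm a' \<le> (2 * K0 + 1) * norm a"
      by (simp add: algebra_simps) (use norm_ge_zero[of a] in linarith)
    have "lam (a * b) = lam (b * a')" for b
    proof -
      have partial: "lam (b * (\<Sum>k<n. Z' (Y k))) = lam (a * b) - lam (Y n * b)" for n
      proof (induction n)
        case (Suc n)
        have "lam (b * Z' (Y n)) = lam (Z (Y n) * b)"
          using Z(1)[of "Y n"] by (simp add: G_def)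
        then show ?case
          using Suc by (simp add: Y distrib_left left_diff_distrib plf_linear[OF lam])
      qed (simp add: Y plf_zero[OF lam])
      have "(\<lambda>n. lam (b * (\<Sum>k<n. Z' (Y k)))) \<longlonglongrightarrow> lam (b * a')"
        unfolding a'_def
        by (intro bounded_linear.tendsto[OF bounded_linear_plf[OF lam]] tendsto_intros summable_LIMSEQ summ)
      moreover have "Y \<longlonglongrightarrow> 0"
        by (rule Lim_null_comparison[OF always_eventually[OF allI[OF Y_norm]]])
          (auto intro!: tendsto_mult_right_zero LIMSEQ_power_zero)
      then have "(\<lambda>n. lam (a * b) - lam (Y n * b)) \<longlonglongrightarrow> lam (a * b) - lam (0 * b)"
        by (intro bounded_linear.tendsto[OF bounded_linear_plf[OF lam]] tendsto_intros)
      ultimately show ?thesis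
        unfolding partial using LIMSEQ_unique by (fastforce simp: plf_zero[OF lam])
    qed
    then show ?thesis
      using norm_a' by blast
  qed
  then show thesis
    using that[of "2 * K0 + 1"] K0 by simp
qed

text \<open>The twist \<open>a \<mapsto> a'\<close> is symmetric for the GNS inner product, so it has moments
  \<open>M (j + k) = \<langle>s j, s k\<rangle>\<close>, and \<open>M 1 = lam (a a\<^sup>*)\<close>. By log-convexity of the moments,
  the exponential growth rate of \<open>M\<close> bounds \<open>M 1 / M 0\<close>.\<close>

lemma kms_star_bounded:
  fixes lam :: "'a::unital_cstar_algebra \<Rightarrow> complex"
  assumes lam: "is_plf lam" and kms: "\<And>a. \<exists>a'. \<forall>b. lam (a * b) = lam (b * a')"
  obtains K where "0 < K" "\<And>a. gns_norm lam (star a) \<le> K * gns_norm lam a"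
proof -
  obtain K where K: "0 < K" "\<And>a. \<exists>a'. (\<forall>b. lam (a * b) = lam (b * a')) \<and> norm a' \<le> K * norm a"
    using kms_open_mapping[OF lam kms] by blast
  then obtain T where T: "\<And>a b. lam (a * b) = lam (b * T a)" "\<And>a. norm (T a) \<le> K * norm a"
    by metis
  have "(gns_norm lam (star a))\<^sup>2 \<le> K * (gns_norm lam a)\<^sup>2" for a
  proof -
    define s where "s k = (T ^^ k) a" for k
    define N where "N = gns_norm lam a"
    have N0: "0 \<le> N"
      by (simp add: N_def gns_norm_nonneg lam)
    define M where "M n = lam (star a * s n)" for n
    \<comment> \<open>One use of the KMS relation. Together with hermiticity it moves a twist from
      one side of the inner product to the other, so that only the total number of twists
      matters.\<close>
    have hankel1: "lam (star (s k) * s (Suc j)) = lam (s j * star (s k))" for j k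
      using T(1)[of "s j" "star (s k)"] by (simp add: s_def)
    have hankel: "lam (star (s (Suc k)) * s j) = lam (star (s k) * s (Suc j))" for j k
    proof -
      have "lam (star (s (Suc k)) * s j) = cnj (lam (star (s j) * s (Suc k)))"
        by (rule plf_hermitian[OF lam])
      also have "\<dots> = cnj (lam (star (star (s k)) * star (s j)))"
        by (simp add: hankel1 star_star)
      also have "\<dots> = lam (star (star (s j)) * star (s k))"
        by (rule plf_hermitian[OF lam, symmetric])
      finally show ?thesis
        by (simp add: hankel1 star_star)
    qed
    have moment: "lam (star (s k) * s j) = M (j + k)" for j k
      by (induction k arbitrary: j) (simp_all add: hankel, simp add: M_def s_def)
    have s_norm: "norm (s k) \<le> K ^ k * norm a" for k
    proof (induction k)
      case (Suc k)
      show ?case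
        using order_trans[OF T(2)[of "s k"] mult_left_mono[OF Suc less_imp_le[OF K(1)]]]
        by (simp add: s_def mult.assoc)
    qed (simp add: s_def)
    have M_le: "cmod (M n) \<le> N * gns_norm lam (s n)" for n
      unfolding M_def N_def by (rule plf_Cauchy_Schwarz[OF lam])
    have M_sq: "(cmod (M n))\<^sup>2 \<le> N\<^sup>2 * cmod (M (2 * n))" for n
    proof -
      have "cmod (M (2 * n)) = (gns_norm lam (s n))\<^sup>2"
        unfolding mult_2 moment[of n n, symmetric] plf_star_mult_self[OF lam] norm_of_real abs_power2 ..
      then show ?thesis
        using power_mono[OF M_le[of n], of 2] by (simp add: power_mult_distrib)
    qed
    have "cmod (M 1) \<le> K * N\<^sup>2"
    proof (cases "N = 0")
      case True
      then show ?thesis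
        using M_le[of 1] by simp
    next
      case False
      then have N: "0 < N"
        using N0 by simp
      \<comment> \<open>The index doubles under squaring: \<open>u 0 ^ (2 ^ i) \<le> u i\<close>,
        while norm bounds give \<open>u i \<le> D * K ^ (2 ^ i)\<close>. The constant
        \<open>D\<close> disappears on taking roots, and \<open>u 0 \<le> K\<close> remains.\<close>
      define u where "u i = cmod (M (2 ^ i)) / N\<^sup>2" for i
      have u0: "0 \<le> u i" for i
        by (simp add: u_def)
      have u_sq: "(u i)\<^sup>2 \<le> u (Suc i)" for i
        using M_sq[of "2 ^ i"] N by (simp add: u_def power_divide field_simps power2_eq_square)
      have u_pow: "u 0 ^ (2 ^ i) \<le> u i" for i
      proof (induction i)
        case (Suc i)
        have "u 0 ^ 2 ^ Suc i = (u 0 ^ 2 ^ i)\<^sup>2"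
          by (simp add: mult.commute flip: power_mult)
        also have "\<dots> \<le> (u i)\<^sup>2"
          using Suc u0 by (intro power_mono) auto
        finally show ?case
          using u_sq[of i] by linarith
      qed simp
      define D where "D = norm a * gns_norm lam 1 / N"
      have u_le: "u i \<le> D * K ^ (2 ^ i)" for i
      proof -
        have "cmod (M (2 ^ i)) \<le> N * (norm (s (2 ^ i)) * gns_norm lam 1)"
          using M_le[of "2 ^ i"] mult_left_mono[OF gns_norm_le[OF lam] N0] order_trans by blast
        also have "\<dots> \<le> N * ((K ^ 2 ^ i * norm a) * gns_norm lam 1)"
          using N0 s_norm by (intro mult_left_mono mult_right_mono gns_norm_nonneg lam)
        finally show ?thesis
          using N by (simp add: u_def D_def field_simps power2_eq_square)
      qed
      have "u 0 \<le> K"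
      proof (rule ccontr)
        assume "\<not> u 0 \<le> K"
        then have q: "1 < u 0 / K"
          using K(1) by simp
        obtain n where n: "D < (u 0 / K) ^ n"
          using real_arch_pow[OF q] by blast
        have "(u 0 / K) ^ n \<le> (u 0 / K) ^ (2 ^ n)"
          using q by (intro power_increasing) auto
        also have "\<dots> \<le> D"
          using order_trans[OF u_pow u_le, of n] K(1) by (simp add: power_divide divide_le_eq)
        finally show False
          using n by simp
      qed
      then show ?thesis
        using N by (simp add: u_def field_simps)
    qed
    moreover have "M 1 = of_real ((gns_norm lam (star a))\<^sup>2)"
      using hankel1[of 0 0] plf_star_mult_self[OF lam, of "star a"]
      by (simp add: M_def s_def star_star)
    then have "cmod (M 1) = (gns_norm lam (star a))\<^sup>2"
      by (simp add: norm_power gns_norm_nonneg[OF lam])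
    ultimately show ?thesis
      by (simp add: N_def)
  qed
  note sq = this
  have "gns_norm lam (star a) \<le> sqrt K * gns_norm lam a" for a
  proof (rule power2_le_imp_le)
    show "(gns_norm lam (star a))\<^sup>2 \<le> (sqrt K * gns_norm lam a)\<^sup>2"
      using sq[of a] K(1) by (simp add: power_mult_distrib)
    show "0 \<le> sqrt K * gns_norm lam a"
      using K(1) gns_norm_nonneg[OF lam, of a] by simp
  qed
  then show thesis
    using that[of "sqrt K"] K(1) by simp
qed

section \<open>Approximate resolvents\<close>

text \<open>Positivity is tested on functionals instead of by factorizations \<open>c\<^sup>* c\<close>, and inverses are replaced by
  geometric partial sums. This avoids spectral theory, in particular the fact that
  \<open>1 + a\<^sup>* a\<close> is invertible.\<close>

definition plf_positive :: "'a::unital_cstar_algebra \<Rightarrow> bool" where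
  "plf_positive p \<longleftrightarrow> star p = p \<and> (\<forall>\<phi>. is_plf \<phi> \<longrightarrow> 0 \<le> Re (\<phi> p))"

lemma plf_positiveD: "plf_positive p \<Longrightarrow> star p = p" "plf_positive p \<Longrightarrow> is_plf \<phi> \<Longrightarrow> 0 \<le> Re (\<phi> p)"
  by (auto simp: plf_positive_def)

lemma plf_positive_compress: "plf_positive p \<Longrightarrow> plf_positive (star c * p * c)"
  using plf_compress[of _ c] by (auto simp: plf_positive_def star_simps mult.assoc)

lemma plf_positive_square: "plf_positive (star a * a)"
  by (auto simp: plf_positive_def star_simps plf_Re_pos)

lemma plf_positive_one: "plf_positive 1"
  using plf_positive_square[of 1] by simp

lemma plf_positive_add: "plf_positive p \<Longrightarrow> plf_positive q \<Longrightarrow> plf_positive (p + q)"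
  by (auto simp: plf_positive_def star_simps plf_add)

lemma plf_positive_scaleR: "plf_positive p \<Longrightarrow> 0 \<le> r \<Longrightarrow> plf_positive (r *\<^sub>R p)"
  by (auto simp: plf_positive_def star_simps plf_scaleR)

lemma plf_positive_sum: "(\<And>i. i \<in> I \<Longrightarrow> plf_positive (f i)) \<Longrightarrow> plf_positive (sum f I)"
  using plf_positive_scaleR[OF plf_positive_one, of 0]
  by (induction I rule: infinite_finite_induct) (auto intro: plf_positive_add)

lemma plf_positive_norm_diff:
  assumes "star h = h" "norm h \<le> r"
  shows "plf_positive (r *\<^sub>R 1 - h)"
proof -
  have "Re (\<phi> h) \<le> r * Re (\<phi> 1)" if "is_plf \<phi>" for \<phi>
    using plf_Re_selfadjoint_le[OF that assms(1)] mult_right_mono[OF assms(2)] plf_Re_pos[OF that, of 1]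
    by (simp) (metis order_trans)
  then show ?thesis
    using assms(1) by (auto simp: plf_positive_def star_simps plf_linear)
qed

text \<open>For \<open>d = s *\<^sub>R 1 - p\<close>, which commutes with \<open>p\<close>, the
  product \<open>p * d\<close> is \<open>1 / s\<close> times \<open>p * d * p + d * p * d\<close>, a
  sum of compressions of positive elements. This replaces the product of commuting square
  roots.\<close>

lemma plf_positive_mult_diff:
  assumes "plf_positive p" "plf_positive (s *\<^sub>R 1 - p)" "0 < s"
  shows "plf_positive (s *\<^sub>R p - p * p)"
proof -
  let ?d = "s *\<^sub>R 1 - p"
  have "plf_positive (star p * ?d * p + star ?d * p * ?d)"
    by (intro plf_positive_add plf_positive_compress assms)
  moreover have "star p * ?d * p + star ?d * p * ?d = s *\<^sub>R (s *\<^sub>R p - p * p)"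
    using plf_positiveD(1)[OF assms(1)] by (simp add: star_simps algebra_simps)
  ultimately have "plf_positive (s *\<^sub>R (s *\<^sub>R p - p * p))"
    by simp
  then have "plf_positive ((1 / s) *\<^sub>R (s *\<^sub>R (s *\<^sub>R p - p * p)))"
    by (rule plf_positive_scaleR) (use assms(3) in simp)
  moreover have "(1 / s) *\<^sub>R (s *\<^sub>R (s *\<^sub>R p - p * p)) = s *\<^sub>R p - p * p"
    unfolding scaleR_scaleR using assms(3) by simp
  ultimately show ?thesis
    by simp
qed

lemma plf_positive_compress_le:
  assumes "plf_positive (q - p)" "is_plf \<phi>"
  shows "Re (\<phi> (star c * p * c)) \<le> Re (\<phi> (star c * q * c))"
  using plf_positiveD(2)[OF plf_positive_compress[OF assms(1), of c] assms(2)]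
  by (simp add: algebra_simps plf_linear[OF assms(2)])

text \<open>\<open>q\<close> stands for the inverse of \<open>1 + p\<close>. The error is measured
  in all GNS seminorms at once because positivity tested on functionals yields estimates in exactly
  this form.\<close>

definition approx_resolvent :: "real \<Rightarrow> 'a::unital_cstar_algebra \<Rightarrow> 'a \<Rightarrow> bool" where
  "approx_resolvent \<delta> p q \<longleftrightarrow> plf_positive p \<and> plf_positive q \<and> plf_positive (1 - q) \<and> p * q = q * p \<and>
    (\<forall>\<phi> c. is_plf \<phi> \<longrightarrow> gns_norm \<phi> ((1 - (1 + p) * q) * c) \<le> \<delta> * gns_norm \<phi> c)"

text \<open>\<open>q\<close> is a partial sum of the Neumann series of
  \<open>1 + p = R *\<^sub>R (1 - r)\<close>, and the residual is exactly
  \<open>r ^ n\<close>.\<close>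

lemma approx_resolvent_exists:
  fixes p :: "'a::unital_cstar_algebra"
  assumes p: "plf_positive p" and \<delta>: "0 < \<delta>"
  obtains q where "approx_resolvent \<delta> p q"
proof -
  \<comment> \<open>With this \<open>R\<close> one has \<open>0 \<le> r \<le> s\<close> in the sense
    of functionals, where \<open>0 < s < 1\<close>: the lower bound uses the norm of
    \<open>p\<close>, the upper bound its positivity.\<close>
  define R where "R = 2 + norm p"
  define r where "r = 1 - (1/R) *\<^sub>R (1 + p)"
  define s where "s = 1 - 1/R"
  have R: "2 \<le> R"
    by (simp add: R_def)
  have s: "0 < s" "s < 1"
    using R by (auto simp: s_def)
  have "plf_positive ((1/R) *\<^sub>R ((1 + norm p) *\<^sub>R 1 - p))"
    using R plf_positiveD(1)[OF p] by (intro plf_positive_scaleR plf_positive_norm_diff) auto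
  also have "(1 + norm p) *\<^sub>R 1 - p = R *\<^sub>R 1 - (1 + p)"
    by (simp add: R_def scaleR_2 algebra_simps)
  also have "(1/R) *\<^sub>R (R *\<^sub>R 1 - (1 + p)) = r"
    using R by (simp add: r_def scaleR_diff_right)
  finally have r: "plf_positive r" .
  have sr: "s *\<^sub>R 1 - r = (1/R) *\<^sub>R p"
    by (simp add: s_def r_def algebra_simps)
  have sr_pos: "plf_positive (s *\<^sub>R 1 - r)"
    unfolding sr using R by (intro plf_positive_scaleR p) auto
  \<comment> \<open>From \<open>0 \<le> r \<le> s\<close> follows \<open>r * r \<le> s r\<close>,
    and then \<open>s r\<close> is at most the square of \<open>s\<close>.\<close>
  have r_norm: "gns_norm \<phi> (r * c) \<le> s * gns_norm \<phi> c" if \<phi>: "is_plf \<phi>" for \<phi> c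
  proof (rule power2_le_imp_le)
    have "Re (\<phi> (star c * (r * r) * c)) \<le> Re (\<phi> (star c * (s *\<^sub>R r) * c))"
      by (rule plf_positive_compress_le[OF plf_positive_mult_diff[OF r sr_pos s(1)] \<phi>])
    also have "\<dots> = s * Re (\<phi> (star c * r * c))"
      by (simp add: plf_scaleR[OF \<phi>])
    also have "\<dots> \<le> s * Re (\<phi> (star c * (s *\<^sub>R 1) * c))"
      using s by (intro mult_left_mono plf_positive_compress_le sr_pos \<phi>) auto
    finally show "(gns_norm \<phi> (r * c))\<^sup>2 \<le> (s * gns_norm \<phi> c)\<^sup>2"
      using plf_positiveD(1)[OF r] unfolding power_mult_distrib gns_norm_sq[OF \<phi>]
      by (simp add: star_simps mult.assoc plf_scaleR[OF \<phi>] power2_eq_square)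
  qed (use s gns_norm_nonneg[OF \<phi>] in auto)
  have r_pow: "gns_norm \<phi> (r ^ n * c) \<le> s ^ n * gns_norm \<phi> c" if \<phi>: "is_plf \<phi>" for \<phi> n c
  proof (induction n)
    case (Suc n)
    have "gns_norm \<phi> (r ^ Suc n * c) \<le> s * gns_norm \<phi> (r ^ n * c)"
      using r_norm[OF \<phi>, of "r ^ n * c"] by (simp add: mult.assoc)
    also have "\<dots> \<le> s * (s ^ n * gns_norm \<phi> c)"
      using Suc s by (intro mult_left_mono) auto
    finally show ?case
      by (simp add: mult.assoc)
  qed simp
  \<comment> \<open>An even power is a square, an odd one a compression of \<open>r\<close>.\<close>
  have r_pow_pos: "plf_positive (r ^ n)" for n
  proof (cases "even n")
    case True
    then obtain k where "n = k + k"
      by (metis evenE mult_2)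
    then show ?thesis
      using plf_positive_square[of "r ^ k"] plf_positiveD(1)[OF r] by (simp add: star_power power_add)
  next
    case False
    then obtain k where "n = k + 1 + k"
      by (metis oddE mult_2 add.commute add.left_commute)
    then show ?thesis
      using plf_positive_compress[OF r, of "r ^ k"] plf_positiveD(1)[OF r]
      by (simp add: star_power power_add power_commutes mult.assoc)
  qed
  obtain n where n: "s ^ n < \<delta>"
    using real_arch_pow_inv[OF \<delta> s(2)] by blast
  define q where "q = (1/R) *\<^sub>R (\<Sum>k<n. r ^ k)"
  have q: "plf_positive q"
    unfolding q_def using R r_pow_pos by (intro plf_positive_scaleR plf_positive_sum) auto
  have q_norm: "gns_norm \<phi> q \<le> gns_norm \<phi> 1" if \<phi>: "is_plf \<phi>" for \<phi>
  proof -
    have "(\<Sum>k<n. s ^ k) \<le> R"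
    proof -
      have "(1 - s) * (\<Sum>k<n. s ^ k) \<le> 1"
        using zero_le_power[of s n] s(1) by (simp flip: one_diff_power_eq)
      then show ?thesis
        using R by (simp add: s_def field_simps)
    qed
    have "gns_norm \<phi> (\<Sum>k<n. r ^ k) \<le> (\<Sum>k<n. gns_norm \<phi> (r ^ k))"
      by (rule gns_norm_sum[OF \<phi>])
    also have "\<dots> \<le> (\<Sum>k<n. s ^ k * gns_norm \<phi> 1)"
      using r_pow[OF \<phi>, of _ 1] by (intro sum_mono) simp
    also have "\<dots> \<le> R * gns_norm \<phi> 1"
      unfolding sum_distrib_right[symmetric]
      by (intro mult_right_mono \<open>(\<Sum>k<n. s ^ k) \<le> R\<close> gns_norm_nonneg \<phi>)
    finally show ?thesis
      using R by (simp add: q_def gns_norm_scaleR[OF \<phi>] field_simps)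
  qed
  \<comment> \<open>Tested on functionals, \<open>q \<le> 1\<close> follows from
    \<open>q_norm\<close> by Cauchy-Schwarz.\<close>
  have "plf_positive (1 - q)"
    unfolding plf_positive_def
  proof (intro conjI allI impI)
    show "star (1 - q) = 1 - q"
      using plf_positiveD(1)[OF q] by (simp add: star_simps)
    fix \<phi> :: "'a \<Rightarrow> complex" assume \<phi>: "is_plf \<phi>"
    have "Re (\<phi> q) \<le> gns_norm \<phi> 1 * gns_norm \<phi> q"
      using plf_norm_le[OF \<phi>, of q] complex_Re_le_cmod order_trans by blast
    also have "\<dots> \<le> gns_norm \<phi> 1 * gns_norm \<phi> 1"
      by (intro mult_left_mono q_norm gns_norm_nonneg \<phi>)
    finally show "0 \<le> Re (\<phi> (1 - q))"
      using gns_norm_one_sq[OF \<phi>] by (simp add: plf_linear[OF \<phi>] power2_eq_square)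
  qed
  moreover have p_eq: "1 + p = R *\<^sub>R (1 - r)"
    using R by (simp add: r_def)
  have "p * q = q * p"
  proof -
    have p': "p = R *\<^sub>R (1 - r) - 1"
      using p_eq by (metis add_diff_cancel_left')
    have "r * (\<Sum>k<n. r ^ k) = (\<Sum>k<n. r ^ k) * r"
      by (simp add: sum_distrib_left sum_distrib_right power_commutes)
    then show ?thesis
      unfolding p' q_def by (simp add: algebra_simps)
  qed
  moreover have "1 - (1 + p) * q = r ^ n"
  proof -
    have "(1 - r) * (\<Sum>k<n. r ^ k) = 1 - r ^ n"
    proof (induction n)
      case (Suc n)
      show ?case
        unfolding sum.lessThan_Suc distrib_left Suc.IH by (simp add: left_diff_distrib)
    qed simp
    then show ?thesis
      using R unfolding p_eq q_def by simp
  qed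
  moreover have "gns_norm \<phi> (r ^ n * c) \<le> \<delta> * gns_norm \<phi> c" if \<phi>: "is_plf \<phi>" for \<phi> c
    using r_pow[OF \<phi>, of n c] mult_right_mono[OF less_imp_le[OF n] gns_norm_nonneg[OF \<phi>, of c]] by linarith
  ultimately have "approx_resolvent \<delta> p q"
    using p q by (simp add: approx_resolvent_def)
  then show thesis
    by (rule that)
qed

context
  fixes p q :: "'a::unital_cstar_algebra" and \<delta> :: real
  assumes res: "approx_resolvent \<delta> p q"
begin

lemma approx_resolvent_selfadjoint: "star q = q" "star p = p"
  using res by (auto simp: approx_resolvent_def plf_positive_def)

lemma approx_resolvent_error: "is_plf \<phi> \<Longrightarrow> gns_norm \<phi> ((1 - (1 + p) * q) * c) \<le> \<delta> * gns_norm \<phi> c"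
  using res by (auto simp: approx_resolvent_def)

lemma approx_resolvent_square_le: "plf_positive (q - q * q)"
  using plf_positive_mult_diff[of q 1] res by (simp add: approx_resolvent_def)

lemma approx_resolvent_contraction:
  assumes \<phi>: "is_plf \<phi>"
  shows "gns_norm \<phi> (q * c) \<le> gns_norm \<phi> c"
proof (rule power2_le_imp_le)
  have "Re (\<phi> (star c * (q * q) * c)) \<le> Re (\<phi> (star c * q * c))"
    by (rule plf_positive_compress_le[OF approx_resolvent_square_le \<phi>])
  also have "\<dots> \<le> Re (\<phi> (star c * 1 * c))"
    using res by (intro plf_positive_compress_le \<phi>) (simp add: approx_resolvent_def)
  finally show "(gns_norm \<phi> (q * c))\<^sup>2 \<le> (gns_norm \<phi> c)\<^sup>2"
    by (simp add: gns_norm_sq[OF \<phi>] star_simps approx_resolvent_selfadjoint mult.assoc)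
qed (rule gns_norm_nonneg[OF \<phi>])

text \<open>Compressing \<open>b * star b \<le> \<eta> p\<close> by \<open>q\<close> leaves at most
  \<open>\<eta>\<close> times \<open>q * (1 + p) * q\<close>. Here \<open>(1 + p) * q\<close> is
  within \<open>\<delta> \<le> 1\<close> of \<open>1\<close>, which gives the factor
  \<open>2\<close>. This bounds \<open>star b * q\<close>, and the adjoint \<open>q * b\<close> has
  the same bound.\<close>

lemma approx_resolvent_mult:
  assumes \<phi>: "is_plf \<phi>" and "\<delta> \<le> 1" and b: "plf_positive (\<eta> *\<^sub>R p - b * star b)" and \<eta>: "0 \<le> \<eta>"
  shows "gns_norm \<phi> (q * (b * c)) \<le> sqrt (2 * \<eta>) * gns_norm \<phi> c"
proof -
  have A: "gns_norm \<phi> (star b * (q * d)) \<le> sqrt (2 * \<eta>) * gns_norm \<phi> d" for d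
  proof (rule power2_le_imp_le)
    let ?u = "q * d"
    have "Re (\<phi> (star ?u * (1 + p) * ?u)) \<le> gns_norm \<phi> ?u * gns_norm \<phi> ((1 + p) * ?u)"
      using plf_Cauchy_Schwarz[OF \<phi>, of ?u "(1 + p) * ?u"] complex_Re_le_cmod order_trans
      by (fastforce simp: mult.assoc)
    also have "(1 + p) * ?u = d - (1 - (1 + p) * q) * d"
      by (simp add: algebra_simps)
    also have "gns_norm \<phi> ?u * gns_norm \<phi> (d - (1 - (1 + p) * q) * d) \<le> gns_norm \<phi> d * (2 * gns_norm \<phi> d)"
    proof (intro mult_mono approx_resolvent_contraction gns_norm_nonneg \<phi>)
      have "gns_norm \<phi> (d - (1 - (1 + p) * q) * d) \<le> gns_norm \<phi> d + \<delta> * gns_norm \<phi> d"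
        using gns_norm_triangle_diff[OF \<phi>, of d "(1 - (1 + p) * q) * d"] approx_resolvent_error[OF \<phi>, of d]
        by linarith
      also have "\<dots> \<le> gns_norm \<phi> d + 1 * gns_norm \<phi> d"
        using \<open>\<delta> \<le> 1\<close> by (intro add_left_mono mult_right_mono gns_norm_nonneg \<phi>)
      finally show "gns_norm \<phi> (d - (1 - (1 + p) * q) * d) \<le> 2 * gns_norm \<phi> d"
        by simp
    qed
    finally have le: "Re (\<phi> (star ?u * (1 + p) * ?u)) \<le> 2 * (gns_norm \<phi> d)\<^sup>2"
      by (simp add: power2_eq_square)
    have "Re (\<phi> (star ?u * (b * star b) * ?u)) \<le> Re (\<phi> (star ?u * (\<eta> *\<^sub>R p) * ?u))"
      by (rule plf_positive_compress_le[OF b \<phi>])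
    also have "\<dots> = \<eta> * Re (\<phi> (star ?u * p * ?u))"
      by (simp add: plf_scaleR[OF \<phi>])
    also have "\<dots> \<le> \<eta> * Re (\<phi> (star ?u * (1 + p) * ?u))"
      using \<eta> plf_positive_one by (intro mult_left_mono plf_positive_compress_le \<phi>) auto
    also have "\<dots> \<le> \<eta> * (2 * (gns_norm \<phi> d)\<^sup>2)"
      by (rule mult_left_mono[OF le \<eta>])
    also have "\<dots> = (sqrt (2 * \<eta>) * gns_norm \<phi> d)\<^sup>2"
      using \<eta> by (simp add: power_mult_distrib)
    finally show "(gns_norm \<phi> (star b * (q * d)))\<^sup>2 \<le> (sqrt (2 * \<eta>) * gns_norm \<phi> d)\<^sup>2"
      by (simp add: gns_norm_sq[OF \<phi>, of "star b * (q * d)"] star_simps mult.assoc)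
  qed (use \<eta> gns_norm_nonneg[OF \<phi>] in simp)
  \<comment> \<open>Passing to the adjoint: the square of the seminorm of \<open>?v\<close> is an
    inner product of \<open>c\<close> with \<open>star b * (q * ?v)\<close>, to which the bound
    \<open>A\<close> applies.\<close>
  let ?v = "q * (b * c)"
  have "(gns_norm \<phi> ?v)\<^sup>2 = Re (\<phi> (star c * (star b * (q * ?v))))"
    by (simp add: gns_norm_sq[OF \<phi>] star_simps approx_resolvent_selfadjoint mult.assoc)
  also have "\<dots> \<le> gns_norm \<phi> c * gns_norm \<phi> (star b * (q * ?v))"
    using plf_Cauchy_Schwarz[OF \<phi>] complex_Re_le_cmod order_trans by blast
  also have "\<dots> \<le> gns_norm \<phi> c * (sqrt (2 * \<eta>) * gns_norm \<phi> ?v)"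
    by (intro mult_left_mono A gns_norm_nonneg \<phi>)
  finally have "gns_norm \<phi> ?v * gns_norm \<phi> ?v \<le> (sqrt (2 * \<eta>) * gns_norm \<phi> c) * gns_norm \<phi> ?v"
    by (simp add: power2_eq_square algebra_simps)
  moreover have "0 \<le> sqrt (2 * \<eta>) * gns_norm \<phi> c"
    using \<eta> gns_norm_nonneg[OF \<phi>] by simp
  ultimately show ?thesis
    using gns_norm_nonneg[OF \<phi>, of ?v]
    by (cases "gns_norm \<phi> ?v = 0") (auto simp: mult_le_cancel_right)
qed

end

section \<open>Absolute continuity as an \<open>\<epsilon>\<close>-\<open>\<delta>\<close> condition\<close>

definition plf_contraction :: "'a::unital_cstar_algebra \<Rightarrow> bool" where
  "plf_contraction a \<longleftrightarrow> plf_positive (1 - star a * a)"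

lemma plf_contraction_le:
  assumes "plf_contraction a" "is_plf \<phi>"
  shows "gns_norm \<phi> (a * c) \<le> gns_norm \<phi> c"
proof (rule power2_le_imp_le)
  have "Re (\<phi> (star c * (star a * a) * c)) \<le> Re (\<phi> (star c * 1 * c))"
    using assms by (intro plf_positive_compress_le) (simp_all add: plf_contraction_def)
  then show "(gns_norm \<phi> (a * c))\<^sup>2 \<le> (gns_norm \<phi> c)\<^sup>2"
    by (simp add: gns_norm_sq[OF assms(2)] star_simps mult.assoc)
qed (rule gns_norm_nonneg[OF assms(2)])

text \<open>The restriction to contractions is essential: without it, homogeneity would turn the
  condition into domination of \<open>\<rho>\<close> by a multiple of \<open>lam\<close>.\<close>

definition abs_cont :: "('a::unital_cstar_algebra \<Rightarrow> complex) \<Rightarrow> ('a \<Rightarrow> complex) \<Rightarrow> bool" where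
  "abs_cont lam \<rho> \<longleftrightarrow>
    (\<forall>\<epsilon>>0. \<exists>\<delta>>0. \<forall>a. plf_contraction a \<and> gns_norm lam a < \<delta> \<longrightarrow> gns_norm \<rho> a < \<epsilon>)"

text \<open>Split \<open>\<rho>\<close> into \<open>\<rho> - m n\<close> and \<open>m n\<close>. The
  first has small mass and contractions do not increase it; the second is dominated by a multiple of
  \<open>lam\<close>.\<close>

lemma AC_imp_abs_cont:
  assumes lam: "is_plf lam" and "\<rho> \<in> AC lam"
  shows "abs_cont lam \<rho>"
  unfolding abs_cont_def
proof (intro allI impI)
  fix \<epsilon> :: real assume \<epsilon>: "0 < \<epsilon>"
  obtain m t where m: "\<And>n. is_plf (m n)" "\<And>a. (\<lambda>n. m n a) \<longlonglongrightarrow> \<rho> a"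
    "\<And>n. 0 < t n" "\<And>n. m n \<preceq>\<^sub>+ (\<lambda>a. complex_of_real (t n) * lam a)" "\<And>n. m n \<preceq>\<^sub>+ \<rho>"
    using ACE[OF assms(2)] by metis
  have "\<forall>\<^sub>F n in sequentially. Re (\<rho> 1) - \<epsilon>\<^sup>2 / 2 < Re (m n 1)"
    by (rule order_tendstoD[OF tendsto_Re[OF m(2)]]) (use \<epsilon> in simp)
  then obtain n where "Re (\<rho> 1) - \<epsilon>\<^sup>2 / 2 < Re (m n 1)"
    using eventually_happens' sequentially_bot by blast
  then have n: "Re (\<rho> 1) - Re (m n 1) < \<epsilon>\<^sup>2 / 2"
    by simp
  \<comment> \<open>Chosen so that \<open>t n * \<delta>\<^sup>2 = \<epsilon>\<^sup>2 / 2\<close>,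
    the half of the error left for the dominated part.\<close>
  define \<delta> where "\<delta> = \<epsilon> / sqrt (2 * t n)"
  have "gns_norm \<rho> a < \<epsilon>" if a: "plf_contraction a" "gns_norm lam a < \<delta>" for a
  proof (rule power2_less_imp_less)
    have d: "is_plf (\<lambda>a. \<rho> a - m n a)"
      using m(5) by (simp add: plf_le_def)
    have "Re (\<rho> (star a * a) - m n (star a * a)) \<le> Re (\<rho> 1 - m n 1)"
      using power_mono[OF plf_contraction_le[OF a(1) d, of 1] gns_norm_nonneg[OF d], of 2]
      by (simp add: gns_norm_sq[OF d])
    moreover have "Re (m n (star a * a)) \<le> t n * (gns_norm lam a)\<^sup>2"
      using plf_le_Re[OF m(4), of n a] by (simp add: gns_norm_sq[OF lam])
    moreover have "t n * (gns_norm lam a)\<^sup>2 \<le> t n * \<delta>\<^sup>2"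
      using a(2) gns_norm_nonneg[OF lam] m(3)[of n] by (intro mult_left_mono power_mono) auto
    moreover have "t n * \<delta>\<^sup>2 = \<epsilon>\<^sup>2 / 2"
      using m(3)[of n] by (simp add: \<delta>_def power_divide)
    ultimately show "(gns_norm \<rho> a)\<^sup>2 < \<epsilon>\<^sup>2"
      using n by (simp add: gns_norm_sq[OF ACD_plf[OF assms(2)]])
  qed (use \<epsilon> in simp)
  moreover have "0 < \<delta>"
    using \<epsilon> m(3) by (simp add: \<delta>_def)
  ultimately show "\<exists>\<delta>>0. \<forall>a. plf_contraction a \<and> gns_norm lam a < \<delta> \<longrightarrow> gns_norm \<rho> a < \<epsilon>"
    by blast
qed

lemma abs_cont_mono: "\<rho> \<preceq>\<^sub>+ \<mu> \<Longrightarrow> abs_cont lam \<mu> \<Longrightarrow> abs_cont lam \<rho>"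
  unfolding abs_cont_def using plf_le_gns_norm by (meson le_less_trans)

text \<open>If \<open>b\<close> is small in \<open>L\<^sup>2(lam)\<close> then, with \<open>x = 1 - b\<close>, the contraction
  \<open>z = 1 - 2 (1 + x\<^sup>* x)\<^sup>-\<^sup>1\<close> is small there too, because \<open>x\<^sup>* x - 1 = - x\<^sup>* b - b\<^sup>*\<close>;
  and \<open>x\<^sup>* x \<ge> 1 + 2 z\<close>, since \<open>s + 4 / s \<ge> 4\<close> for \<open>s > 0\<close>.\<close>

lemma abs_cont_lower_bound:
  assumes lam: "is_plf lam" and \<rho>: "is_plf \<rho>"
    and K: "0 \<le> K" "\<And>a. gns_norm lam (star a) \<le> K * gns_norm lam a"
    and \<delta>: "\<And>z. plf_contraction z \<Longrightarrow> gns_norm lam z < \<delta> \<Longrightarrow> gns_norm \<rho> z < \<epsilon>"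
    and b: "(sqrt 2 + K) * gns_norm lam b < \<delta>"
  shows "Re (\<rho> 1) - 2 * gns_norm \<rho> 1 * \<epsilon> \<le> (gns_norm \<rho> (1 - b))\<^sup>2"
proof (rule field_le_epsilon)
  fix e :: real assume e: "0 < e"
  define x where "x = 1 - b"
  define p where "p = star x * x"
  have p: "plf_positive p"
    unfolding p_def by (rule plf_positive_square)
  let ?P = "1 + p"
  let ?g = "gns_norm lam 1 + 1" and ?h = "gns_norm \<rho> 1 * gns_norm \<rho> (?P - 4 *\<^sub>R 1) + 1"
  have gh: "0 < ?g" "0 < ?h"
    using gns_norm_nonneg[OF lam, of 1] gns_norm_nonneg[OF \<rho>] by (auto intro: add_nonneg_pos)
  \<comment> \<open>The resolvent error \<open>d\<close> meets three demands:
    \<open>approx_resolvent_mult\<close> wants it at most \<open>1\<close>, the seminorm of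
    \<open>z\<close> has to stay below \<open>\<delta>\<close>, and the term \<open>v\<close> below
    \<open>e\<close>.\<close>
  define d where "d = min 1 (min ((\<delta> - (sqrt 2 + K) * gns_norm lam b) / ?g) (e / ?h))"
  have d: "0 < d" "d \<le> 1" "d * ?g \<le> \<delta> - (sqrt 2 + K) * gns_norm lam b" "d * ?h \<le> e"
    using e gh b by (auto simp: d_def pos_le_divide_eq[symmetric])
  obtain q where q: "approx_resolvent d p q"
    using approx_resolvent_exists[OF p d(1)] by blast
  define err where "err = 1 - ?P * q"
  have pq: "p * q = q * p"
    using q by (simp add: approx_resolvent_def)
  have sa: "star q = q" "star p = p"
    using approx_resolvent_selfadjoint[OF q] by auto
  define z where "z = 1 - 2 *\<^sub>R q"
  have "1 - star z * z = 4 *\<^sub>R (q - q * q)"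
    by (simp add: z_def star_simps sa algebra_simps flip: scaleR_2)
  then have z: "plf_contraction z"
    unfolding plf_contraction_def
    using plf_positive_scaleR[OF approx_resolvent_square_le[OF q], of 4] by simp
  have "gns_norm lam z < \<delta>"
  proof -
    have "p - 1 = - (star x * b) - star b"
      by (simp add: p_def x_def star_simps algebra_simps)
    \<comment> \<open>Obtained by substituting \<open>(1 + p) * q + err\<close> for \<open>1\<close>
      in \<open>z\<close>. The summand \<open>star b\<close> of \<open>1 - p\<close> is the place
      where the bound on the involution enters.\<close>
    moreover have "z = q * (p - 1) + err * 1"
      by (simp add: z_def err_def algebra_simps pq scaleR_2)
    ultimately have "z = q * (- (star x * b) - star b) + err * 1"
      by simp
    then have "z = - (q * (star x * b)) - q * star b + err * 1"
      by (simp add: right_diff_distrib)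
    then have "gns_norm lam z \<le> gns_norm lam (q * (star x * b)) + gns_norm lam (q * star b) + gns_norm lam (err * 1)"
      using gns_norm_triangle[OF lam, of "- (q * (star x * b)) - q * star b" "err * 1"]
        gns_norm_triangle_diff[OF lam, of "- (q * (star x * b))" "q * star b"]
      by (simp add: gns_norm_minus[OF lam])
    also have "\<dots> \<le> sqrt (2 * 1) * gns_norm lam b + K * gns_norm lam b + d * gns_norm lam 1"
    proof (intro add_mono)
      \<comment> \<open>\<open>approx_resolvent_mult\<close> is used with \<open>star x\<close> in
        the role of its \<open>b\<close> and with \<open>\<eta> = 1\<close>, where the required
        domination is an equality.\<close>
      show "gns_norm lam (q * (star x * b)) \<le> sqrt (2 * 1) * gns_norm lam b"
        using d(2) plf_positive_scaleR[OF plf_positive_one, of 0]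
        by (intro approx_resolvent_mult[OF q lam]) (auto simp: p_def star_simps)
      show "gns_norm lam (q * star b) \<le> K * gns_norm lam b"
        using approx_resolvent_contraction[OF q lam, of "star b"] K(2)[of b] by linarith
      show "gns_norm lam (err * 1) \<le> d * gns_norm lam 1"
        unfolding err_def by (rule approx_resolvent_error[OF q lam])
    qed
    also have "\<dots> < \<delta>"
      using d(1,3) by (simp add: algebra_simps)
    finally show ?thesis .
  qed
  then have z\<rho>: "gns_norm \<rho> z < \<epsilon>"
    using \<delta> z by blast
  \<comment> \<open>With \<open>s = 1 + p\<close> and \<open>q\<close> in place of
    \<open>1 / s\<close> this is the identity \<open>s + 4 / s - 4 = (s - 2)\<^sup>2 / s\<close>:
    \<open>w\<close> is its positive right side, \<open>v\<close> the error made by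
    \<open>q\<close>.\<close>
  define w where "w = star (?P - 2 *\<^sub>R 1) * q * (?P - 2 *\<^sub>R 1)"
  define v where "v = err * (?P - 4 *\<^sub>R 1)"
  have "p - 1 - 2 *\<^sub>R z = 4 *\<^sub>R q + ?P - 4 *\<^sub>R 1"
    by (simp add: z_def scaleR_conv_of_real algebra_simps)
  also have "\<dots> = w + v"
  proof -
    have comm: "?P * q = q * ?P"
      using pq by (simp add: algebra_simps)
    have "(?P - 2 *\<^sub>R 1) * q * (?P - 2 *\<^sub>R 1) = ?P * q * ?P - 4 *\<^sub>R (?P * q) + 4 *\<^sub>R q"
      using comm by (simp add: algebra_simps flip: scaleR_2)
    moreover have "err * (?P - 4 *\<^sub>R 1) = ?P - 4 *\<^sub>R 1 - ?P * q * ?P + 4 *\<^sub>R (?P * q)"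
      by (simp add: err_def algebra_simps)
    moreover have "star (?P - 2 *\<^sub>R 1) = ?P - 2 *\<^sub>R 1"
      by (simp add: star_simps sa)
    ultimately show ?thesis
      by (simp add: w_def v_def)
  qed
  finally have "p = 1 + 2 *\<^sub>R z + w + v"
    by (simp add: diff_eq_eq ac_simps)
  then have "Re (\<rho> p) = Re (\<rho> 1) + 2 * Re (\<rho> z) + Re (\<rho> w) + Re (\<rho> v)"
    by (simp add: plf_linear[OF \<rho>])
  moreover have "0 \<le> Re (\<rho> w)"
    unfolding w_def using q by (intro plf_positiveD plf_positive_compress \<rho>) (simp add: approx_resolvent_def)
  moreover have "- (gns_norm \<rho> 1 * \<epsilon>) \<le> Re (\<rho> z)"
    using plf_norm_le[OF \<rho>, of z] abs_Re_le_cmod[of "\<rho> z"]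
      mult_left_mono[OF less_imp_le[OF z\<rho>] gns_norm_nonneg[OF \<rho>, of 1]] by linarith
  moreover have "- e \<le> Re (\<rho> v)"
  proof -
    have "cmod (\<rho> v) \<le> gns_norm \<rho> 1 * gns_norm \<rho> v"
      by (rule plf_norm_le[OF \<rho>])
    also have "\<dots> \<le> gns_norm \<rho> 1 * (d * gns_norm \<rho> (?P - 4 *\<^sub>R 1))"
      unfolding err_def v_def by (intro mult_left_mono approx_resolvent_error[OF q \<rho>] gns_norm_nonneg \<rho>)
    also have "\<dots> \<le> d * ?h"
      using d(1) by (simp add: algebra_simps)
    also have "\<dots> \<le> e"
      by (rule d(4))
    finally show ?thesis
      using abs_Re_le_cmod[of "\<rho> v"] by linarith
  qed
  ultimately show "Re (\<rho> 1) - 2 * gns_norm \<rho> 1 * \<epsilon> \<le> (gns_norm \<rho> (1 - b))\<^sup>2 + e"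
    by (simp add: gns_norm_sq[OF \<rho>] p_def x_def)
qed

text \<open>A nearly optimal splitting \<open>1 = (1 - b) + b\<close> for the parallel sum with
  \<open>l n\<close> has bounded cost, so \<open>b\<close> is small in the seminorm of
  \<open>lam\<close> once \<open>n\<close> is large. By \<open>abs_cont_lower_bound\<close> the
  other part \<open>1 - b\<close> then carries almost the whole mass
  \<open>\<rho> 1\<close>.\<close>

lemma abs_cont_imp_AC:
  assumes lam: "is_plf lam" and \<rho>: "is_plf \<rho>" and null: "plf_null lam \<subseteq> plf_null \<rho>"
    and K: "0 \<le> K" "\<And>a. gns_norm lam (star a) \<le> K * gns_norm lam a"
    and ac: "abs_cont lam \<rho>"
  shows "\<rho> \<in> AC lam"
proof (rule AC_if_parallel_sums_tendsto[OF \<rho> lam null], rule LIMSEQ_I)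
  fix e :: real assume e: "0 < e"
  define l where "l n = (\<lambda>a. complex_of_real (real (Suc n)) * lam a)" for n
  have l: "is_plf (l n)" for n
    unfolding l_def by (rule is_plf_times[OF lam]) simp
  define g where "g = gns_norm \<rho> 1"
  have g: "0 \<le> g"
    unfolding g_def by (rule gns_norm_nonneg[OF \<rho>])
  define \<epsilon> where "\<epsilon> = e / (4 * (g + 1))"
  have \<epsilon>: "0 < \<epsilon>" "2 * g * \<epsilon> \<le> e / 2"
    using e g by (auto simp: \<epsilon>_def field_simps)
  obtain \<delta> where \<delta>: "0 < \<delta>" "\<And>z. plf_contraction z \<Longrightarrow> gns_norm lam z < \<delta> \<Longrightarrow> gns_norm \<rho> z < \<epsilon>"
    using ac \<epsilon>(1) unfolding abs_cont_def by meson
  define C where "C = sqrt 2 + K"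
  have C: "0 < C"
    using K(1) by (simp add: C_def add_pos_nonneg)
  \<comment> \<open>The cost of a nearly optimal splitting is at most \<open>g\<^sup>2 + e\<close>;
    this \<open>N\<close> makes \<open>C\<close> times the resulting seminorm of \<open>b\<close>
    smaller than \<open>\<delta>\<close>.\<close>
  obtain N where N: "C\<^sup>2 * (g\<^sup>2 + e) / \<delta>\<^sup>2 < real N"
    using reals_Archimedean2 by blast
  have "norm (Re (parallel_sum \<rho> (l n) 1) - Re (\<rho> 1)) < e" if n: "n \<ge> N" for n
  proof -
    let ?m = "Re (parallel_sum \<rho> (l n) 1)"
    have m_le: "?m \<le> Re (\<rho> 1)"
      using plf_le_Re[OF parallel_sum_le_left[OF \<rho> l], of n 1] by simp
    obtain b where b: "(gns_norm \<rho> (1 - b))\<^sup>2 + (gns_norm (l n) b)\<^sup>2 < ?m + e / 2"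
      using parallel_sum_approx[OF \<rho> l, of "e / 2" 1 n] e by auto
    have l_norm: "(gns_norm (l n) b)\<^sup>2 = real (Suc n) * (gns_norm lam b)\<^sup>2"
      by (simp add: gns_norm_sq l gns_norm_sq[OF lam]) (simp add: l_def)
    have "(gns_norm (l n) b)\<^sup>2 \<le> g\<^sup>2 + e"
      using b m_le e zero_le_power2[of "gns_norm \<rho> (1 - b)"]
      unfolding g_def gns_norm_one_sq[OF \<rho>] by linarith
    moreover have "real N * (gns_norm lam b)\<^sup>2 \<le> real (Suc n) * (gns_norm lam b)\<^sup>2"
      using n by (intro mult_right_mono) auto
    ultimately have N_b: "real N * (gns_norm lam b)\<^sup>2 \<le> g\<^sup>2 + e"
      unfolding l_norm by linarith
    have "C * gns_norm lam b < \<delta>"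
    proof (rule power2_less_imp_less)
      have N_pos: "0 < real N"
        using N e g zero_le_power2[of g] by (smt (verit) divide_nonneg_nonneg mult_nonneg_nonneg zero_le_power2)
      have "real N * (C * gns_norm lam b)\<^sup>2 \<le> C\<^sup>2 * (g\<^sup>2 + e)"
        using mult_left_mono[OF N_b, of "C\<^sup>2"] by (simp add: power_mult_distrib mult.left_commute)
      also have "\<dots> < real N * \<delta>\<^sup>2"
        using N \<delta>(1) by (simp add: divide_less_eq)
      finally show "(C * gns_norm lam b)\<^sup>2 < \<delta>\<^sup>2"
        using N_pos by simp
    qed (use \<delta> in simp)
    then have "Re (\<rho> 1) - 2 * gns_norm \<rho> 1 * \<epsilon> \<le> (gns_norm \<rho> (1 - b))\<^sup>2"
      unfolding C_def by (intro abs_cont_lower_bound[OF lam \<rho> K \<delta>(2)])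
    then have "Re (\<rho> 1) - ?m < e"
      using b \<epsilon>(2)[unfolded g_def] zero_le_power2[of "gns_norm (l n) b"] by linarith
    then show ?thesis
      using m_le by simp
  qed
  then show "\<exists>N. \<forall>n\<ge>N. norm (Re (parallel_sum \<rho> (\<lambda>a. complex_of_real (real (Suc n)) * lam a) 1) - Re (\<rho> 1)) < e"
    unfolding l_def by blast
qed

section \<open>Sums of singular functionals\<close>

text \<open>The parallel sum lies below both functionals, hence is zero, and its infimum at
  \<open>1\<close> supplies \<open>b\<close>.\<close>

lemma SG_separation:
  assumes lam: "is_plf lam" and \<mu>: "\<mu> \<in> SG lam" and e: "0 < e"
  obtains b where "gns_norm \<mu> (1 - b) < e" "gns_norm lam b < e"
proof -
  have plf: "is_plf \<mu>"
    by (rule SGD_plf[OF \<mu>])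
  have "parallel_sum \<mu> lam = (\<lambda>_. 0)"
    using \<mu> is_plf_parallel_sum[OF plf lam] parallel_sum_le_left[OF plf lam] parallel_sum_le_right[OF plf lam]
    by (simp add: SG_def)
  then obtain b where b: "(gns_norm \<mu> (1 - b))\<^sup>2 + (gns_norm lam b)\<^sup>2 < e\<^sup>2"
    using parallel_sum_approx[OF plf lam, of "e\<^sup>2" 1] e by auto
  show thesis
  proof (rule that)
    show "gns_norm \<mu> (1 - b) < e"
      by (rule power2_less_imp_less) (use b e zero_le_power2[of "gns_norm lam b"] in linarith)+
    show "gns_norm lam b < e"
      by (rule power2_less_imp_less) (use b e zero_le_power2[of "gns_norm \<mu> (1 - b)"] in linarith)+
  qed
qed

text \<open>Here \<open>q\<close> approximates \<open>\<eta>\<close> times the inverse of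
  \<open>\<eta> + b * star b + c * star c\<close>. It is small for \<open>\<mu>\<close> and for
  \<open>\<nu>\<close>, while \<open>1 - q\<close> is small for \<open>lam\<close>. A functional
  \<open>\<rho>\<close> below both \<open>\<mu> + \<nu>\<close> and \<open>lam\<close> therefore
  sees \<open>1\<close> as the sum of two small elements.\<close>

lemma SG_plus:
  assumes lam: "is_plf lam" and K: "0 < K" "\<And>a. gns_norm lam (star a) \<le> K * gns_norm lam a"
    and \<mu>: "\<mu> \<in> SG lam" and \<nu>: "\<nu> \<in> SG lam"
  shows "(\<lambda>a. \<mu> a + \<nu> a) \<in> SG lam"
proof -
  note plf = SGD_plf[OF \<mu>] SGD_plf[OF \<nu>]
  have "\<rho> = (\<lambda>_. 0)" if \<rho>: "is_plf \<rho>" "\<rho> \<preceq>\<^sub>+ (\<lambda>a. \<mu> a + \<nu> a)" "\<rho> \<preceq>\<^sub>+ lam" for \<rho>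
  proof -
    have "gns_norm \<rho> 1 \<le> 6 * \<theta>" if \<theta>: "0 < \<theta>" for \<theta>
    proof -
      define M where "M = gns_norm \<mu> 1 + gns_norm \<nu> 1 + gns_norm lam 1 + 1"
      have M: "0 < M" "gns_norm \<mu> 1 \<le> M" "gns_norm \<nu> 1 \<le> M" "gns_norm lam 1 \<le> M"
        using gns_norm_nonneg[OF plf(1), of 1] gns_norm_nonneg[OF plf(2), of 1] gns_norm_nonneg[OF lam, of 1]
        by (auto simp: M_def)
      \<comment> \<open>\<open>k\<close> is the target for the bound
        \<open>sqrt (2 * \<eta>)\<close> of \<open>approx_resolvent_mult\<close>, which dictates
        \<open>\<eta>\<close>.\<close>
      define k where "k = \<theta> / M"
      define \<eta> where "\<eta> = k\<^sup>2 / 2"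
      have k: "0 < k" "sqrt (2 * \<eta>) = k" "k * M = \<theta>" "0 < \<eta>"
        using \<theta> M by (auto simp: k_def \<eta>_def)
      \<comment> \<open>The separation accuracy is fixed after \<open>\<eta>\<close>, because the
        estimate of \<open>1 - q\<close> divides by \<open>\<eta>\<close>.\<close>
      define \<epsilon> where "\<epsilon> = min \<theta> (\<theta> * \<eta> / (2 * k * K))"
      have \<epsilon>: "0 < \<epsilon>" "\<epsilon> \<le> \<theta>" "(1 / \<eta>) * (k * (K * \<epsilon>) + k * (K * \<epsilon>)) \<le> \<theta>"
      proof -
        show "0 < \<epsilon>" "\<epsilon> \<le> \<theta>"
          using \<theta> k K(1) by (auto simp: \<epsilon>_def)
        have "\<epsilon> \<le> \<theta> * \<eta> / (2 * k * K)"
          by (simp add: \<epsilon>_def)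
        then show "(1 / \<eta>) * (k * (K * \<epsilon>) + k * (K * \<epsilon>)) \<le> \<theta>"
          using k K(1) by (simp add: field_simps)
      qed
      obtain b where b: "gns_norm \<mu> (1 - b) < \<epsilon>" "gns_norm lam b < \<epsilon>"
        using SG_separation[OF lam \<mu> \<epsilon>(1)] by blast
      obtain c where c: "gns_norm \<nu> (1 - c) < \<epsilon>" "gns_norm lam c < \<epsilon>"
        using SG_separation[OF lam \<nu> \<epsilon>(1)] by blast
      define p where "p = (1 / \<eta>) *\<^sub>R (b * star b + c * star c)"
      have pos: "plf_positive (b * star b)" "plf_positive (c * star c)"
        using plf_positive_square[of "star b"] plf_positive_square[of "star c"] by (auto simp: star_star)
      then have p: "plf_positive p"
        unfolding p_def using k by (intro plf_positive_scaleR plf_positive_add) auto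
      have dom: "plf_positive (\<eta> *\<^sub>R p - b * star b)" "plf_positive (\<eta> *\<^sub>R p - c * star c)"
        using pos k by (auto simp: p_def)
      define d where "d = min 1 k"
      have d: "0 < d" "d \<le> 1" "d \<le> k"
        using k by (auto simp: d_def)
      obtain q where q: "approx_resolvent d p q"
        using approx_resolvent_exists[OF p d(1)] by blast
      note mult = approx_resolvent_mult[OF q _ d(2) _ less_imp_le[OF k(4)], unfolded k(2)]
      have small: "gns_norm \<phi> q \<le> 2 * \<theta>"
        if \<phi>: "is_plf \<phi>" and x: "gns_norm \<phi> (1 - x) < \<epsilon>" "plf_positive (\<eta> *\<^sub>R p - x * star x)" "gns_norm \<phi> 1 \<le> M"
        for \<phi> x
      proof -
        \<comment> \<open>On \<open>1 - x\<close> it suffices that \<open>q\<close> is a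
          contraction; on \<open>x\<close> the domination of \<open>x * star x\<close> by
          \<open>\<eta> *\<^sub>R p\<close> takes over.\<close>
        have "gns_norm \<phi> q \<le> gns_norm \<phi> (q * (1 - x)) + gns_norm \<phi> (q * (x * 1))"
          using gns_norm_triangle[OF \<phi>, of "q * (1 - x)" "q * (x * 1)"] by (simp add: algebra_simps)
        also have "\<dots> \<le> gns_norm \<phi> (1 - x) + k * gns_norm \<phi> 1"
          by (intro add_mono approx_resolvent_contraction[OF q] mult \<phi> x)
        also have "\<dots> \<le> \<theta> + k * M"
          using x \<epsilon>(2) k(1) by (intro add_mono mult_left_mono) auto
        finally show ?thesis
          using k(3) by simp
      qed
      have "gns_norm lam (1 - q) \<le> 2 * \<theta>"
      proof -
        have pq: "p * q = q * p"
          using q by (simp add: approx_resolvent_def)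
        \<comment> \<open>Up to the resolvent error, \<open>1 - q\<close> is \<open>q * p\<close>.
          In each term \<open>q * b\<close> is small as an operator, and its right factor
          \<open>star b\<close> is small by the bounded involution.\<close>
        have "1 - q = (1 / \<eta>) *\<^sub>R (q * (b * star b) + q * (c * star c)) + (1 - (1 + p) * q) * 1"
          by (simp add: algebra_simps pq) (simp add: p_def algebra_simps)
        then have "gns_norm lam (1 - q)
          \<le> gns_norm lam ((1 / \<eta>) *\<^sub>R (q * (b * star b) + q * (c * star c))) + gns_norm lam ((1 - (1 + p) * q) * 1)"
          using gns_norm_triangle[OF lam] by metis
        also have "\<dots> \<le> (1 / \<eta>) * (gns_norm lam (q * (b * star b)) + gns_norm lam (q * (c * star c))) + d * gns_norm lam 1"
          using k(4) by (intro add_mono approx_resolvent_error[OF q lam])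
            (simp add: gns_norm_scaleR[OF lam] divide_right_mono gns_norm_triangle[OF lam])
        also have "\<dots> \<le> (1 / \<eta>) * (k * gns_norm lam (star b) + k * gns_norm lam (star c)) + k * M"
          using k d M(4) dom gns_norm_nonneg[OF lam, of 1]
          by (intro add_mono mult_left_mono mult_mono mult lam) auto
        also have "\<dots> \<le> (1 / \<eta>) * (k * (K * \<epsilon>) + k * (K * \<epsilon>)) + k * M"
        proof (intro add_mono mult_left_mono order_refl)
          show "gns_norm lam (star b) \<le> K * \<epsilon>"
            using order_trans[OF K(2)[of b] mult_left_mono[OF less_imp_le[OF b(2)] less_imp_le[OF K(1)]]] .
          show "gns_norm lam (star c) \<le> K * \<epsilon>"
            using order_trans[OF K(2)[of c] mult_left_mono[OF less_imp_le[OF c(2)] less_imp_le[OF K(1)]]] .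
        qed (use k in auto)
        finally show ?thesis
          using \<epsilon>(3) k(3) by simp
      qed
      then have "gns_norm \<rho> (1 - q) \<le> 2 * \<theta>"
        using plf_le_gns_norm[OF \<rho>(3), of "1 - q"] by linarith
      moreover have "gns_norm \<rho> q \<le> 4 * \<theta>"
      proof (rule power2_le_imp_le)
        have "(gns_norm \<rho> q)\<^sup>2 \<le> (gns_norm \<mu> q)\<^sup>2 + (gns_norm \<nu> q)\<^sup>2"
          using plf_le_Re[OF \<rho>(2), of q] by (simp add: gns_norm_sq \<rho> plf)
        also have "\<dots> \<le> (2 * \<theta>)\<^sup>2 + (2 * \<theta>)\<^sup>2"
          using small[OF plf(1) b(1) dom(1) M(2)] small[OF plf(2) c(1) dom(2) M(3)]
          by (intro add_mono power_mono gns_norm_nonneg plf)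
        finally show "(gns_norm \<rho> q)\<^sup>2 \<le> (4 * \<theta>)\<^sup>2"
          by (simp add: power_mult_distrib) (smt (verit) zero_le_power2)
      qed (use \<theta> in simp)
      ultimately show ?thesis
        using gns_norm_triangle[OF \<rho>(1), of q "1 - q"] by simp
    qed
    \<comment> \<open>Any denominator above \<open>6\<close> yields a contradiction unless the
      seminorm vanishes.\<close>
    from this[of "gns_norm \<rho> 1 / 7"] have "gns_norm \<rho> 1 = 0"
      using gns_norm_nonneg[OF \<rho>(1), of 1] by (cases "gns_norm \<rho> 1 = 0") auto
    then show ?thesis
      using gns_norm_one_sq[OF \<rho>(1)] by (intro plf_eq_zero \<rho>) simp
  qed
  moreover have "plf_null lam \<subseteq> plf_null (\<lambda>a. \<mu> a + \<nu> a)"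
    using plf_null_plus[OF plf] SGD_null[OF \<mu>] SGD_null[OF \<nu>] by blast
  ultimately show ?thesis
    using is_plf_plus[OF plf] by (simp add: SG_def)
qed

section \<open>Operators on a Hilbert space with explicit carrier\<close>

text \<open>Equality of vectors is tested by inner products, so \<open>inner_sep\<close> takes the
  place of the vector space laws. Completeness appears as the Riesz property, the form in which the
  existence of adjoints consumes it.\<close>

locale hilbert_carrier =
  fixes H :: "'h hilb"
  assumes plus_closed: "h \<in> hcarrier H \<Longrightarrow> k \<in> hcarrier H \<Longrightarrow> hplus H h k \<in> hcarrier H"
    and scale_closed: "h \<in> hcarrier H \<Longrightarrow> hscale H c h \<in> hcarrier H"
    and inner_plus: "h \<in> hcarrier H \<Longrightarrow> k \<in> hcarrier H \<Longrightarrow> l \<in> hcarrier H \<Longrightarrow>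
      hinner H (hplus H h k) l = hinner H h l + hinner H k l"
    and inner_scale: "h \<in> hcarrier H \<Longrightarrow> l \<in> hcarrier H \<Longrightarrow>
      hinner H (hscale H c h) l = c * hinner H h l"
    and inner_cnj: "h \<in> hcarrier H \<Longrightarrow> k \<in> hcarrier H \<Longrightarrow> hinner H k h = cnj (hinner H h k)"
    and inner_pos: "h \<in> hcarrier H \<Longrightarrow> 0 \<le> Re (hinner H h h)"
    and inner_CS: "h \<in> hcarrier H \<Longrightarrow> k \<in> hcarrier H \<Longrightarrow>
      cmod (hinner H h k) \<le> hnorm H h * hnorm H k"
    and inner_sep: "h \<in> hcarrier H \<Longrightarrow> k \<in> hcarrier H \<Longrightarrow>
      (\<And>l. l \<in> hcarrier H \<Longrightarrow> hinner H h l = hinner H k l) \<Longrightarrow> h = k"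
    and riesz: "(\<And>h k. h \<in> hcarrier H \<Longrightarrow> k \<in> hcarrier H \<Longrightarrow> f (hplus H h k) = f h + f k) \<Longrightarrow>
      (\<And>c h. h \<in> hcarrier H \<Longrightarrow> f (hscale H c h) = c * f h) \<Longrightarrow>
      (\<And>h. h \<in> hcarrier H \<Longrightarrow> cmod (f h) \<le> K * hnorm H h) \<Longrightarrow>
      \<exists>y\<in>hcarrier H. \<forall>h\<in>hcarrier H. f h = hinner H h y"
begin

lemma hnorm_sq: "h \<in> hcarrier H \<Longrightarrow> (hnorm H h)\<^sup>2 = Re (hinner H h h)"
  using inner_pos[of h] by (simp add: hnorm_def)

lemma hnorm_nonneg: "h \<in> hcarrier H \<Longrightarrow> 0 \<le> hnorm H h"
  using inner_pos[of h] by (simp add: hnorm_def)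

lemma inner_self: "h \<in> hcarrier H \<Longrightarrow> hinner H h h = of_real ((hnorm H h)\<^sup>2)"
  using inner_cnj[of h h] by (simp add: hnorm_sq complex_eq_iff)

lemma inner_plus_right:
  "h \<in> hcarrier H \<Longrightarrow> k \<in> hcarrier H \<Longrightarrow> l \<in> hcarrier H \<Longrightarrow>
    hinner H l (hplus H h k) = hinner H l h + hinner H l k"
  using inner_cnj[of "hplus H h k" l] inner_cnj[of h l] inner_cnj[of k l]
  by (simp add: plus_closed inner_plus)

lemma inner_scale_right:
  "h \<in> hcarrier H \<Longrightarrow> l \<in> hcarrier H \<Longrightarrow> hinner H l (hscale H c h) = cnj c * hinner H l h"
  using inner_cnj[of "hscale H c h" l] inner_cnj[of h l] by (simp add: scale_closed inner_scale)

lemma inner_sep_right: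
  assumes "h \<in> hcarrier H" "k \<in> hcarrier H"
    and "\<And>l. l \<in> hcarrier H \<Longrightarrow> hinner H l h = hinner H l k"
  shows "h = k"
  using assms(3) inner_cnj[OF _ assms(1)] inner_cnj[OF _ assms(2)]
  by (intro inner_sep assms) (metis assms inner_cnj)

lemma bounded_opsD:
  assumes "T \<in> bounded_ops H"
  shows "h \<in> hcarrier H \<Longrightarrow> T h \<in> hcarrier H" "T \<in> extensional (hcarrier H)"
    "h \<in> hcarrier H \<Longrightarrow> k \<in> hcarrier H \<Longrightarrow> T (hplus H h k) = hplus H (T h) (T k)"
    "h \<in> hcarrier H \<Longrightarrow> T (hscale H c h) = hscale H c (T h)"
  using assms by (auto simp: bounded_ops_def PiE_def)

lemma bounded_ops_bound:
  assumes "T \<in> bounded_ops H"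
  obtains K where "0 \<le> K" "\<And>h. h \<in> hcarrier H \<Longrightarrow> hnorm H (T h) \<le> K * hnorm H h"
proof -
  obtain K where K: "\<And>h. h \<in> hcarrier H \<Longrightarrow> hnorm H (T h) \<le> K * hnorm H h"
    using assms unfolding bounded_ops_def by blast
  have "hnorm H (T h) \<le> \<bar>K\<bar> * hnorm H h" if "h \<in> hcarrier H" for h
    using K[OF that] mult_right_mono[OF abs_ge_self[of K] hnorm_nonneg[OF that]] by linarith
  then show thesis
    by (intro that[of "\<bar>K\<bar>"]) auto
qed

lemma is_adjoint_sym:
  assumes "is_adjoint H S T" "\<And>h. h \<in> hcarrier H \<Longrightarrow> S h \<in> hcarrier H"
    "\<And>h. h \<in> hcarrier H \<Longrightarrow> T h \<in> hcarrier H"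
  shows "is_adjoint H T S"
  using assms unfolding is_adjoint_def by (metis inner_cnj)

lemma adjoint_exists:
  assumes T: "T \<in> bounded_ops H"
  shows "\<exists>T'\<in>bounded_ops H. is_adjoint H T T'"
proof -
  obtain K where K: "0 \<le> K" "\<And>h. h \<in> hcarrier H \<Longrightarrow> hnorm H (T h) \<le> K * hnorm H h"
    using bounded_ops_bound[OF T] by blast
  note T_simps = bounded_opsD[OF T]
  have "\<exists>y\<in>hcarrier H. \<forall>h\<in>hcarrier H. hinner H (T h) k = hinner H h y" if k: "k \<in> hcarrier H" for k
  proof (rule riesz)
    fix h assume h: "h \<in> hcarrier H"
    have "cmod (hinner H (T h) k) \<le> hnorm H (T h) * hnorm H k"
      by (intro inner_CS T_simps h k)
    also have "\<dots> \<le> (K * hnorm H h) * hnorm H k"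
      by (intro mult_right_mono K(2) h hnorm_nonneg k)
    finally show "cmod (hinner H (T h) k) \<le> (K * hnorm H k) * hnorm H h"
      by (simp add: algebra_simps)
  qed (simp_all add: T_simps inner_plus inner_scale k)
  then obtain Y where Y: "\<And>k. k \<in> hcarrier H \<Longrightarrow> Y k \<in> hcarrier H"
    "\<And>h k. h \<in> hcarrier H \<Longrightarrow> k \<in> hcarrier H \<Longrightarrow> hinner H (T h) k = hinner H h (Y k)"
    by metis
  define T' where "T' = restrict Y (hcarrier H)"
  have T'_app: "T' k = Y k" if "k \<in> hcarrier H" for k
    using that by (simp add: T'_def)
  have "hnorm H (Y k) \<le> K * hnorm H k" if k: "k \<in> hcarrier H" for k
  proof -
    have "(hnorm H (Y k))\<^sup>2 = Re (hinner H (T (Y k)) k)"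
      unfolding hnorm_sq[OF Y(1)[OF k]] Y(2)[OF Y(1)[OF k] k] ..
    also have "\<dots> \<le> hnorm H (T (Y k)) * hnorm H k"
      by (rule order_trans[OF complex_Re_le_cmod inner_CS[OF T_simps(1)[OF Y(1)[OF k]] k]])
    also have "\<dots> \<le> (K * hnorm H (Y k)) * hnorm H k"
      by (intro mult_right_mono K(2) Y hnorm_nonneg k)
    finally have "hnorm H (Y k) * hnorm H (Y k) \<le> (K * hnorm H k) * hnorm H (Y k)"
      by (simp add: power2_eq_square algebra_simps)
    moreover have "0 \<le> K * hnorm H k"
      using K(1) hnorm_nonneg[OF k] by simp
    ultimately show ?thesis
      using hnorm_nonneg[OF Y(1)[OF k]] by (cases "hnorm H (Y k) = 0") (auto simp: mult_le_cancel_right)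
  qed
  moreover have "Y (hplus H h k) = hplus H (Y h) (Y k)" if "h \<in> hcarrier H" "k \<in> hcarrier H" for h k
    using that Y(1) by (intro inner_sep_right) (auto simp: plus_closed inner_plus_right T_simps simp flip: Y(2))
  moreover have "Y (hscale H c h) = hscale H c (Y h)" if "h \<in> hcarrier H" for c h
    using that Y(1) by (intro inner_sep_right) (auto simp: scale_closed inner_scale_right T_simps simp flip: Y(2))
  ultimately have "T' \<in> bounded_ops H"
    using Y(1) by (auto simp: bounded_ops_def T'_def plus_closed scale_closed)
  moreover have "is_adjoint H T T'"
    using Y(2) by (simp add: is_adjoint_def T'_app)
  ultimately show ?thesis
    by blast
qed

section \<open>Commutants as adjoint-closed algebras of operators\<close>

definition adjoint_closed :: "('h \<Rightarrow> 'h) set \<Rightarrow> bool" where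
  "adjoint_closed B \<longleftrightarrow> (\<forall>S\<in>B. \<exists>S'\<in>B. is_adjoint H S S')"

lemma commutant_subset: "commutant H B \<subseteq> bounded_ops H"
  by (auto simp: commutant_def)

lemma commutantI:
  assumes "T \<in> bounded_ops H" "B \<subseteq> bounded_ops H"
    "\<And>S h. S \<in> B \<Longrightarrow> h \<in> hcarrier H \<Longrightarrow> T (S h) = S (T h)"
  shows "T \<in> commutant H B"
  using assms unfolding commutant_def by (auto simp: compose_def intro!: ext)

lemma commutantD:
  assumes "T \<in> commutant H B" "S \<in> B" "h \<in> hcarrier H"
  shows "T (S h) = S (T h)"
  using assms unfolding commutant_def by (auto simp: compose_def) (metis restrict_apply')

lemma adjoint_closed_commutant:
  assumes B: "B \<subseteq> bounded_ops H" "adjoint_closed B"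
  shows "adjoint_closed (commutant H B)"
  unfolding adjoint_closed_def
proof
  fix T assume T: "T \<in> commutant H B"
  then have Tb: "T \<in> bounded_ops H"
    using commutant_subset by blast
  obtain T' where T': "T' \<in> bounded_ops H" "is_adjoint H T T'"
    using adjoint_exists[OF Tb] by blast
  have T'T: "is_adjoint H T' T"
    by (rule is_adjoint_sym[OF T'(2) bounded_opsD(1)[OF Tb] bounded_opsD(1)[OF T'(1)]])
  have "T' (S h) = S (T' h)" if S: "S \<in> B" and h: "h \<in> hcarrier H" for S h
  proof (rule inner_sep)
    obtain S' where S': "S' \<in> B" "is_adjoint H S S'"
      using B(2) S by (auto simp: adjoint_closed_def)
    have Sb: "S \<in> bounded_ops H" "S' \<in> bounded_ops H"
      using S S' B by auto
    note closed = bounded_opsD(1)[OF Tb] bounded_opsD(1)[OF T'(1)] bounded_opsD(1)[OF Sb(1)] bounded_opsD(1)[OF Sb(2)]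
    show "T' (S h) \<in> hcarrier H" "S (T' h) \<in> hcarrier H"
      using h closed by auto
    fix k assume k: "k \<in> hcarrier H"
    have "hinner H (T' (S h)) k = hinner H h (S' (T k))"
      using T'T S'(2) h k closed by (simp add: is_adjoint_def)
    also have "\<dots> = hinner H h (T (S' k))"
      using commutantD[OF T S'(1) k] by simp
    also have "\<dots> = hinner H (S (T' h)) k"
      using T'T S'(2) h k closed by (simp add: is_adjoint_def)
    finally show "hinner H (T' (S h)) k = hinner H (S (T' h)) k" .
  qed
  then have "T' \<in> commutant H B"
    by (intro commutantI T' B)
  then show "\<exists>S'\<in>commutant H B. is_adjoint H T S'"
    using T'(2) by blast
qed

definition id_op :: "'h \<Rightarrow> 'h" where "id_op = (\<lambda>h\<in>hcarrier H. h)"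

lemma hplus_bounded: "h \<in> hcarrier H \<Longrightarrow> k \<in> hcarrier H \<Longrightarrow> hnorm H (hplus H h k) \<le> hnorm H h + hnorm H k"
proof (rule power2_le_imp_le)
  assume hk: "h \<in> hcarrier H" "k \<in> hcarrier H"
  have "Re (hinner H h k) \<le> hnorm H h * hnorm H k"
    using inner_CS[OF hk] complex_Re_le_cmod order_trans by blast
  then show "(hnorm H (hplus H h k))\<^sup>2 \<le> (hnorm H h + hnorm H k)\<^sup>2"
    using hk inner_cnj[of h k] by (simp add: hnorm_sq power2_sum plus_closed inner_plus inner_plus_right)
qed (use hnorm_nonneg in simp)

lemma hnorm_scale: "h \<in> hcarrier H \<Longrightarrow> hnorm H (hscale H c h) = cmod c * hnorm H h"
proof -
  assume h: "h \<in> hcarrier H"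
  have "hinner H (hscale H c h) (hscale H c h) = of_real ((cmod c)\<^sup>2) * hinner H h h"
    using h unfolding complex_norm_square by (simp add: scale_closed inner_scale inner_scale_right)
  then show ?thesis
    by (simp add: hnorm_def real_sqrt_mult)
qed

lemma hplus_exchange:
  "h \<in> hcarrier H \<Longrightarrow> k \<in> hcarrier H \<Longrightarrow> h' \<in> hcarrier H \<Longrightarrow> k' \<in> hcarrier H \<Longrightarrow>
    hplus H (hplus H h k) (hplus H h' k') = hplus H (hplus H h h') (hplus H k k')"
  by (intro inner_sep) (simp_all add: plus_closed inner_plus)

lemma hscale_hplus:
  "h \<in> hcarrier H \<Longrightarrow> k \<in> hcarrier H \<Longrightarrow> hscale H c (hplus H h k) = hplus H (hscale H c h) (hscale H c k)"
  by (intro inner_sep) (simp_all add: plus_closed scale_closed inner_plus inner_scale algebra_simps)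

lemma hscale_commute: "h \<in> hcarrier H \<Longrightarrow> hscale H c (hscale H d h) = hscale H d (hscale H c h)"
  by (intro inner_sep) (simp_all add: scale_closed inner_scale)

lemma bounded_opsI:
  assumes "\<And>h. h \<in> hcarrier H \<Longrightarrow> T h \<in> hcarrier H" "T \<in> extensional (hcarrier H)"
    "\<And>h k. h \<in> hcarrier H \<Longrightarrow> k \<in> hcarrier H \<Longrightarrow> T (hplus H h k) = hplus H (T h) (T k)"
    "\<And>c h. h \<in> hcarrier H \<Longrightarrow> T (hscale H c h) = hscale H c (T h)"
    "\<And>h. h \<in> hcarrier H \<Longrightarrow> hnorm H (T h) \<le> K * hnorm H h"
  shows "T \<in> bounded_ops H"
  using assms unfolding bounded_ops_def PiE_def by blast

lemma id_op_bounded: "id_op \<in> bounded_ops H"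
  by (rule bounded_opsI[of _ 1]) (auto simp: id_op_def plus_closed scale_closed)

lemma op_plus_bounded:
  assumes "S \<in> bounded_ops H" "T \<in> bounded_ops H"
  shows "op_plus H S T \<in> bounded_ops H"
proof -
  note S = bounded_opsD[OF assms(1)] and T = bounded_opsD[OF assms(2)]
  obtain K L where K: "\<And>h. h \<in> hcarrier H \<Longrightarrow> hnorm H (S h) \<le> K * hnorm H h"
    and L: "\<And>h. h \<in> hcarrier H \<Longrightarrow> hnorm H (T h) \<le> L * hnorm H h"
    using bounded_ops_bound assms by metis
  show ?thesis
  proof (rule bounded_opsI[of _ "K + L"])
    fix h assume h: "h \<in> hcarrier H"
    show "hnorm H (op_plus H S T h) \<le> (K + L) * hnorm H h"
      using hplus_bounded[of "S h" "T h"] K[OF h] L[OF h] h S T by (simp add: op_plus_def distrib_right)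
  qed (auto simp: op_plus_def S T plus_closed scale_closed hplus_exchange hscale_hplus)
qed

lemma op_scale_bounded:
  assumes "T \<in> bounded_ops H"
  shows "op_scale H c T \<in> bounded_ops H"
proof -
  note T = bounded_opsD[OF assms]
  obtain K where K: "\<And>h. h \<in> hcarrier H \<Longrightarrow> hnorm H (T h) \<le> K * hnorm H h"
    using bounded_ops_bound assms by metis
  show ?thesis
  proof (rule bounded_opsI[of _ "cmod c * K"])
    fix h assume h: "h \<in> hcarrier H"
    show "hnorm H (op_scale H c T h) \<le> cmod c * K * hnorm H h"
      using mult_left_mono[OF K[OF h] norm_ge_zero[of c]] h T by (simp add: op_scale_def hnorm_scale mult.assoc)
  qed (auto simp: op_scale_def T plus_closed scale_closed hscale_hplus hscale_commute)
qed

lemma compose_bounded: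
  assumes "S \<in> bounded_ops H" "T \<in> bounded_ops H"
  shows "compose (hcarrier H) S T \<in> bounded_ops H"
proof -
  note S = bounded_opsD[OF assms(1)] and T = bounded_opsD[OF assms(2)]
  obtain K L where K: "0 \<le> K" "\<And>h. h \<in> hcarrier H \<Longrightarrow> hnorm H (S h) \<le> K * hnorm H h"
    and L: "\<And>h. h \<in> hcarrier H \<Longrightarrow> hnorm H (T h) \<le> L * hnorm H h"
    using bounded_ops_bound assms by metis
  show ?thesis
  proof (rule bounded_opsI[of _ "K * L"])
    fix h assume h: "h \<in> hcarrier H"
    show "hnorm H (compose (hcarrier H) S T h) \<le> K * L * hnorm H h"
      using K(2)[OF T(1)[OF h]] mult_left_mono[OF L[OF h] K(1)] h by (simp add: compose_def mult.assoc)
  qed (auto simp: compose_def S T plus_closed scale_closed)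
qed

context
  fixes B assumes B: "B \<subseteq> bounded_ops H"
begin

lemma id_op_commutant: "id_op \<in> commutant H B"
  by (rule commutantI[OF id_op_bounded B]) (use B bounded_opsD in \<open>auto simp: id_op_def\<close>)

lemma op_plus_commutant:
  assumes "S \<in> commutant H B" "T \<in> commutant H B"
  shows "op_plus H S T \<in> commutant H B"
proof (rule commutantI[OF op_plus_bounded B])
  fix R h assume R: "R \<in> B" and h: "h \<in> hcarrier H"
  have b: "R \<in> bounded_ops H" "S \<in> bounded_ops H" "T \<in> bounded_ops H"
    using R B assms commutant_subset by blast+
  show "op_plus H S T (R h) = R (op_plus H S T h)"
    using commutantD[OF assms(1) R h] commutantD[OF assms(2) R h] h
      bounded_opsD[OF b(1)] bounded_opsD(1)[OF b(2)] bounded_opsD(1)[OF b(3)]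
    by (simp add: op_plus_def)
qed (use assms commutant_subset in blast)+

lemma op_scale_commutant:
  assumes "T \<in> commutant H B"
  shows "op_scale H c T \<in> commutant H B"
proof (rule commutantI[OF op_scale_bounded B])
  fix R h assume R: "R \<in> B" and h: "h \<in> hcarrier H"
  have b: "R \<in> bounded_ops H" "T \<in> bounded_ops H"
    using R B assms commutant_subset by blast+
  show "op_scale H c T (R h) = R (op_scale H c T h)"
    using commutantD[OF assms R h] h bounded_opsD[OF b(1)] bounded_opsD(1)[OF b(2)]
    by (simp add: op_scale_def)
qed (use assms commutant_subset in blast)+

lemma compose_commutant:
  assumes "S \<in> commutant H B" "T \<in> commutant H B"
  shows "compose (hcarrier H) S T \<in> commutant H B"
proof (rule commutantI[OF compose_bounded B])
  fix R h assume R: "R \<in> B" and h: "h \<in> hcarrier H"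
  have b: "R \<in> bounded_ops H" "S \<in> bounded_ops H" "T \<in> bounded_ops H"
    using R B assms commutant_subset by blast+
  show "compose (hcarrier H) S T (R h) = R (compose (hcarrier H) S T h)"
    using commutantD[OF assms(1) R, of "T h"] commutantD[OF assms(2) R h] h
      bounded_opsD(1)[OF b(1)] bounded_opsD(1)[OF b(3)]
    by (simp add: compose_def)
qed (use assms commutant_subset in blast)+

text \<open>Positivity at \<open>T + c\<close> for every scalar \<open>c\<close>: the term quadratic
  in \<open>c\<close> carries the factor \<open>\<omega> id_op = 0\<close>, and a nonnegative
  real-affine function of \<open>c\<close> is constant. Thus a nonzero positive functional is
  already detected at the identity.\<close>

lemma op_plf_commutant_eq_zero:
  assumes adj: "adjoint_closed B" and \<omega>: "op_plf H (commutant H B) \<omega>" and one: "\<omega> id_op = 0"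
    and T: "T \<in> commutant H B"
  shows "\<omega> T = 0"
proof -
  let ?M = "commutant H B"
  obtain T' where T': "T' \<in> ?M" "is_adjoint H T T'"
    using adjoint_closed_commutant[OF B adj] T by (auto simp: adjoint_closed_def)
  have Tb: "T \<in> bounded_ops H" "T' \<in> bounded_ops H"
    using T T' commutant_subset by blast+
  have T'T: "is_adjoint H T' T"
    by (rule is_adjoint_sym[OF T'(2) bounded_opsD(1)[OF Tb(1)] bounded_opsD(1)[OF Tb(2)]])
  have plus: "\<omega> (op_plus H S R) = \<omega> S + \<omega> R" if "S \<in> ?M" "R \<in> ?M" for S R
    using \<omega> that by (simp add: op_plf_def)
  have scale: "\<omega> (op_scale H c R) = c * \<omega> R" if "R \<in> ?M" for c R
    using \<omega> that by (simp add: op_plf_def)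
  define X where "X = \<omega> (compose (hcarrier H) T' T)"
  have pos: "X + c * \<omega> T' + cnj c * \<omega> T \<in> \<real>\<^sub>\<ge>\<^sub>0" for c
  proof -
    define U where "U = op_plus H T (op_scale H c id_op)"
    define U' where "U' = op_plus H T' (op_scale H (cnj c) id_op)"
    have UM: "U \<in> ?M" "U' \<in> ?M"
      unfolding U_def U'_def by (intro op_plus_commutant op_scale_commutant id_op_commutant T T')+
    have "is_adjoint H U' U"
      using T'T bounded_opsD(1)[OF Tb(1)] bounded_opsD(1)[OF Tb(2)]
      by (simp add: is_adjoint_def U_def U'_def op_plus_def op_scale_def id_op_def plus_closed scale_closed
          inner_plus inner_plus_right inner_scale inner_scale_right)
    then have "\<omega> (compose (hcarrier H) U' U) \<in> \<real>\<^sub>\<ge>\<^sub>0"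
      using \<omega> UM by (simp add: op_plf_def)
    moreover have "compose (hcarrier H) U' U = op_plus H
        (op_plus H (compose (hcarrier H) T' T) (op_scale H c T')) (op_scale H (cnj c) U)"
      using bounded_opsD[OF Tb(1)] bounded_opsD[OF Tb(2)]
      by (auto simp: compose_def U_def U'_def op_plus_def op_scale_def id_op_def plus_closed scale_closed
          intro!: ext)
    moreover have "\<omega> (op_plus H (op_plus H (compose (hcarrier H) T' T) (op_scale H c T')) (op_scale H (cnj c) U))
      = X + c * \<omega> T' + cnj c * \<omega> T"
      using UM T T' one
      by (simp add: plus scale compose_commutant op_plus_commutant op_scale_commutant X_def)
        (simp add: U_def plus scale op_scale_commutant id_op_commutant)
    ultimately show ?thesis
      by simp
  qed
  have zero: "u * \<omega> T' + cnj u * \<omega> T = 0" for u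
  proof -
    let ?z = "u * \<omega> T' + cnj u * \<omega> T"
    have *: "X + of_real t * ?z \<in> \<real>\<^sub>\<ge>\<^sub>0" for t
      using pos[of "of_real t * u"] by (simp add: algebra_simps)
    have "Im X = 0" "0 \<le> Re X"
      using *[of 0] by (auto simp: complex_nonneg_Reals_iff)
    then have "Im ?z = 0"
      using *[of 1] by (simp add: complex_nonneg_Reals_iff)
    moreover have "Re ?z = 0"
    proof (rule ccontr)
      assume nz: "Re ?z \<noteq> 0"
      have "0 \<le> Re X + t * Re ?z" for t
        using *[of t] by (simp add: complex_nonneg_Reals_iff)
      from this[of "- (Re X + 1) / Re ?z"] show False
        using nz by simp
    qed
    ultimately show ?thesis
      by (simp add: complex_eq_iff)
  qed
  show ?thesis
    using zero[of 1] zero[of \<i>] by (simp add: algebra_simps)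
qed

end

end

section \<open>The GNS space\<close>

lemma tendsto_null_norm_le:
  fixes f :: "nat \<Rightarrow> 'b::real_normed_vector"
  assumes "g \<longlonglongrightarrow> c" "\<And>n. norm (f n) \<le> g n" "c = 0"
  shows "f \<longlonglongrightarrow> 0"
  using assms by (intro Lim_null_comparison[OF always_eventually, of f g]) auto

context
  fixes lam :: "'a::unital_cstar_algebra \<Rightarrow> complex"
  assumes lam: "is_plf lam"
begin

abbreviation (input) gns_class :: "(nat \<Rightarrow> 'a) \<Rightarrow> (nat \<Rightarrow> 'a) set" where
  "gns_class X \<equiv> gns_rel lam `` {X}"

lemma gns_cauchy_plus:
  assumes "X \<in> gns_cauchy lam" "Y \<in> gns_cauchy lam"
  shows "(\<lambda>n. X n + Y n) \<in> gns_cauchy lam"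
proof (rule gns_cauchyI)
  fix e :: real assume e: "0 < e"
  obtain M where M: "\<And>m n. m \<ge> M \<Longrightarrow> n \<ge> M \<Longrightarrow> gns_norm lam (X m - X n) < e / 2"
    using gns_cauchyD[OF assms(1), of "e / 2"] e by auto
  obtain N where N: "\<And>m n. m \<ge> N \<Longrightarrow> n \<ge> N \<Longrightarrow> gns_norm lam (Y m - Y n) < e / 2"
    using gns_cauchyD[OF assms(2), of "e / 2"] e by auto
  have "gns_norm lam (X m + Y m - (X n + Y n)) < e" if "m \<ge> max M N" "n \<ge> max M N" for m n
    using gns_norm_triangle[OF lam, of "X m - X n" "Y m - Y n"] M[of m n] N[of m n] that
    by (simp add: algebra_simps)
  then show "\<exists>N. \<forall>m\<ge>N. \<forall>n\<ge>N. gns_norm lam (X m + Y m - (X n + Y n)) < e"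
    by blast
qed

lemma gns_cauchy_mult: "X \<in> gns_cauchy lam \<Longrightarrow> (\<lambda>n. a * X n) \<in> gns_cauchy lam"
  by (rule gns_cauchy_bounded_image[of X lam "norm a"])
    (auto simp flip: right_diff_distrib intro: gns_norm_mult_le[OF lam])

lemma scaleC_right_diff: "c *\<^sub>C (x - y) = c *\<^sub>C x - c *\<^sub>C (y::'a)"
  using scaleC_add_right[of c "x - y" y] by (simp add: algebra_simps)

lemma gns_cauchy_scaleC: "X \<in> gns_cauchy lam \<Longrightarrow> (\<lambda>n. c *\<^sub>C X n) \<in> gns_cauchy lam"
  by (rule gns_cauchy_bounded_image[of X lam "cmod c"])
    (auto simp flip: scaleC_right_diff simp: gns_norm_scaleC[OF lam])

lemma gns_cauchy_diff:
  assumes "X \<in> gns_cauchy lam" "Y \<in> gns_cauchy lam"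
  shows "(\<lambda>n. X n - Y n) \<in> gns_cauchy lam"
  using gns_cauchy_plus[OF assms(1) gns_cauchy_scaleC[OF assms(2), of "-1"]] by simp

lemma equiv_gns_rel: "equiv (gns_cauchy lam) (gns_rel lam)"
proof (rule equivI)
  show "gns_rel lam \<subseteq> gns_cauchy lam \<times> gns_cauchy lam"
    by (auto simp: gns_rel_def)
  show "refl_on (gns_cauchy lam) (gns_rel lam)"
    by (auto simp: refl_on_def gns_rel_def gns_norm_zero[OF lam])
  show "sym (gns_rel lam)"
    by (auto simp: sym_def gns_rel_def gns_norm_minus_commute[OF lam])
  show "trans (gns_rel lam)"
  proof (rule transI)
    fix X Y Z assume XY: "(X, Y) \<in> gns_rel lam" and YZ: "(Y, Z) \<in> gns_rel lam"
    have "(\<lambda>n. gns_norm lam (X n - Y n) + gns_norm lam (Y n - Z n)) \<longlonglongrightarrow> 0 + 0"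
      using XY YZ by (intro tendsto_add) (auto simp: gns_rel_def)
    moreover have "norm (gns_norm lam (X n - Z n)) \<le> gns_norm lam (X n - Y n) + gns_norm lam (Y n - Z n)" for n
      using gns_norm_triangle[OF lam, of "X n - Y n" "Y n - Z n"] gns_norm_nonneg[OF lam] by simp
    ultimately have "(\<lambda>n. gns_norm lam (X n - Z n)) \<longlonglongrightarrow> 0"
      by (rule tendsto_null_norm_le) simp
    then show "(X, Z) \<in> gns_rel lam"
      using XY YZ by (auto simp: gns_rel_def)
  qed
qed

lemma carrier_L2: "hcarrier (L2 lam) = gns_cauchy lam // gns_rel lam"
  by (simp add: L2_def)

lemma gns_class_in_carrier: "X \<in> gns_cauchy lam \<Longrightarrow> gns_class X \<in> hcarrier (L2 lam)"
  unfolding carrier_L2 by (rule quotientI)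

lemma L2_cases:
  assumes "h \<in> hcarrier (L2 lam)"
  obtains X where "X \<in> gns_cauchy lam" "h = gns_class X"
  using assms unfolding carrier_L2 by (rule quotientE)

lemma gns_rep_rel:
  assumes "X \<in> gns_cauchy lam"
  shows "(X, gns_rep (gns_class X)) \<in> gns_rel lam"
proof -
  have "\<exists>Y. Y \<in> gns_class X"
    using equiv_class_self[OF equiv_gns_rel assms] by blast
  then have "gns_rep (gns_class X) \<in> gns_class X"
    unfolding gns_rep_def by (rule someI_ex)
  then show ?thesis
    by simp
qed

lemma gns_class_eqI:
  assumes "X \<in> gns_cauchy lam" "Y \<in> gns_cauchy lam" "(\<lambda>n. gns_norm lam (X n - Y n)) \<longlonglongrightarrow> 0"
  shows "gns_class X = gns_class Y"
  by (rule equiv_class_eq[OF equiv_gns_rel]) (use assms in \<open>simp add: gns_rel_def\<close>)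

text \<open>The operations of \<open>L2 lam\<close> are defined through chosen representatives; this
  lemma and its analogues allow arbitrary ones, after which \<open>gns_rep\<close> is no longer
  met.\<close>

lemma hplus_L2:
  assumes X: "X \<in> gns_cauchy lam" and Y: "Y \<in> gns_cauchy lam"
  shows "hplus (L2 lam) (gns_class X) (gns_class Y) = gns_class (\<lambda>n. X n + Y n)"
proof -
  let ?X = "gns_rep (gns_class X)" and ?Y = "gns_rep (gns_class Y)"
  note rel = gns_rep_rel[OF X] gns_rep_rel[OF Y]
  have "gns_class (\<lambda>n. X n + Y n) = gns_class (\<lambda>n. ?X n + ?Y n)"
  proof (rule gns_class_eqI)
    have "(\<lambda>n. gns_norm lam (X n - ?X n) + gns_norm lam (Y n - ?Y n)) \<longlonglongrightarrow> 0 + 0"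
      using rel by (intro tendsto_add) (auto simp: gns_rel_def)
    moreover have "norm (gns_norm lam (X n + Y n - (?X n + ?Y n)))
        \<le> gns_norm lam (X n - ?X n) + gns_norm lam (Y n - ?Y n)" for n
      using gns_norm_triangle[OF lam, of "X n - ?X n" "Y n - ?Y n"] gns_norm_nonneg[OF lam]
      by (simp add: algebra_simps)
    ultimately show "(\<lambda>n. gns_norm lam (X n + Y n - (?X n + ?Y n))) \<longlonglongrightarrow> 0"
      by (rule tendsto_null_norm_le) simp
  qed (use X Y rel in \<open>auto intro!: gns_cauchy_plus simp: gns_rel_def\<close>)
  then show ?thesis
    by (simp add: L2_def)
qed

lemma hscale_L2:
  assumes X: "X \<in> gns_cauchy lam"
  shows "hscale (L2 lam) c (gns_class X) = gns_class (\<lambda>n. c *\<^sub>C X n)"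
proof -
  let ?X = "gns_rep (gns_class X)"
  note rel = gns_rep_rel[OF X]
  have "gns_class (\<lambda>n. c *\<^sub>C X n) = gns_class (\<lambda>n. c *\<^sub>C ?X n)"
  proof (rule gns_class_eqI)
    have "(\<lambda>n. cmod c * gns_norm lam (X n - ?X n)) \<longlonglongrightarrow> 0"
      using rel by (intro tendsto_mult_right_zero) (auto simp: gns_rel_def)
    then show "(\<lambda>n. gns_norm lam (c *\<^sub>C X n - c *\<^sub>C ?X n)) \<longlonglongrightarrow> 0"
      by (simp add: gns_norm_scaleC[OF lam] flip: scaleC_right_diff)
  qed (use X rel in \<open>auto intro!: gns_cauchy_scaleC simp: gns_rel_def\<close>)
  then show ?thesis
    by (simp add: L2_def)
qed

lemma gns_pi_class:
  assumes X: "X \<in> gns_cauchy lam"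
  shows "gns_pi lam a (gns_class X) = gns_class (\<lambda>n. a * X n)"
proof -
  let ?X = "gns_rep (gns_class X)"
  note rel = gns_rep_rel[OF X]
  have "gns_class (\<lambda>n. a * X n) = gns_class (\<lambda>n. a * ?X n)"
  proof (rule gns_class_eqI)
    have "(\<lambda>n. norm a * gns_norm lam (X n - ?X n)) \<longlonglongrightarrow> 0"
      using rel by (intro tendsto_mult_right_zero) (auto simp: gns_rel_def)
    moreover have "norm (gns_norm lam (a * X n - a * ?X n)) \<le> norm a * gns_norm lam (X n - ?X n)" for n
      using gns_norm_mult_le[OF lam, of a "X n - ?X n"] gns_norm_nonneg[OF lam]
      by (simp add: right_diff_distrib)
    ultimately show "(\<lambda>n. gns_norm lam (a * X n - a * ?X n)) \<longlonglongrightarrow> 0"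
      by (rule tendsto_null_norm_le) simp
  qed (use X rel in \<open>auto intro!: gns_cauchy_mult simp: gns_rel_def\<close>)
  then show ?thesis
    using gns_class_in_carrier[OF X] by (simp add: gns_pi_def)
qed

lemma hinner_L2:
  assumes X: "X \<in> gns_cauchy lam" and Y: "Y \<in> gns_cauchy lam"
  shows "(\<lambda>n. lam (star (Y n) * X n)) \<longlonglongrightarrow> hinner (L2 lam) (gns_class X) (gns_class Y)"
proof -
  let ?X = "gns_rep (gns_class X)" and ?Y = "gns_rep (gns_class Y)"
  note rel = gns_rep_rel[OF X] gns_rep_rel[OF Y]
  have X': "?X \<in> gns_cauchy lam" and Y': "?Y \<in> gns_cauchy lam"
    using rel by (auto simp: gns_rel_def)
  obtain B where B: "0 < B" "\<And>n. gns_norm lam (?X n) \<le> B"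
    using gns_cauchy_bounded[OF lam X'] by blast
  obtain C where C: "0 < C" "\<And>n. gns_norm lam (Y n) \<le> C"
    using gns_cauchy_bounded[OF lam Y] by blast
  have "(\<lambda>n. C * gns_norm lam (X n - ?X n) + gns_norm lam (Y n - ?Y n) * B) \<longlonglongrightarrow> C * 0 + 0 * B"
    using rel by (intro tendsto_intros) (auto simp: gns_rel_def)
  moreover have "cmod (lam (star (Y n) * X n) - lam (star (?Y n) * ?X n))
      \<le> C * gns_norm lam (X n - ?X n) + gns_norm lam (Y n - ?Y n) * B" for n
    by (rule order_trans[OF gns_inner_diff_le[OF lam]])
      (intro add_mono mult_mono B C gns_norm_nonneg lam order_refl less_imp_le[OF C(1)])
  ultimately have "(\<lambda>n. lam (star (Y n) * X n) - lam (star (?Y n) * ?X n)) \<longlonglongrightarrow> 0"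
    by (rule tendsto_null_norm_le) simp
  moreover have "(\<lambda>n. lam (star (?Y n) * ?X n)) \<longlonglongrightarrow> hinner (L2 lam) (gns_class X) (gns_class Y)"
    using gns_inner_convergent[OF lam X' Y'] by (simp add: L2_def convergent_LIMSEQ_iff)
  ultimately show ?thesis
    using tendsto_add by fastforce
qed

lemma hnorm_L2:
  assumes X: "X \<in> gns_cauchy lam"
  shows "(\<lambda>n. gns_norm lam (X n)) \<longlonglongrightarrow> hnorm (L2 lam) (gns_class X)"
  unfolding gns_seminorm_def hnorm_def by (intro tendsto_intros hinner_L2 X)

lemma hnorm_L2_const: "hnorm (L2 lam) (gns_class (\<lambda>_. a)) = gns_norm lam a"
  using hnorm_L2[OF gns_cauchy_const[OF lam, of a]] by (simp add: LIMSEQ_const_iff)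

lemma hinner_L2_plus:
  assumes "h \<in> hcarrier (L2 lam)" "k \<in> hcarrier (L2 lam)" "l \<in> hcarrier (L2 lam)"
  shows "hinner (L2 lam) (hplus (L2 lam) h k) l = hinner (L2 lam) h l + hinner (L2 lam) k l"
proof -
  obtain X Y Z where X: "X \<in> gns_cauchy lam" "h = gns_class X" and Y: "Y \<in> gns_cauchy lam" "k = gns_class Y"
    and Z: "Z \<in> gns_cauchy lam" "l = gns_class Z"
    using L2_cases assms by metis
  have "(\<lambda>n. lam (star (Z n) * X n) + lam (star (Z n) * Y n)) \<longlonglongrightarrow> hinner (L2 lam) (hplus (L2 lam) h k) l"
    using hinner_L2[OF gns_cauchy_plus[OF X(1) Y(1)] Z(1)]
    by (simp add: X Y Z hplus_L2 distrib_left plf_add[OF lam])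
  moreover have "(\<lambda>n. lam (star (Z n) * X n) + lam (star (Z n) * Y n))
      \<longlonglongrightarrow> hinner (L2 lam) h l + hinner (L2 lam) k l"
    unfolding X(2) Y(2) Z(2) by (intro tendsto_intros hinner_L2 X Y Z)
  ultimately show ?thesis
    by (rule LIMSEQ_unique)
qed

lemma hinner_L2_Cauchy_Schwarz:
  assumes "h \<in> hcarrier (L2 lam)" "k \<in> hcarrier (L2 lam)"
  shows "cmod (hinner (L2 lam) h k) \<le> hnorm (L2 lam) h * hnorm (L2 lam) k"
proof -
  obtain X Y where X: "X \<in> gns_cauchy lam" "h = gns_class X" and Y: "Y \<in> gns_cauchy lam" "k = gns_class Y"
    using L2_cases assms by metis
  show ?thesis
    unfolding X(2) Y(2)
  proof (rule LIMSEQ_le)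
    show "(\<lambda>n. cmod (lam (star (Y n) * X n))) \<longlonglongrightarrow> cmod (hinner (L2 lam) (gns_class X) (gns_class Y))"
      by (intro tendsto_intros hinner_L2 X Y)
    show "(\<lambda>n. gns_norm lam (X n) * gns_norm lam (Y n)) \<longlonglongrightarrow> hnorm (L2 lam) (gns_class X) * hnorm (L2 lam) (gns_class Y)"
      by (intro tendsto_intros hnorm_L2 X Y)
  qed (metis plf_Cauchy_Schwarz[OF lam] mult.commute)
qed

text \<open>Density of the algebra in its completion: \<open>h\<close> differs from the class of the
  constant sequence \<open>X N\<close> by a class \<open>D\<close> of small norm.\<close>

lemma L2_functional_eq_zero:
  assumes plus: "\<And>h k. h \<in> hcarrier (L2 lam) \<Longrightarrow> k \<in> hcarrier (L2 lam) \<Longrightarrow> F (hplus (L2 lam) h k) = F h + F k"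
    and bound: "\<And>h. h \<in> hcarrier (L2 lam) \<Longrightarrow> cmod (F h) \<le> K * hnorm (L2 lam) h"
    and const: "\<And>a. F (gns_class (\<lambda>_. a)) = 0"
    and h: "h \<in> hcarrier (L2 lam)"
  shows "F h = 0"
proof -
  obtain X where X: "X \<in> gns_cauchy lam" "h = gns_class X"
    using L2_cases[OF h] by blast
  have "cmod (F h) \<le> 0 + e" if e: "0 < e" for e
  proof -
    have "0 < e / (\<bar>K\<bar> + 1)"
      using e by simp
    then obtain N where N: "\<And>m n. m \<ge> N \<Longrightarrow> n \<ge> N \<Longrightarrow> gns_norm lam (X m - X n) < e / (\<bar>K\<bar> + 1)"
      using gns_cauchyD[OF X(1)] by blast
    define D where "D = (\<lambda>n. X n - X N)"
    have D: "D \<in> gns_cauchy lam"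
      unfolding D_def by (rule gns_cauchy_diff[OF X(1) gns_cauchy_const[OF lam]])
    have "h = hplus (L2 lam) (gns_class D) (gns_class (\<lambda>_. X N))"
      unfolding hplus_L2[OF D gns_cauchy_const[OF lam]] X(2) by (simp add: D_def)
    then have Fh: "F h = F (gns_class D)"
      using plus[OF gns_class_in_carrier[OF D] gns_class_in_carrier[OF gns_cauchy_const[OF lam]]] by (simp add: const)
    have "hnorm (L2 lam) (gns_class D) \<le> e / (\<bar>K\<bar> + 1)"
      by (rule LIMSEQ_le_const2[OF hnorm_L2[OF D]]) (auto simp: D_def intro!: exI[of _ N] less_imp_le[OF N])
    moreover have "0 \<le> hnorm (L2 lam) (gns_class D)"
      by (rule LIMSEQ_le_const[OF hnorm_L2[OF D]]) (auto intro: gns_norm_nonneg[OF lam])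
    ultimately have "K * hnorm (L2 lam) (gns_class D) \<le> \<bar>K\<bar> * (e / (\<bar>K\<bar> + 1))"
      by (intro mult_mono) auto
    also have "\<dots> \<le> e"
      using e by (simp add: field_simps)
    finally show ?thesis
      using bound[OF gns_class_in_carrier[OF D]] Fh by simp
  qed
  then have "cmod (F h) \<le> 0"
    by (rule field_le_epsilon)
  then show ?thesis
    by simp
qed

text \<open>For the Riesz property the functional is restricted to constant sequences;
  \<open>plf_Riesz\<close> then supplies a Cauchy sequence whose class is the representing vector,
  and density extends the identity to all of \<open>L2 lam\<close>. Completeness of the quotient
  need not be treated separately.\<close>

lemma hilbert_carrier_L2: "hilbert_carrier (L2 lam)"
proof
  fix h k l c
  assume "h \<in> hcarrier (L2 lam)"
  then obtain X where X: "X \<in> gns_cauchy lam" "h = gns_class X"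
    by (rule L2_cases)
  show "hscale (L2 lam) c h \<in> hcarrier (L2 lam)"
    by (simp add: X hscale_L2 gns_class_in_carrier gns_cauchy_scaleC)
  show "0 \<le> Re (hinner (L2 lam) h h)"
    using tendsto_Re[OF hinner_L2[OF X(1) X(1)]] plf_Re_pos[OF lam] unfolding X(2)
    by (intro LIMSEQ_le_const) auto
  {
    assume "l \<in> hcarrier (L2 lam)"
    then obtain Z where Z: "Z \<in> gns_cauchy lam" "l = gns_class Z"
      by (rule L2_cases)
    have "(\<lambda>n. c * lam (star (Z n) * X n)) \<longlonglongrightarrow> hinner (L2 lam) (hscale (L2 lam) c h) l"
      using hinner_L2[OF gns_cauchy_scaleC[OF X(1)] Z(1), of c]
      by (simp add: X Z hscale_L2 mult_scaleC_right plf_scaleC[OF lam])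
    moreover have "(\<lambda>n. c * lam (star (Z n) * X n)) \<longlonglongrightarrow> c * hinner (L2 lam) h l"
      unfolding X(2) Z(2) by (intro tendsto_intros hinner_L2 X Z)
    ultimately show "hinner (L2 lam) (hscale (L2 lam) c h) l = c * hinner (L2 lam) h l"
      by (rule LIMSEQ_unique)
  }
  assume "k \<in> hcarrier (L2 lam)"
  then obtain Y where Y: "Y \<in> gns_cauchy lam" "k = gns_class Y"
    by (rule L2_cases)
  show "hplus (L2 lam) h k \<in> hcarrier (L2 lam)"
    by (simp add: X Y hplus_L2 gns_class_in_carrier gns_cauchy_plus)
  have "(\<lambda>n. cnj (lam (star (Y n) * X n))) \<longlonglongrightarrow> hinner (L2 lam) k h"
    using hinner_L2[OF Y(1) X(1)] unfolding X(2) Y(2) by (simp add: plf_hermitian[OF lam, of "X _"])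
  moreover have "(\<lambda>n. cnj (lam (star (Y n) * X n))) \<longlonglongrightarrow> cnj (hinner (L2 lam) h k)"
    unfolding X(2) Y(2) by (intro tendsto_cnj hinner_L2 X Y)
  ultimately show "hinner (L2 lam) k h = cnj (hinner (L2 lam) h k)"
    by (rule LIMSEQ_unique)
  show "cmod (hinner (L2 lam) h k) \<le> hnorm (L2 lam) h * hnorm (L2 lam) k"
    by (rule hinner_L2_Cauchy_Schwarz) fact+
  {
    assume "l \<in> hcarrier (L2 lam)"
    show "hinner (L2 lam) (hplus (L2 lam) h k) l = hinner (L2 lam) h l + hinner (L2 lam) k l"
      by (rule hinner_L2_plus) fact+
  }
  {
    assume eq: "\<And>l. l \<in> hcarrier (L2 lam) \<Longrightarrow> hinner (L2 lam) h l = hinner (L2 lam) k l"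
    define D where "D = (\<lambda>n. X n - Y n)"
    have D: "D \<in> gns_cauchy lam"
      unfolding D_def by (rule gns_cauchy_diff[OF X(1) Y(1)])
    have "(\<lambda>n. lam (star (D n) * X n) - lam (star (D n) * Y n))
        \<longlonglongrightarrow> hinner (L2 lam) h (gns_class D) - hinner (L2 lam) k (gns_class D)"
      unfolding X(2) Y(2) by (intro tendsto_intros hinner_L2 X Y D)
    then have "(\<lambda>n. lam (star (D n) * D n)) \<longlonglongrightarrow> 0"
      using eq[OF gns_class_in_carrier[OF D]] by (simp add: D_def right_diff_distrib plf_diff[OF lam])
    then have "(\<lambda>n. sqrt (Re (lam (star (D n) * D n)))) \<longlonglongrightarrow> sqrt (Re 0)"
      by (intro tendsto_intros)
    then show "h = k"
      unfolding X(2) Y(2) by (intro gns_class_eqI X Y) (simp add: gns_seminorm_def D_def)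
  }
next
  fix f K
  assume plus: "\<And>h k. h \<in> hcarrier (L2 lam) \<Longrightarrow> k \<in> hcarrier (L2 lam) \<Longrightarrow> f (hplus (L2 lam) h k) = f h + f k"
    and scale: "\<And>c h. h \<in> hcarrier (L2 lam) \<Longrightarrow> f (hscale (L2 lam) c h) = c * f h"
    and bound: "\<And>h. h \<in> hcarrier (L2 lam) \<Longrightarrow> cmod (f h) \<le> K * hnorm (L2 lam) h"
  define g where "g a = f (gns_class (\<lambda>_. a))" for a
  note const = gns_class_in_carrier[OF gns_cauchy_const[OF lam]]
  have g: "g (a + b) = g a + g b" "g (c *\<^sub>C a) = c * g a" "cmod (g a) \<le> K * gns_norm lam a" for a b c
    using plus[OF const const, of a b] scale[OF const, of c a] bound[OF const, of a]
    by (simp_all add: g_def hplus_L2[OF gns_cauchy_const[OF lam] gns_cauchy_const[OF lam]] hscale_L2[OF gns_cauchy_const[OF lam]] hnorm_L2_const)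
  obtain b where b: "b \<in> gns_cauchy lam" "\<And>a. (\<lambda>n. lam (star (b n) * a)) \<longlonglongrightarrow> g a"
    using plf_Riesz[OF lam g] by blast
  let ?y = "gns_class b"
  have y: "?y \<in> hcarrier (L2 lam)"
    by (rule gns_class_in_carrier[OF b(1)])
  have "f h - hinner (L2 lam) h ?y = 0" if h: "h \<in> hcarrier (L2 lam)" for h
  proof (rule L2_functional_eq_zero[of "\<lambda>h. f h - hinner (L2 lam) h ?y" "K + hnorm (L2 lam) ?y", OF _ _ _ h])
    fix h k assume "h \<in> hcarrier (L2 lam)" "k \<in> hcarrier (L2 lam)"
    then show "f (hplus (L2 lam) h k) - hinner (L2 lam) (hplus (L2 lam) h k) ?y
      = f h - hinner (L2 lam) h ?y + (f k - hinner (L2 lam) k ?y)"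
      by (simp add: plus hinner_L2_plus y)
  next
    fix h assume h: "h \<in> hcarrier (L2 lam)"
    show "cmod (f h - hinner (L2 lam) h ?y) \<le> (K + hnorm (L2 lam) ?y) * hnorm (L2 lam) h"
      using norm_triangle_ineq4[of "f h" "hinner (L2 lam) h ?y"] bound[OF h] hinner_L2_Cauchy_Schwarz[OF h y]
      unfolding distrib_right mult.commute[of "hnorm (L2 lam) ?y"] by linarith
  next
    fix a
    have "(\<lambda>n. lam (star (b n) * a)) \<longlonglongrightarrow> hinner (L2 lam) (gns_class (\<lambda>_. a)) ?y"
      by (rule hinner_L2[OF gns_cauchy_const[OF lam] b(1)])
    then show "f (gns_class (\<lambda>_. a)) - hinner (L2 lam) (gns_class (\<lambda>_. a)) ?y = 0"
      using LIMSEQ_unique[OF b(2)] by (simp add: g_def)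
  qed
  then show "\<exists>y\<in>hcarrier (L2 lam). \<forall>h\<in>hcarrier (L2 lam). f h = hinner (L2 lam) h y"
    using y by (intro bexI[of _ ?y]) auto
qed

section \<open>The GNS representation and its bicommutant\<close>

interpretation L2: hilbert_carrier "L2 lam"
  by (rule hilbert_carrier_L2)

lemma gns_pi_bounded: "gns_pi lam a \<in> bounded_ops (L2 lam)"
proof (rule L2.bounded_opsI[of _ "norm a"])
  show "gns_pi lam a \<in> extensional (hcarrier (L2 lam))"
    by (simp add: gns_pi_def)
  fix h c assume "h \<in> hcarrier (L2 lam)"
  then obtain X where X: "X \<in> gns_cauchy lam" "h = gns_class X"
    by (rule L2_cases)
  show "gns_pi lam a h \<in> hcarrier (L2 lam)"
    by (simp add: X gns_pi_class gns_class_in_carrier gns_cauchy_mult)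
  show "gns_pi lam a (hscale (L2 lam) c h) = hscale (L2 lam) c (gns_pi lam a h)"
    by (simp add: X gns_pi_class hscale_L2 gns_cauchy_scaleC gns_cauchy_mult mult_scaleC_right)
  show "hnorm (L2 lam) (gns_pi lam a h) \<le> norm a * hnorm (L2 lam) h"
    unfolding X(2) gns_pi_class[OF X(1)]
    by (rule LIMSEQ_le[OF hnorm_L2[OF gns_cauchy_mult[OF X(1)]] tendsto_mult_left[OF hnorm_L2[OF X(1)]]])
      (use gns_norm_mult_le[OF lam] in blast)
  fix k assume "k \<in> hcarrier (L2 lam)"
  then obtain Y where Y: "Y \<in> gns_cauchy lam" "k = gns_class Y"
    by (rule L2_cases)
  show "gns_pi lam a (hplus (L2 lam) h k) = hplus (L2 lam) (gns_pi lam a h) (gns_pi lam a k)"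
    by (simp add: X Y gns_pi_class hplus_L2 gns_cauchy_plus gns_cauchy_mult distrib_left)
qed

lemma gns_pi_adjoint: "is_adjoint (L2 lam) (gns_pi lam (star a)) (gns_pi lam a)"
  unfolding is_adjoint_def
proof (intro ballI)
  fix h k assume "h \<in> hcarrier (L2 lam)" "k \<in> hcarrier (L2 lam)"
  then obtain X Y where X: "X \<in> gns_cauchy lam" "h = gns_class X" and Y: "Y \<in> gns_cauchy lam" "k = gns_class Y"
    using L2_cases by metis
  have "(\<lambda>n. lam (star (Y n) * (star a * X n))) \<longlonglongrightarrow> hinner (L2 lam) (gns_pi lam (star a) h) k"
    unfolding X(2) Y(2) gns_pi_class[OF X(1)] by (intro hinner_L2 gns_cauchy_mult X Y)
  moreover have "(\<lambda>n. lam (star (a * Y n) * X n)) \<longlonglongrightarrow> hinner (L2 lam) h (gns_pi lam a k)"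
    unfolding X(2) Y(2) gns_pi_class[OF Y(1)] by (intro hinner_L2 gns_cauchy_mult X Y)
  ultimately show "hinner (L2 lam) (gns_pi lam (star a) h) k = hinner (L2 lam) h (gns_pi lam a k)"
    by (simp add: star_mult mult.assoc LIMSEQ_unique)
qed

lemma gns_pi_ops:
  "gns_pi lam (a + b) = op_plus (L2 lam) (gns_pi lam a) (gns_pi lam b)"
  "gns_pi lam (c *\<^sub>C a) = op_scale (L2 lam) c (gns_pi lam a)"
  "gns_pi lam (a * b) = compose (hcarrier (L2 lam)) (gns_pi lam a) (gns_pi lam b)"
  "gns_pi lam 1 = L2.id_op"
proof -
  have eqI: "gns_pi lam d = F" if "F \<in> extensional (hcarrier (L2 lam))"
    "\<And>X. X \<in> gns_cauchy lam \<Longrightarrow> gns_pi lam d (gns_class X) = F (gns_class X)" for d F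
  proof (rule extensionalityI[OF _ that(1)])
    show "gns_pi lam d \<in> extensional (hcarrier (L2 lam))"
      by (simp add: gns_pi_def)
  qed (metis that(2) L2_cases)
  show "gns_pi lam (a + b) = op_plus (L2 lam) (gns_pi lam a) (gns_pi lam b)"
    by (rule eqI) (auto simp: op_plus_def gns_pi_class hplus_L2 gns_class_in_carrier gns_cauchy_mult distrib_right)
  show "gns_pi lam (c *\<^sub>C a) = op_scale (L2 lam) c (gns_pi lam a)"
    by (rule eqI) (auto simp: op_scale_def gns_pi_class hscale_L2 gns_class_in_carrier gns_cauchy_mult mult_scaleC_left)
  show "gns_pi lam (a * b) = compose (hcarrier (L2 lam)) (gns_pi lam a) (gns_pi lam b)"
    by (rule eqI) (auto simp: compose_def gns_pi_class gns_class_in_carrier gns_cauchy_mult mult.assoc)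
  show "gns_pi lam 1 = L2.id_op"
    by (rule eqI) (auto simp: L2.id_op_def gns_pi_class gns_class_in_carrier)
qed

lemma range_gns_pi_bounded: "range (gns_pi lam) \<subseteq> bounded_ops (L2 lam)"
  using gns_pi_bounded by blast

lemma gns_pi_Linf: "gns_pi lam a \<in> Linf lam"
  unfolding Linf_def
proof (rule L2.commutantI[OF gns_pi_bounded L2.commutant_subset])
  fix S h assume "S \<in> commutant (L2 lam) (range (gns_pi lam))" "h \<in> hcarrier (L2 lam)"
  then show "gns_pi lam a (S h) = S (gns_pi lam a h)"
    using L2.commutantD[of S "range (gns_pi lam)" "gns_pi lam a" h] by simp
qed

lemma Linf_bounded: "Linf lam \<subseteq> bounded_ops (L2 lam)"
  unfolding Linf_def by (rule L2.commutant_subset)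

text \<open>\<open>Linf lam\<close> is the commutant of an adjoint-closed set and its identity is
  \<open>gns_pi lam 1\<close>, so a nonzero functional on it remains nonzero when restricted to the
  C*-algebra.\<close>

lemma Linf_plf_eq_zero:
  assumes "Linf_plf lam \<omega>" "\<omega> (gns_pi lam 1) = 0" "T \<in> Linf lam"
  shows "\<omega> T = 0"
proof -
  have "L2.adjoint_closed (range (gns_pi lam))"
    unfolding L2.adjoint_closed_def using gns_pi_adjoint[of "star _"] by (auto simp: star_star)
  then have "L2.adjoint_closed (commutant (L2 lam) (range (gns_pi lam)))"
    by (rule L2.adjoint_closed_commutant[OF range_gns_pi_bounded])
  from L2.op_plf_commutant_eq_zero[OF L2.commutant_subset this assms(1)[unfolded Linf_plf_def Linf_def]
      assms(2)[unfolded gns_pi_ops(4)] assms(3)[unfolded Linf_def]]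
  show ?thesis .
qed

lemma Linf_plf_restrict:
  assumes "Linf_plf lam \<phi>"
  shows "is_plf (\<lambda>a. \<phi> (gns_pi lam a))"
  using assms gns_pi_Linf gns_pi_adjoint
  by (auto simp: is_plf_def Linf_plf_def op_plf_def gns_pi_ops(1-3))

end

section \<open>Weak* continuous functionals are absolutely continuous\<close>

text \<open>A filter turns the \<epsilon>-\<delta> condition of \<open>abs_cont\<close> into a
  limit, to which Tannery's theorem and topological arguments apply.\<close>

definition small_contractions :: "('a::unital_cstar_algebra \<Rightarrow> complex) \<Rightarrow> 'a filter" where
  "small_contractions lam = inf (filtercomap (gns_norm lam) (nhds 0)) (principal {a. plf_contraction a})"

context
  fixes lam :: "'a::unital_cstar_algebra \<Rightarrow> complex"
  assumes lam: "is_plf lam"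
begin

interpretation L2: hilbert_carrier "L2 lam"
  by (rule hilbert_carrier_L2[OF lam])

lemma eventually_small_contractions:
  "eventually P (small_contractions lam) \<longleftrightarrow>
    (\<exists>\<delta>>0. \<forall>a. plf_contraction a \<and> gns_norm lam a < \<delta> \<longrightarrow> P a)"
proof
  assume "eventually P (small_contractions lam)"
  then obtain Q where Q: "eventually Q (nhds 0)" "\<And>a. Q (gns_norm lam a) \<Longrightarrow> plf_contraction a \<Longrightarrow> P a"
    by (auto simp: small_contractions_def eventually_inf_principal eventually_filtercomap)
  then obtain \<delta> where \<delta>: "0 < \<delta>" "\<And>x. dist x 0 < \<delta> \<Longrightarrow> Q x"
    unfolding eventually_nhds_metric by blast
  then show "\<exists>\<delta>>0. \<forall>a. plf_contraction a \<and> gns_norm lam a < \<delta> \<longrightarrow> P a"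
    using Q(2) gns_norm_nonneg[OF lam] by (intro exI[of _ \<delta>]) auto
next
  assume "\<exists>\<delta>>0. \<forall>a. plf_contraction a \<and> gns_norm lam a < \<delta> \<longrightarrow> P a"
  then obtain \<delta> where \<delta>: "0 < \<delta>" "\<And>a. plf_contraction a \<Longrightarrow> gns_norm lam a < \<delta> \<Longrightarrow> P a"
    by blast
  have "eventually (\<lambda>x. x < \<delta>) (nhds (0::real))"
    using \<delta>(1) by (intro eventually_nhds_in_open[of "{..<\<delta>}", simplified]) auto
  then show "eventually P (small_contractions lam)"
    using \<delta>(2) unfolding small_contractions_def eventually_inf_principal eventually_filtercomap by auto
qed

lemma small_contractions_neq_bot: "small_contractions lam \<noteq> bot"
proof -
  have "plf_contraction (0 :: 'a)"
    using plf_positive_one by (simp add: plf_contraction_def)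
  then have "\<not> eventually (\<lambda>_. False) (small_contractions lam)"
    unfolding eventually_small_contractions using gns_norm_zero[OF lam] by force
  then show ?thesis
    by (metis eventually_bot)
qed

lemma hnorm_gns_pi_contraction:
  assumes "plf_contraction a" "h \<in> hcarrier (L2 lam)"
  shows "hnorm (L2 lam) (gns_pi lam a h) \<le> hnorm (L2 lam) h"
proof -
  obtain X where X: "X \<in> gns_cauchy lam" "h = gns_rel lam `` {X}"
    using L2_cases[OF lam assms(2)] by blast
  show ?thesis
    unfolding X(2) gns_pi_class[OF lam X(1)]
    by (rule LIMSEQ_le[OF hnorm_L2[OF lam gns_cauchy_mult[OF lam X(1)]] hnorm_L2[OF lam X(1)]])
      (use plf_contraction_le[OF assms(1) lam] in blast)
qed

text \<open>Approximate \<open>h\<close> by a single \<open>X N\<close>. The part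
  \<open>a * X N\<close> is small because right multiplication by \<open>X N\<close> is bounded; the
  remainder stays small uniformly because \<open>a\<close> is a contraction.\<close>

lemma gns_pi_small:
  assumes K: "0 < K" "\<And>a. gns_norm lam (star a) \<le> K * gns_norm lam a"
    and h: "h \<in> hcarrier (L2 lam)"
  shows "((\<lambda>a. hnorm (L2 lam) (gns_pi lam a h)) \<longlongrightarrow> 0) (small_contractions lam)"
proof (rule tendstoI)
  fix e :: real assume e: "0 < e"
  obtain X where X: "X \<in> gns_cauchy lam" "h = gns_rel lam `` {X}"
    using L2_cases[OF lam h] by blast
  \<comment> \<open>Right multiplication is left multiplication conjugated by the involution, which
    costs the factor \<open>K\<close> twice.\<close>
  have right_mult: "gns_norm lam (a * b) \<le> K\<^sup>2 * norm b * gns_norm lam a" for a b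
  proof -
    have "gns_norm lam (a * b) \<le> K * gns_norm lam (star b * star a)"
      using K(2)[of "star (a * b)"] by (simp add: star_simps)
    also have "\<dots> \<le> K * (norm b * (K * gns_norm lam a))"
      using K(1) order_trans[OF gns_norm_mult_le[OF lam, of "star b" "star a"]
          mult_left_mono[OF K(2)[of a] norm_ge_zero[of "star b"]]]
      by (intro mult_left_mono) auto
    finally show ?thesis
      by (simp add: power2_eq_square algebra_simps)
  qed
  obtain N where N: "\<And>m n. m \<ge> N \<Longrightarrow> n \<ge> N \<Longrightarrow> gns_norm lam (X m - X n) < e / 3"
    using gns_cauchyD[OF X(1), of "e / 3"] e by auto
  define C where "C = K\<^sup>2 * norm (X N) + 1"
  have C: "0 < C"
    by (simp add: C_def add_nonneg_pos)
  have "dist (hnorm (L2 lam) (gns_pi lam a h)) 0 < e"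
    if a: "plf_contraction a" "gns_norm lam a < e / (3 * C)" for a
  proof -
    have "gns_norm lam (a * X n) \<le> e / 3 + e / 3" if "n \<ge> N" for n
    proof -
      have "gns_norm lam (a * X n) \<le> gns_norm lam (a * (X n - X N)) + gns_norm lam (a * X N)"
        using gns_norm_triangle[OF lam, of "a * (X n - X N)" "a * X N"] by (simp add: algebra_simps)
      also have "\<dots> \<le> gns_norm lam (X n - X N) + C * gns_norm lam a"
        using right_mult[of a "X N"] gns_norm_nonneg[OF lam, of a]
        by (intro add_mono plf_contraction_le[OF a(1) lam]) (simp add: C_def distrib_right)
      also have "\<dots> \<le> e / 3 + C * (e / (3 * C))"
        using N[of n N] that a(2) C by (intro add_mono mult_left_mono) auto
      finally show ?thesis
        using C by simp
    qed
    then have "hnorm (L2 lam) (gns_pi lam a h) \<le> e / 3 + e / 3"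
      unfolding X(2) gns_pi_class[OF lam X(1)]
      by (intro LIMSEQ_le_const2[OF hnorm_L2[OF lam gns_cauchy_mult[OF lam X(1)]]]) blast
    then show ?thesis
      using e L2.hnorm_nonneg[OF L2.bounded_opsD(1)[OF gns_pi_bounded[OF lam] h], of a] by simp
  qed
  moreover have "0 < e / (3 * C)"
    using e C by simp
  ultimately show "\<forall>\<^sub>F a in small_contractions lam. dist (hnorm (L2 lam) (gns_pi lam a h)) 0 < e"
    unfolding eventually_small_contractions by blast
qed

text \<open>Each summand tends to zero by \<open>gns_pi_small\<close>. Since contractions do not
  increase vector norms, half the sum of the squared norms of \<open>h n\<close> and
  \<open>k n\<close> is a summable majorant, and Tannery's theorem exchanges limit and sum.\<close>

lemma predual_small:
  assumes K: "0 < K" "\<And>a. gns_norm lam (star a) \<le> K * gns_norm lam a"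
    and \<omega>: "\<omega> \<in> predual (L2 lam)"
  shows "((\<lambda>a. \<omega> (gns_pi lam (star a * a))) \<longlongrightarrow> 0) (small_contractions lam)"
proof -
  let ?H = "L2 lam"
  obtain h k where hk: "square_summable ?H h" "square_summable ?H k"
    and \<omega>_eq: "\<omega> = (\<lambda>T. \<Sum>n. hinner ?H (T (h n)) (k n))"
    using \<omega> unfolding predual_def by blast
  have carrier: "h n \<in> hcarrier ?H" "k n \<in> hcarrier ?H" for n
    using hk by (auto simp: square_summable_def)
  define f where "f n a = hinner ?H (gns_pi lam (star a * a) (h n)) (k n)" for n a
  define M where "M n = ((hnorm ?H (h n))\<^sup>2 + (hnorm ?H (k n))\<^sup>2) / 2" for n
  note pi_carrier = L2.bounded_opsD(1)[OF gns_pi_bounded[OF lam]]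
  have le: "norm (f n a) \<le> hnorm ?H (gns_pi lam a (h n)) * hnorm ?H (gns_pi lam a (k n))" for n a
  proof -
    have "f n a = hinner ?H (gns_pi lam (star a) (gns_pi lam a (h n))) (k n)"
      by (simp add: f_def gns_pi_ops(3)[OF lam] compose_def carrier)
    also have "\<dots> = hinner ?H (gns_pi lam a (h n)) (gns_pi lam a (k n))"
      using gns_pi_adjoint[OF lam, of a] carrier pi_carrier by (simp add: is_adjoint_def)
    finally show ?thesis
      using L2.inner_CS pi_carrier carrier by simp
  qed
  have "((\<lambda>a. \<Sum>n. f n a) \<longlongrightarrow> (\<Sum>n. 0)) (small_contractions lam)"
  proof (rule tannerys_theorem[THEN conjunct2, THEN conjunct2])
    fix n
    have "((\<lambda>a. hnorm ?H (gns_pi lam a (h n)) * hnorm ?H (gns_pi lam a (k n))) \<longlongrightarrow> 0 * 0) (small_contractions lam)"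
      by (intro tendsto_mult gns_pi_small[OF K] carrier)
    then show "(f n \<longlongrightarrow> 0) (small_contractions lam)"
      using le[of n] by (intro Lim_null_comparison[OF always_eventually, of "f n"]) auto
  next
    have M: "norm (f n a) \<le> M n" if a: "plf_contraction a" for n a
    proof -
      let ?x = "hnorm ?H (h n)" and ?y = "hnorm ?H (k n)"
      have "norm (f n a) \<le> ?x * ?y"
        using le[of n a] hnorm_gns_pi_contraction[OF a carrier(1)[of n]] hnorm_gns_pi_contraction[OF a carrier(2)[of n]]
        by (rule order_trans[OF _ mult_mono]) (auto intro: L2.hnorm_nonneg carrier pi_carrier)
      moreover have "0 \<le> (?x - ?y)\<^sup>2"
        by simp
      ultimately show ?thesis
        unfolding M_def by (simp add: power2_diff)
    qed
    have "eventually plf_contraction (small_contractions lam)"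
      unfolding eventually_small_contractions by (auto intro: exI[of _ 1])
    then have "eventually (\<lambda>(n::nat, a). plf_contraction a) (at_top \<times>\<^sub>F small_contractions lam)"
      by (subst eventually_prod2) simp_all
    then show "eventually (\<lambda>(n, a). norm (f n a) \<le> M n) (at_top \<times>\<^sub>F small_contractions lam)"
      by (rule eventually_mono) (auto intro: M)
  next
    show "summable M"
      unfolding M_def using hk by (intro summable_divide summable_add) (auto simp: square_summable_def)
  qed (rule small_contractions_neq_bot)
  then show ?thesis
    by (simp add: \<omega>_eq f_def)
qed

text \<open>It suffices that \<open>gns_pi lam (star a * a)\<close> tends to zero in the weak*
  topology along small contractions; continuity of the extension then transports this to
  \<open>\<rho>\<close>. In this way no representation of the extension by a predual element has to
  be found.\<close>

lemma weak_star_cont_imp_abs_cont: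
  assumes K: "0 < K" "\<And>a. gns_norm lam (star a) \<le> K * gns_norm lam a"
    and \<rho>: "weak_star_cont lam \<rho>"
  shows "abs_cont lam \<rho>"
  unfolding abs_cont_def
proof (intro allI impI)
  fix \<epsilon> :: real assume \<epsilon>: "0 < \<epsilon>"
  have plf: "is_plf \<rho>"
    using \<rho> by (simp add: weak_star_cont_def)
  obtain \<phi> where \<phi>: "Linf_extension lam \<rho> \<phi>" "Linf_weak_star_continuous lam \<phi>"
    using \<rho> unfolding weak_star_cont_def by blast
  let ?T = "weak_star_topology (L2 lam) (Linf lam)"
  let ?S = "{{T \<in> Linf lam. \<omega> T \<in> U} | \<omega> U. \<omega> \<in> predual (L2 lam) \<and> open U}"
  have pred0: "\<omega> (gns_pi lam 0) = 0" if "\<omega> \<in> predual (L2 lam)" for \<omega>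
  proof -
    have zero: "gns_pi lam 0 = op_scale (L2 lam) 0 (gns_pi lam 0)"
      using gns_pi_ops(2)[OF lam, of 0 0] by simp
    have "hinner (L2 lam) (gns_pi lam 0 h) k = 0" if "h \<in> hcarrier (L2 lam)" "k \<in> hcarrier (L2 lam)" for h k
      using that L2.bounded_opsD(1)[OF gns_pi_bounded[OF lam]]
      by (subst zero) (simp add: op_scale_def L2.inner_scale)
    then show ?thesis
      using that by (auto simp: predual_def square_summable_def image_subset_iff)
  qed
  \<comment> \<open>Convergence is checked by induction over the generation of open sets from the
    subbasis, where \<open>predual_small\<close> settles the basic ones.\<close>
  have ev: "\<forall>\<^sub>F a in small_contractions lam. gns_pi lam (star a * a) \<in> U"
    if "generate_topology_on ?S U" "gns_pi lam 0 \<in> U" for U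
    using that
  proof induction
    case (Int U V)
    then show ?case
      by (auto intro: eventually_conj)
  next
    case (UN \<U>)
    then obtain U where "U \<in> \<U>" "gns_pi lam 0 \<in> U"
      by blast
    then have "\<forall>\<^sub>F a in small_contractions lam. gns_pi lam (star a * a) \<in> U"
      using UN by blast
    then show ?case
      by (rule eventually_mono) (use \<open>U \<in> \<U>\<close> in blast)
  next
    case (Basis U)
    then obtain \<omega> V where \<omega>: "\<omega> \<in> predual (L2 lam)" "open V" "U = {T \<in> Linf lam. \<omega> T \<in> V}"
      by blast
    have "0 \<in> V"
      using Basis(2) pred0[OF \<omega>(1)] by (simp add: \<omega>(3))
    have "\<forall>\<^sub>F a in small_contractions lam. \<omega> (gns_pi lam (star a * a)) \<in> V"
      by (rule topological_tendstoD[OF predual_small[OF K \<omega>(1)] \<omega>(2) \<open>0 \<in> V\<close>])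
    then show ?case
      by (rule eventually_mono) (simp add: \<omega>(3) gns_pi_Linf[OF lam])
  qed simp
  have ext: "\<phi> (gns_pi lam a) = \<rho> a" for a
    using \<phi>(1) by (simp add: Linf_extension_def)
  have "openin ?T {T \<in> topspace ?T. \<phi> T \<in> ball 0 (\<epsilon>\<^sup>2)}"
    using \<phi>(2) unfolding Linf_weak_star_continuous_def by (rule openin_continuous_map_preimage) simp
  moreover have "topspace ?T = Linf lam"
  proof -
    obtain \<omega> where "\<omega> \<in> predual (L2 lam)"
    proof -
      have "square_summable (L2 lam) (\<lambda>_. gns_rel lam `` {\<lambda>_. 0})"
        using gns_class_in_carrier[OF lam gns_cauchy_const[OF lam], of 0]
        by (auto simp: square_summable_def hnorm_L2_const[OF lam] gns_norm_zero[OF lam])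
      then show thesis
        using that unfolding predual_def by blast
    qed
    then have "Linf lam \<in> ?S"
      by (auto intro!: exI[of _ \<omega>] exI[of _ UNIV])
    then show ?thesis
      unfolding weak_star_topology_def topology_generated_by_topspace by blast
  qed
  ultimately have "generate_topology_on ?S {T \<in> Linf lam. \<phi> T \<in> ball 0 (\<epsilon>\<^sup>2)}"
    by (simp only: weak_star_topology_def openin_topology_generated_by_iff)
  then have "\<forall>\<^sub>F a in small_contractions lam. gns_pi lam (star a * a) \<in> {T \<in> Linf lam. \<phi> T \<in> ball 0 (\<epsilon>\<^sup>2)}"
    by (rule ev) (use \<epsilon> in \<open>simp add: gns_pi_Linf[OF lam] ext plf_zero[OF plf]\<close>)
  then have "\<forall>\<^sub>F a in small_contractions lam. gns_norm \<rho> a < \<epsilon>"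
  proof (rule eventually_mono)
    fix a assume "gns_pi lam (star a * a) \<in> {T \<in> Linf lam. \<phi> T \<in> ball 0 (\<epsilon>\<^sup>2)}"
    then have "cmod (of_real ((gns_norm \<rho> a)\<^sup>2)) < \<epsilon>\<^sup>2"
      unfolding plf_star_mult_self[OF plf, symmetric] by (simp add: ext)
    then have "(gns_norm \<rho> a)\<^sup>2 < \<epsilon>\<^sup>2"
      unfolding norm_of_real by simp
    then show "gns_norm \<rho> a < \<epsilon>"
      using \<epsilon> by (rule power2_less_imp_less[OF _ less_imp_le])
  qed
  then show "\<exists>\<delta>>0. \<forall>a. plf_contraction a \<and> gns_norm lam a < \<delta> \<longrightarrow> gns_norm \<rho> a < \<epsilon>"
    unfolding eventually_small_contractions .
qed

section \<open>Absolutely continuous functionals are weak* continuous\<close>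

definition vector_functional :: "(nat \<Rightarrow> 'a) set \<Rightarrow> 'a \<Rightarrow> complex" where
  "vector_functional \<eta> a = hinner (L2 lam) (gns_pi lam a \<eta>) \<eta>"

lemma vector_functional_LIMSEQ:
  assumes "Y \<in> gns_cauchy lam"
  shows "(\<lambda>n. lam (star (Y n) * a * Y n)) \<longlonglongrightarrow> vector_functional (gns_rel lam `` {Y}) a"
  using hinner_L2[OF lam gns_cauchy_mult[OF lam assms] assms]
  by (simp add: vector_functional_def gns_pi_class[OF lam assms] mult.assoc)

lemma is_plf_vector_functional:
  assumes "\<eta> \<in> hcarrier (L2 lam)"
  shows "is_plf (vector_functional \<eta>)"
proof -
  obtain Y where Y: "Y \<in> gns_cauchy lam" "\<eta> = gns_rel lam `` {Y}"
    using L2_cases[OF lam assms] by blast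
  show ?thesis
    unfolding Y(2) by (rule is_plf_limit[OF plf_compress[OF lam] vector_functional_LIMSEQ[OF Y(1)]])
qed

lemma vector_functional_one:
  assumes "\<eta> \<in> hcarrier (L2 lam)"
  shows "vector_functional \<eta> 1 = of_real ((hnorm (L2 lam) \<eta>)\<^sup>2)"
  using assms by (simp add: vector_functional_def gns_pi_ops(4)[OF lam] L2.id_op_def L2.inner_self)

text \<open>Writing \<open>m = \<langle>D \<cdot> \<xi>, \<xi>\<rangle>\<close> with \<open>0 \<le> D \<le> 1\<close> in the commutant, \<open>\<eta> = D \<xi>\<close> and the lemma says that
  \<open>D\<^sup>2 \<le> D\<close>. Iterating \<open>D \<mapsto> D - D\<^sup>2\<close> expresses \<open>m\<close> as a series of vector functionals
  without taking the square root of \<open>D\<close>.\<close>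

lemma dominated_vector_part:
  assumes m: "is_plf m" "m \<preceq>\<^sub>+ lam"
  obtains \<eta> where "\<eta> \<in> hcarrier (L2 lam)" "vector_functional \<eta> \<preceq>\<^sub>+ m"
    "Re (m 1) \<le> gns_norm lam 1 * hnorm (L2 lam) \<eta>"
proof -
  have bound: "cmod (m a) \<le> gns_norm m 1 * gns_norm lam a" for a
    using plf_norm_le[OF m(1), of a] mult_left_mono[OF plf_le_gns_norm[OF m(2), of a] gns_norm_nonneg[OF m(1), of 1]]
    by (rule order_trans)
  obtain Y where Y: "Y \<in> gns_cauchy lam" "\<And>a. (\<lambda>n. lam (star (Y n) * a)) \<longlonglongrightarrow> m a"
    using plf_Riesz[OF lam plf_add[OF m(1)] plf_scaleC[OF m(1)] bound] by blast
  let ?\<eta> = "gns_rel lam `` {Y}"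
  have \<eta>: "?\<eta> \<in> hcarrier (L2 lam)"
    by (rule gns_class_in_carrier[OF lam Y(1)])
  obtain B where B: "0 < B" "\<And>n. gns_norm lam (Y n) \<le> B"
    using gns_cauchy_bounded[OF lam Y(1)] by blast
  have "Re (vector_functional ?\<eta> (star a * a)) \<le> Re (m (star a * a))" for a
  proof -
    let ?l = "hnorm (L2 lam) (gns_rel lam `` {\<lambda>n. a * Y n})"
    have l: "(\<lambda>n. gns_norm lam (a * Y n)) \<longlonglongrightarrow> ?l"
      by (rule hnorm_L2[OF lam gns_cauchy_mult[OF lam Y(1)]])
    have l0: "0 \<le> ?l"
      by (rule L2.hnorm_nonneg[OF gns_class_in_carrier[OF lam gns_cauchy_mult[OF lam Y(1)]]])
    have sq: "Re (lam (star (Y n) * (star a * a) * Y n)) = (gns_norm lam (a * Y n))\<^sup>2" for n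
      by (simp add: gns_norm_sq[OF lam] star_simps mult.assoc)
    have vec: "Re (vector_functional ?\<eta> (star a * a)) = ?l\<^sup>2"
      using tendsto_Re[OF vector_functional_LIMSEQ[OF Y(1), of "star a * a"]] tendsto_power[OF l, of 2]
      unfolding sq by (rule LIMSEQ_unique)
    define w where "w n = star a * a * Y n" for n
    have "gns_norm lam (w n) \<le> norm (star a * a) * B" for n
      using gns_norm_mult_le[OF lam, of "star a * a" "Y n"] mult_left_mono[OF B(2)[of n] norm_ge_zero[of "star a * a"]]
      unfolding w_def by linarith
    then have lim0: "(\<lambda>n. lam (star (Y n) * w n) - m (w n)) \<longlonglongrightarrow> 0"
      by (rule gns_cauchy_uniform_lim[OF lam Y])
    \<comment> \<open>In the limit \<open>Y n\<close> becomes the vector that represents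
      \<open>m\<close>, so \<open>?l\<^sup>2\<close> is the limit of
      \<open>m (star a * (a * Y n))\<close>. Cauchy-Schwarz for \<open>m\<close> followed by
      \<open>m \<preceq>\<^sub>+ lam\<close> bounds this.\<close>
    have "?l\<^sup>2 \<le> gns_norm m a * ?l"
    proof (rule LIMSEQ_le)
      show "(\<lambda>n. (gns_norm lam (a * Y n))\<^sup>2) \<longlonglongrightarrow> ?l\<^sup>2"
        by (intro tendsto_intros l)
      have "(\<lambda>n. Re (lam (star (Y n) * w n) - m (w n)) + gns_norm m a * gns_norm lam (a * Y n))
          \<longlonglongrightarrow> Re 0 + gns_norm m a * ?l"
        by (intro tendsto_intros l lim0)
      then show "(\<lambda>n. Re (lam (star (Y n) * w n) - m (w n)) + gns_norm m a * gns_norm lam (a * Y n))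
          \<longlonglongrightarrow> gns_norm m a * ?l"
        by simp
      have "(gns_norm lam (a * Y n))\<^sup>2
          \<le> Re (lam (star (Y n) * w n) - m (w n)) + gns_norm m a * gns_norm lam (a * Y n)" for n
      proof -
        have "Re (m (w n)) \<le> gns_norm m a * gns_norm m (a * Y n)"
          unfolding w_def mult.assoc
          by (rule order_trans[OF complex_Re_le_cmod plf_Cauchy_Schwarz[OF m(1)]])
        also have "\<dots> \<le> gns_norm m a * gns_norm lam (a * Y n)"
          by (intro mult_left_mono plf_le_gns_norm m gns_norm_nonneg)
        finally show ?thesis
          using sq[of n] by (simp add: w_def mult.assoc)
      qed
      then show "\<exists>N. \<forall>n\<ge>N. (gns_norm lam (a * Y n))\<^sup>2
          \<le> Re (lam (star (Y n) * w n) - m (w n)) + gns_norm m a * gns_norm lam (a * Y n)"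
        by blast
    qed
    then have "?l \<le> gns_norm m a"
      using l0 gns_norm_nonneg[OF m(1), of a] by (cases "?l = 0") (auto simp: power2_eq_square)
    then show ?thesis
      unfolding vec using power_mono[of ?l "gns_norm m a" 2] l0 by (simp add: gns_norm_sq[OF m(1)])
  qed
  then have le: "vector_functional ?\<eta> \<preceq>\<^sub>+ m"
    by (intro plf_leI m is_plf_vector_functional \<eta>)
  have one: "Re (m 1) \<le> gns_norm lam 1 * hnorm (L2 lam) ?\<eta>"
  proof (rule LIMSEQ_le)
    show "(\<lambda>n. Re (lam (star (Y n) * 1))) \<longlonglongrightarrow> Re (m 1)"
      by (intro tendsto_Re Y)
    show "(\<lambda>n. gns_norm lam 1 * gns_norm lam (Y n)) \<longlonglongrightarrow> gns_norm lam 1 * hnorm (L2 lam) ?\<eta>"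
      by (intro tendsto_intros hnorm_L2 lam Y)
    have "Re (lam (star (Y n) * 1)) \<le> gns_norm lam 1 * gns_norm lam (Y n)" for n
      using order_trans[OF complex_Re_le_cmod plf_Cauchy_Schwarz[OF lam, of "Y n" 1]] by (simp add: mult.commute)
    then show "\<exists>N. \<forall>n\<ge>N. Re (lam (star (Y n) * 1)) \<le> gns_norm lam 1 * gns_norm lam (Y n)"
      by blast
  qed
  from \<eta> le one show thesis
    by (rule that)
qed

text \<open>Vector functionals are split off one after another. Telescoping at \<open>1\<close>
  makes the squared norms of the \<open>\<eta> k\<close> summable, so these norms tend to zero;
  since they bound the remainders at \<open>1\<close>, the remainders vanish in the limit.\<close>

lemma dominated_vector_series:
  assumes m: "is_plf m" "m \<preceq>\<^sub>+ lam"
  obtains \<eta> where "\<And>k. \<eta> k \<in> hcarrier (L2 lam)" "\<And>a. (\<lambda>k. vector_functional (\<eta> k) a) sums m a"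
proof -
  have "\<exists>\<eta>. \<eta> \<in> hcarrier (L2 lam) \<and> vector_functional \<eta> \<preceq>\<^sub>+ m \<and> Re (m 1) \<le> gns_norm lam 1 * hnorm (L2 lam) \<eta>"
    if "is_plf m" "m \<preceq>\<^sub>+ lam" for m
    using dominated_vector_part[OF that] by metis
  then obtain E where E: "\<And>m. is_plf m \<Longrightarrow> m \<preceq>\<^sub>+ lam \<Longrightarrow> E m \<in> hcarrier (L2 lam)"
    "\<And>m. is_plf m \<Longrightarrow> m \<preceq>\<^sub>+ lam \<Longrightarrow> vector_functional (E m) \<preceq>\<^sub>+ m"
    "\<And>m. is_plf m \<Longrightarrow> m \<preceq>\<^sub>+ lam \<Longrightarrow> Re (m 1) \<le> gns_norm lam 1 * hnorm (L2 lam) (E m)"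
    by metis
  define r where "r = rec_nat m (\<lambda>_ m'. (\<lambda>a. m' a - vector_functional (E m') a))"
  have r: "r 0 = m" "r (Suc k) = (\<lambda>a. r k a - vector_functional (E (r k)) a)" for k
    by (auto simp: r_def)
  have inv: "is_plf (r k) \<and> r k \<preceq>\<^sub>+ lam" for k
  proof (induction k)
    case (Suc k)
    have le: "vector_functional (E (r k)) \<preceq>\<^sub>+ r k"
      using E(2) Suc by blast
    then have "is_plf (r (Suc k))"
      by (simp add: r plf_le_def)
    moreover have "r (Suc k) \<preceq>\<^sub>+ r k"
      using is_plf_vector_functional[OF E(1)] Suc by (simp add: r plf_le_def)
    ultimately show ?case
      using Suc plf_le_trans by blast
  qed (simp add: r m)
  define \<eta> where "\<eta> k = E (r k)" for k
  have \<eta>: "\<eta> k \<in> hcarrier (L2 lam)" "Re (r k 1) \<le> gns_norm lam 1 * hnorm (L2 lam) (\<eta> k)" for k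
    unfolding \<eta>_def using E inv by blast+
  have partial: "(\<Sum>k<n. vector_functional (\<eta> k) a) = m a - r n a" for n a
    by (induction n) (auto simp: r \<eta>_def)
  have "(\<Sum>k<n. (hnorm (L2 lam) (\<eta> k))\<^sup>2) \<le> Re (m 1)" for n
  proof -
    have "complex_of_real (\<Sum>k<n. (hnorm (L2 lam) (\<eta> k))\<^sup>2) = m 1 - r n 1"
      using partial[of 1 n] vector_functional_one[OF \<eta>(1)] by simp
    then have "(\<Sum>k<n. (hnorm (L2 lam) (\<eta> k))\<^sup>2) = Re (m 1) - Re (r n 1)"
      by (metis Re_complex_of_real minus_complex.simps(1))
    then show ?thesis
      using plf_Re_pos[of "r n" 1] inv by simp
  qed
  then have "summable (\<lambda>k. (hnorm (L2 lam) (\<eta> k))\<^sup>2)"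
    by (intro summableI_nonneg_bounded) auto
  then have "(\<lambda>k. sqrt ((hnorm (L2 lam) (\<eta> k))\<^sup>2)) \<longlonglongrightarrow> sqrt 0"
    by (intro tendsto_real_sqrt summable_LIMSEQ_zero)
  then have "(\<lambda>k. hnorm (L2 lam) (\<eta> k)) \<longlonglongrightarrow> 0"
    using L2.hnorm_nonneg[OF \<eta>(1)] by simp
  then have lim: "(\<lambda>k. gns_norm lam 1 * hnorm (L2 lam) (\<eta> k) * norm a) \<longlonglongrightarrow> gns_norm lam 1 * 0 * norm a" for a :: 'a
    by (intro tendsto_intros)
  have "(\<lambda>n. r n a) \<longlonglongrightarrow> 0" for a
  proof (rule tendsto_null_norm_le[OF lim])
    fix k
    show "norm (r k a) \<le> gns_norm lam 1 * hnorm (L2 lam) (\<eta> k) * norm a"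
      using plf_bound[of "r k" a] inv[of k] mult_right_mono[OF \<eta>(2)[of k] norm_ge_zero[of a]] by simp
  qed simp
  then have "(\<lambda>k. vector_functional (\<eta> k) a) sums m a" for a
    unfolding sums_def partial using tendsto_diff[OF tendsto_const[of "m a"]] by fastforce
  then show thesis
    using that \<eta>(1) by blast
qed

lemma vector_functional_scale:
  assumes "\<eta> \<in> hcarrier (L2 lam)" "0 \<le> t"
  shows "vector_functional (hscale (L2 lam) (of_real (sqrt t)) \<eta>) a = of_real t * vector_functional \<eta> a"
proof -
  have "complex_of_real (sqrt t) * complex_of_real (sqrt t) = of_real t"
    using assms(2) by (simp flip: of_real_mult)
  then show ?thesis
    using assms(1) L2.bounded_opsD[OF gns_pi_bounded[OF lam]]
    by (simp add: vector_functional_def L2.inner_scale L2.inner_scale_right L2.scale_closed mult.assoc[symmetric])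
qed

lemma dominated_vector_series_scaled:
  assumes m: "is_plf m" "m \<preceq>\<^sub>+ (\<lambda>a. complex_of_real t * lam a)" and t: "0 < t"
  shows "\<exists>\<eta>. (\<forall>k. \<eta> k \<in> hcarrier (L2 lam)) \<and> (\<forall>a. (\<lambda>k. vector_functional (\<eta> k) a) sums m a)"
proof -
  define m' where "m' = (\<lambda>a. complex_of_real (1 / t) * m a)"
  have "complex_of_real (1 / t) * (complex_of_real t * x) = x" for x
    using t by simp
  then have "m' \<preceq>\<^sub>+ lam"
    using plf_le_times[OF m(2), of "1 / t"] t unfolding m'_def by simp
  moreover have "is_plf m'"
    unfolding m'_def using t by (intro is_plf_times m) simp
  ultimately obtain \<eta> where \<eta>: "\<And>k. \<eta> k \<in> hcarrier (L2 lam)" "\<And>a. (\<lambda>k. vector_functional (\<eta> k) a) sums m' a"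
    using dominated_vector_series by blast
  have "(\<lambda>k. vector_functional (hscale (L2 lam) (of_real (sqrt t)) (\<eta> k)) a) sums m a" for a
    using sums_mult[OF \<eta>(2)[of a], of "of_real t"] t by (simp add: vector_functional_scale \<eta>(1) m'_def)
  then show ?thesis
    by (intro exI[of _ "\<lambda>k. hscale (L2 lam) (of_real (sqrt t)) (\<eta> k)"])
      (simp add: \<eta>(1) L2.scale_closed)
qed

text \<open>The increments of the approximating sequence are each dominated by a multiple of
  \<open>lam\<close>, hence each is a series of vector functionals. By positivity every value is
  bounded by the value at \<open>1\<close> times the norm, so the double series converges absolutely
  and can be enumerated by one index, as membership in the predual demands.\<close>

lemma AC_vector_series:
  assumes "\<rho> \<in> AC lam"
  obtains \<eta> where "\<And>k. \<eta> k \<in> hcarrier (L2 lam)" "\<And>a. (\<lambda>k. vector_functional (\<eta> k) a) sums \<rho> a"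
proof -
  obtain m t where m: "\<And>n. is_plf (m n)" "\<And>n. m n \<preceq>\<^sub>+ m (Suc n)" "\<And>a. (\<lambda>n. m n a) \<longlonglongrightarrow> \<rho> a"
    "\<And>n. 0 < t n" "\<And>n. m n \<preceq>\<^sub>+ (\<lambda>a. complex_of_real (t n) * lam a)"
    using ACE[OF assms] by metis
  define d where "d n = (case n of 0 \<Rightarrow> m 0 | Suc k \<Rightarrow> (\<lambda>a. m (Suc k) a - m k a))" for n
  have d: "is_plf (d n)" "d n \<preceq>\<^sub>+ (\<lambda>a. complex_of_real (t n) * lam a)" for n
  proof -
    show plf: "is_plf (d n)"
      using m(1) m(2) by (cases n) (simp_all add: d_def plf_le_def)
    have "d n \<preceq>\<^sub>+ m n"
      using m(1) by (cases n) (simp_all add: d_def plf_le_refl, simp add: plf_le_def)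
    then show "d n \<preceq>\<^sub>+ (\<lambda>a. complex_of_real (t n) * lam a)"
      using m(5) by (rule plf_le_trans)
  qed
  have "(\<Sum>n<Suc N. d n a) = m N a" for N a
    by (induction N) (simp_all add: d_def)
  then have d_sums: "(\<lambda>n. d n a) sums \<rho> a" for a
    using m(3)[of a] unfolding sums_def by (subst filterlim_sequentially_Suc[symmetric]) simp
  obtain \<eta> where \<eta>: "\<And>n k. \<eta> n k \<in> hcarrier (L2 lam)" "\<And>n a. (\<lambda>k. vector_functional (\<eta> n k) a) sums d n a"
    using dominated_vector_series_scaled[OF d m(4)] by metis
  have plf_has_sum: "((\<lambda>k. g k a) has_sum s a) (UNIV :: nat set)"
    if g: "\<And>k. is_plf (g k)" "\<And>a. (\<lambda>k. g k a) sums s a" for g :: "nat \<Rightarrow> 'a \<Rightarrow> complex" and s a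
  proof (rule norm_summable_imp_has_sum[OF _ g(2)])
    have "summable (\<lambda>k. Re (g k 1) * norm a)"
      using sums_Re[OF g(2)[of 1]] by (intro summable_mult2) (auto simp: sums_iff)
    then show "summable (\<lambda>k. norm (g k a))"
      by (rule summable_comparison_test[rotated]) (use plf_bound[OF g(1)] in auto)
  qed
  define f where "f a p = vector_functional (\<eta> (fst p) (snd p)) a" for a p
  have f_plf: "is_plf (\<lambda>a. f a p)" for p
    unfolding f_def using is_plf_vector_functional[OF \<eta>(1)] by simp
  have "(f a has_sum \<rho> a) (UNIV \<times> UNIV)" for a
  proof (rule has_sum_SigmaI)
    show "((\<lambda>k. f a (n, k)) has_sum d n a) UNIV" for n
      unfolding f_def fst_conv snd_conv
      by (rule plf_has_sum[of "\<lambda>k. vector_functional (\<eta> n k)" "d n"]) (intro is_plf_vector_functional \<eta>)+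
    show "((\<lambda>n. d n a) has_sum \<rho> a) UNIV"
      by (rule plf_has_sum[of d \<rho>]) (intro d d_sums)+
    have one: "(\<lambda>p. Re (f 1 p)) summable_on UNIV \<times> UNIV"
    proof (rule summable_on_SigmaI)
      show "((\<lambda>k. Re (f 1 (n, k))) has_sum Re (d n 1)) UNIV" for n
        using sums_Re[OF \<eta>(2)[of n 1]] plf_Re_pos[OF f_plf, where a = 1]
        by (intro sums_nonneg_imp_has_sum) (auto simp: f_def)
      show "(\<lambda>n. Re (d n 1)) summable_on UNIV"
        using plf_Re_pos[OF d(1), where a = 1]
        by (intro has_sum_imp_summable[OF sums_nonneg_imp_has_sum[OF sums_Re[OF d_sums[of 1]]]]) simp
    qed (use plf_Re_pos[OF f_plf, where a = 1] in auto)
    have "(\<lambda>p. norm (f a p)) summable_on UNIV \<times> UNIV"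
      by (rule Infinite_Sum.abs_summable_on_comparison_test'[OF summable_on_cmult_left[OF one, of "norm a"]])
        (rule plf_bound[OF f_plf])
    then show "f a summable_on UNIV \<times> UNIV"
      by (rule abs_summable_summable)
  qed
  then have "((\<lambda>i. f a (prod_decode i)) has_sum \<rho> a) UNIV" for a
    using has_sum_reindex_bij_betw[OF bij_prod_decode, of "f a"] by simp
  then have "(\<lambda>i. vector_functional (\<eta> (fst (prod_decode i)) (snd (prod_decode i))) a) sums \<rho> a" for a
    using has_sum_imp_sums unfolding f_def by blast
  then show thesis
    using that[of "\<lambda>i. \<eta> (fst (prod_decode i)) (snd (prod_decode i))"] \<eta>(1) by blast
qed

text \<open>The vector series for \<open>\<rho>\<close> makes sense for every operator in
  \<open>Linf lam\<close>. Its value at \<open>1\<close> is the sum of the squared norms of the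
  \<open>\<eta> k\<close>, so these vectors are square summable and the extension is itself an
  element of the predual.\<close>

lemma AC_imp_weak_star_cont:
  assumes "\<rho> \<in> AC lam"
  shows "weak_star_cont lam \<rho>"
proof -
  let ?H = "L2 lam"
  obtain \<eta> where \<eta>: "\<And>k. \<eta> k \<in> hcarrier ?H" "\<And>a. (\<lambda>k. vector_functional (\<eta> k) a) sums \<rho> a"
    using AC_vector_series[OF assms] by blast
  have summ: "summable (\<lambda>k. (hnorm ?H (\<eta> k))\<^sup>2)"
    using sums_Re[OF \<eta>(2)[of 1]] by (simp add: vector_functional_one \<eta>(1) sums_iff)
  define \<phi> where "\<phi> T = (\<Sum>k. hinner ?H (T (\<eta> k)) (\<eta> k))" for T
  have T_summable: "summable (\<lambda>k. hinner ?H (T (\<eta> k)) (\<eta> k))" if T: "T \<in> Linf lam" for T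
  proof -
    have Tb: "T \<in> bounded_ops ?H"
      using T Linf_bounded[OF lam] by blast
    obtain K where K: "\<And>h. h \<in> hcarrier ?H \<Longrightarrow> hnorm ?H (T h) \<le> K * hnorm ?H h"
      using L2.bounded_ops_bound[OF Tb] by metis
    have "norm (hinner ?H (T (\<eta> k)) (\<eta> k)) \<le> K * (hnorm ?H (\<eta> k))\<^sup>2" for k
      using L2.inner_CS[OF L2.bounded_opsD(1)[OF Tb \<eta>(1)] \<eta>(1), of k k]
        mult_right_mono[OF K[OF \<eta>(1)] L2.hnorm_nonneg[OF \<eta>(1)], of k k]
      by (simp add: power2_eq_square)
    then show ?thesis
      by (intro summable_comparison_test[OF _ summable_mult[OF summ, of K]]) blast
  qed
  have "Linf_plf lam \<phi>"
    unfolding Linf_plf_def op_plf_def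
  proof (intro conjI ballI allI impI)
    fix S T c assume T: "T \<in> Linf lam"
    then have Tb: "T \<in> bounded_ops ?H"
      using Linf_bounded[OF lam] by blast
    show "\<phi> (op_scale ?H c T) = c * \<phi> T"
      using suminf_mult[OF T_summable[OF T], of c] L2.bounded_opsD(1)[OF Tb]
      by (simp add: \<phi>_def op_scale_def \<eta>(1) L2.inner_scale)
    assume S: "S \<in> Linf lam"
    then have Sb: "S \<in> bounded_ops ?H"
      using Linf_bounded[OF lam] by blast
    show "\<phi> (op_plus ?H S T) = \<phi> S + \<phi> T"
      using suminf_add[OF T_summable[OF S] T_summable[OF T]] L2.bounded_opsD(1)[OF Tb] L2.bounded_opsD(1)[OF Sb]
      by (simp add: \<phi>_def op_plus_def \<eta>(1) L2.inner_plus)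
    assume adj: "is_adjoint ?H S T"
    have eq: "hinner ?H (compose (hcarrier ?H) S T (\<eta> k)) (\<eta> k) = of_real ((hnorm ?H (T (\<eta> k)))\<^sup>2)" for k
      using adj \<eta>(1)[of k] L2.bounded_opsD(1)[OF Tb] by (simp add: compose_def is_adjoint_def L2.inner_self)
    obtain K where K: "0 \<le> K" "\<And>h. h \<in> hcarrier ?H \<Longrightarrow> hnorm ?H (T h) \<le> K * hnorm ?H h"
      using L2.bounded_ops_bound[OF Tb] by metis
    have "norm ((hnorm ?H (T (\<eta> k)))\<^sup>2) \<le> K\<^sup>2 * (hnorm ?H (\<eta> k))\<^sup>2" for k
      using power_mono[OF K(2)[OF \<eta>(1)[of k]] L2.hnorm_nonneg[OF L2.bounded_opsD(1)[OF Tb \<eta>(1)]], of 2]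
      by (simp add: power_mult_distrib)
    then have "summable (\<lambda>k. (hnorm ?H (T (\<eta> k)))\<^sup>2)"
      by (intro summable_comparison_test[OF _ summable_mult[OF summ, of "K\<^sup>2"]]) blast
    then have "\<phi> (compose (hcarrier ?H) S T) = of_real (\<Sum>k. (hnorm ?H (T (\<eta> k)))\<^sup>2)"
      and "0 \<le> (\<Sum>k. (hnorm ?H (T (\<eta> k)))\<^sup>2)"
      unfolding \<phi>_def eq by (auto intro: suminf_nonneg simp: suminf_of_real)
    then show "\<phi> (compose (hcarrier ?H) S T) \<in> \<real>\<^sub>\<ge>\<^sub>0"
      by (simp only: nonneg_Reals_of_real_iff)
  qed
  moreover have "\<phi> (gns_pi lam a) = \<rho> a" for a
    using \<eta>(2)[of a] by (simp add: \<phi>_def vector_functional_def sums_iff)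
  moreover have "Linf_weak_star_continuous lam \<phi>"
  proof -
    have sq: "square_summable ?H \<eta>"
      using \<eta>(1) summ by (auto simp: square_summable_def)
    have \<phi>_eq: "\<phi> = (\<lambda>T. \<Sum>k. hinner ?H (T (\<eta> k)) (\<eta> k))"
      by (simp add: \<phi>_def fun_eq_iff)
    have pred: "\<phi> \<in> predual ?H"
      unfolding predual_def mem_Collect_eq by (intro exI[of _ \<eta>] conjI \<phi>_eq sq)
    let ?S = "{{T \<in> Linf lam. \<omega> T \<in> U} | \<omega> U. \<omega> \<in> predual ?H \<and> open U}"
    have "Linf lam \<in> ?S"
      using pred by (auto intro!: exI[of _ \<phi>] exI[of _ UNIV])
    then have "topspace (topology_generated_by ?S) = Linf lam"
      unfolding topology_generated_by_topspace by blast
    moreover have "openin (topology_generated_by ?S) {T \<in> Linf lam. \<phi> T \<in> U}" if "open U" for U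
      using that pred by (intro topology_generated_by_Basis) blast
    ultimately show ?thesis
      unfolding Linf_weak_star_continuous_def weak_star_topology_def continuous_map_def by simp
  qed
  ultimately show ?thesis
    using ACD_plf[OF assms] ACD_null[OF assms] unfolding weak_star_cont_def Linf_extension_def by blast
qed

end

section \<open>Additivity of the decompositions\<close>

locale star_bounded_plf =
  fixes lam :: "'a::unital_cstar_algebra \<Rightarrow> complex" and K :: real
  assumes lam: "is_plf lam" and K_pos: "0 < K"
    and star_bound: "\<And>a. gns_norm lam (star a) \<le> K * gns_norm lam a"
begin

lemma AC_iff_abs_cont:
  "\<rho> \<in> AC lam \<longleftrightarrow> is_plf \<rho> \<and> plf_null lam \<subseteq> plf_null \<rho> \<and> abs_cont lam \<rho>"
  using abs_cont_imp_AC[OF lam _ _ less_imp_le[OF K_pos] star_bound] AC_imp_abs_cont[OF lam]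
    ACD_plf ACD_null by blast

lemma hereditary_AC: "hereditary (AC lam)"
proof (unfold hereditary_def, intro ballI allI impI, elim conjE)
  fix \<phi> \<psi>
  assume \<phi>: "\<phi> \<in> AC lam" and \<psi>: "is_plf \<psi>" "\<psi> \<preceq>\<^sub>+ \<phi>"
  have "abs_cont lam \<psi>"
    using abs_cont_mono[OF \<psi>(2)] AC_imp_abs_cont[OF lam \<phi>] by blast
  moreover have "plf_null lam \<subseteq> plf_null \<psi>"
    using ACD_null[OF \<phi>] plf_null_mono[OF \<psi>(1) ACD_plf[OF \<phi>] \<psi>(2)] by blast
  ultimately show "\<psi> \<in> AC lam"
    using \<psi>(1) by (simp add: AC_iff_abs_cont)
qed

lemma positive_cone_AC: "positive_cone (AC lam)"
  unfolding positive_cone_def using ACD_plf zero_in_AC[OF lam] AC_plus AC_times[OF _ lam] by blast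

lemma positive_cone_SG: "positive_cone (SG lam)"
  unfolding positive_cone_def using SGD_plf zero_in_SG SG_plus[OF lam K_pos star_bound] SG_times by blast

lemma weak_star_cont_iff_AC: "weak_star_cont lam \<rho> \<longleftrightarrow> \<rho> \<in> AC lam"
proof
  assume \<rho>: "weak_star_cont lam \<rho>"
  then show "\<rho> \<in> AC lam"
    using weak_star_cont_imp_abs_cont[OF lam K_pos star_bound \<rho>]
    by (simp add: AC_iff_abs_cont weak_star_cont_def)
qed (rule AC_imp_weak_star_cont[OF lam])

text \<open>The difference of \<open>ac_part lam \<mu>\<close> and \<open>\<alpha>\<close> is below
  \<open>ac_part lam \<mu>\<close> and below \<open>\<beta>\<close>. Heredity of both classes makes
  it absolutely continuous and singular, hence zero.\<close>

lemma AC_SG_decomposition_unique: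
  assumes "\<mu> = (\<lambda>a. \<alpha> a + \<beta> a)" "\<alpha> \<in> AC lam" "\<beta> \<in> SG lam"
  shows "ac_part lam \<mu> = \<alpha>" "s_part lam \<mu> = \<beta>"
proof -
  note plfs = ACD_plf[OF assms(2)] SGD_plf[OF assms(3)]
  have \<mu>: "is_plf \<mu>" "plf_null lam \<subseteq> plf_null \<mu>"
    unfolding assms(1) using plfs plf_null_plus[OF plfs] ACD_null[OF assms(2)] SGD_null[OF assms(3)]
    by (blast intro: is_plf_plus)+
  note ac = ac_part_AC[OF \<mu>(1) lam \<mu>(2)] ac_part_le[OF \<mu>(1) lam \<mu>(2)]
  have "\<alpha> \<preceq>\<^sub>+ \<mu>"
    unfolding assms(1) by (rule plf_le_add_left[OF plfs(2)])
  then have le: "\<alpha> \<preceq>\<^sub>+ ac_part lam \<mu>"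
    by (rule ac_part_greatest[OF \<mu>(1) lam \<mu>(2) assms(2)])
  let ?\<rho> = "\<lambda>a. ac_part lam \<mu> a - \<alpha> a"
  have \<rho>: "is_plf ?\<rho>"
    using le by (simp add: plf_le_def)
  have "?\<rho> \<preceq>\<^sub>+ ac_part lam \<mu>"
    using plfs(1) by (simp add: plf_le_def)
  then have "?\<rho> \<in> AC lam"
    using hereditary_AC ac(1) \<rho> unfolding hereditary_def by blast
  moreover have "?\<rho> \<preceq>\<^sub>+ \<beta>"
    using ac(2) unfolding assms(1) plf_le_def by (simp add: algebra_simps)
  then have "?\<rho> \<in> SG lam"
    using hereditary_SG assms(3) \<rho> unfolding hereditary_def by blast
  ultimately have "?\<rho> = (\<lambda>_. 0)"
    by (rule AC_SG_eq_zero[OF lam])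
  then show "ac_part lam \<mu> = \<alpha>"
    by (auto simp: fun_eq_iff)
  then show "s_part lam \<mu> = \<beta>"
    by (simp add: s_part_def assms(1))
qed

lemma ac_s_part_plus:
  assumes "is_plf \<mu>" "is_plf \<nu>" "plf_null lam \<subseteq> plf_null \<mu>" "plf_null lam \<subseteq> plf_null \<nu>"
  shows "ac_part lam (\<lambda>a. \<mu> a + \<nu> a) = (\<lambda>a. ac_part lam \<mu> a + ac_part lam \<nu> a)"
    and "s_part lam (\<lambda>a. \<mu> a + \<nu> a) = (\<lambda>a. s_part lam \<mu> a + s_part lam \<nu> a)"
proof -
  have "(\<lambda>a. \<mu> a + \<nu> a) = (\<lambda>a. ac_part lam \<mu> a + ac_part lam \<nu> a + (s_part lam \<mu> a + s_part lam \<nu> a))"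
    by (simp add: s_part_def)
  note AC_SG_decomposition_unique[OF this
      AC_plus[OF ac_part_AC[OF assms(1) lam assms(3)] ac_part_AC[OF assms(2) lam assms(4)]]
      SG_plus[OF lam K_pos star_bound s_part_SG[OF assms(1) lam assms(3)] s_part_SG[OF assms(2) lam assms(4)]]]
  then show "ac_part lam (\<lambda>a. \<mu> a + \<nu> a) = (\<lambda>a. ac_part lam \<mu> a + ac_part lam \<nu> a)"
    "s_part lam (\<lambda>a. \<mu> a + \<nu> a) = (\<lambda>a. s_part lam \<mu> a + s_part lam \<nu> a)"
    by blast+
qed

text \<open>Additivity applied to \<open>\<nu> = \<mu> + (\<nu> - \<mu>)\<close>: the parts of the
  difference are positive.\<close>

lemma ac_s_part_mono:
  assumes "is_plf \<mu>" "is_plf \<nu>" "plf_null lam \<subseteq> plf_null \<mu>" "plf_null lam \<subseteq> plf_null \<nu>" "\<mu> \<preceq>\<^sub>+ \<nu>"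
  shows "ac_part lam \<mu> \<preceq>\<^sub>+ ac_part lam \<nu>" "s_part lam \<mu> \<preceq>\<^sub>+ s_part lam \<nu>"
proof -
  let ?d = "\<lambda>a. \<nu> a - \<mu> a"
  have d: "is_plf ?d"
    using assms(5) by (simp add: plf_le_def)
  have "?d \<preceq>\<^sub>+ \<nu>"
    using assms(1) by (simp add: plf_le_def)
  then have null: "plf_null lam \<subseteq> plf_null ?d"
    using plf_null_mono[OF d assms(2)] assms(4) by blast
  have eq: "(\<lambda>a. \<mu> a + ?d a) = \<nu>"
    by simp
  have "is_plf (ac_part lam ?d)" "is_plf (s_part lam ?d)"
    using ACD_plf[OF ac_part_AC[OF d lam null]] SGD_plf[OF s_part_SG[OF d lam null]] .
  then show "ac_part lam \<mu> \<preceq>\<^sub>+ ac_part lam \<nu>" "s_part lam \<mu> \<preceq>\<^sub>+ s_part lam \<nu>"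
    using ac_s_part_plus[OF assms(1) d assms(3) null] plf_le_add_left unfolding eq by metis+
qed

text \<open>A weak* continuous functional below an extension of the singular part restricts to one
  that is both singular and absolutely continuous. The restriction is zero, and by
  \<open>Linf_plf_eq_zero\<close> so is the functional itself.\<close>

lemma s_part_weak_star_sing:
  assumes \<mu>: "is_plf \<mu>" "plf_null lam \<subseteq> plf_null \<mu>"
  shows "weak_star_sing lam (s_part lam \<mu>)"
proof -
  have SG: "s_part lam \<mu> \<in> SG lam"
    by (rule s_part_SG[OF \<mu>(1) lam \<mu>(2)])
  have "False"
    if \<phi>: "Linf_extension lam (s_part lam \<mu>) \<phi>" and \<omega>: "Linf_plf lam \<omega>" "Linf_weak_star_continuous lam \<omega>"
      "T \<in> Linf lam" "\<omega> T \<noteq> 0" and diff: "Linf_plf lam (\<lambda>T. \<phi> T - \<omega> T)" for \<phi> \<omega> T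
  proof -
    define \<rho> where "\<rho> = (\<lambda>a. \<omega> (gns_pi lam a))"
    have \<rho>: "is_plf \<rho>"
      unfolding \<rho>_def by (rule Linf_plf_restrict[OF lam \<omega>(1)])
    have le: "\<rho> \<preceq>\<^sub>+ s_part lam \<mu>"
      using Linf_plf_restrict[OF lam diff] \<phi> by (simp add: plf_le_def \<rho>_def Linf_extension_def)
    then have "\<rho> \<in> SG lam"
      using hereditary_SG SG \<rho> unfolding hereditary_def by blast
    moreover have "weak_star_cont lam \<rho>"
      using \<rho> SGD_null[OF calculation] \<omega> unfolding weak_star_cont_def Linf_extension_def \<rho>_def by blast
    then have "\<rho> \<in> AC lam"
      by (simp add: weak_star_cont_iff_AC)
    ultimately have "\<rho> = (\<lambda>_. 0)"
      using AC_SG_eq_zero[OF lam] by blast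
    then have "\<omega> (gns_pi lam 1) = 0"
      unfolding \<rho>_def by (rule fun_cong)
    then show False
      using Linf_plf_eq_zero[OF lam \<omega>(1) _ \<omega>(3)] \<omega>(4) by blast
  qed
  then show ?thesis
    using SGD_plf[OF SG] SGD_null[OF SG] unfolding weak_star_sing_def by blast
qed

text \<open>Since weak* continuity and absolute continuity coincide, both decompositions have the
  same maximality property. Existence and uniqueness in one statement let the definite descriptions
  \<open>wc_part\<close> and \<open>ws_part\<close> be evaluated.\<close>

lemma weak_star_decomposition_iff:
  assumes \<mu>: "is_plf \<mu>" "plf_null lam \<subseteq> plf_null \<mu>"
  shows "weak_star_decomposition lam \<mu> \<mu>\<^sub>1 \<mu>\<^sub>2 \<longleftrightarrow> \<mu>\<^sub>1 = ac_part lam \<mu> \<and> \<mu>\<^sub>2 = s_part lam \<mu>"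
proof
  assume dec: "weak_star_decomposition lam \<mu> \<mu>\<^sub>1 \<mu>\<^sub>2"
  then have eq: "\<mu> = (\<lambda>a. \<mu>\<^sub>1 a + \<mu>\<^sub>2 a)" and AC: "\<mu>\<^sub>1 \<in> AC lam" and "is_plf \<mu>\<^sub>2"
    and greatest: "\<And>\<rho>. \<rho> \<in> AC lam \<Longrightarrow> \<rho> \<preceq>\<^sub>+ \<mu> \<Longrightarrow> \<rho> \<preceq>\<^sub>+ \<mu>\<^sub>1"
    by (auto simp: weak_star_decomposition_def weak_star_cont_iff_AC weak_star_sing_def)
  have "\<mu>\<^sub>1 \<preceq>\<^sub>+ \<mu>"
    unfolding eq by (rule plf_le_add_left[OF \<open>is_plf \<mu>\<^sub>2\<close>])
  then have "\<mu>\<^sub>1 = ac_part lam \<mu>"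
    using ac_part_greatest[OF \<mu>(1) lam \<mu>(2) AC] greatest[OF ac_part_AC[OF \<mu>(1) lam \<mu>(2)] ac_part_le[OF \<mu>(1) lam \<mu>(2)]]
    by (blast intro: plf_le_antisym)
  moreover have "\<mu>\<^sub>2 = (\<lambda>a. \<mu> a - \<mu>\<^sub>1 a)"
    by (simp add: eq)
  ultimately show "\<mu>\<^sub>1 = ac_part lam \<mu> \<and> \<mu>\<^sub>2 = s_part lam \<mu>"
    by (simp add: s_part_def)
next
  assume "\<mu>\<^sub>1 = ac_part lam \<mu> \<and> \<mu>\<^sub>2 = s_part lam \<mu>"
  then show "weak_star_decomposition lam \<mu> \<mu>\<^sub>1 \<mu>\<^sub>2"
    using ac_part_AC[OF \<mu>(1) lam \<mu>(2)] s_part_weak_star_sing[OF \<mu>] ac_part_greatest[OF \<mu>(1) lam \<mu>(2)]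
    by (simp add: weak_star_decomposition_def weak_star_cont_iff_AC) (simp add: s_part_def)
qed

end

theorem theorem5:
  fixes \<sigma> :: "real \<Rightarrow> 'a::unital_cstar_algebra \<Rightarrow> 'a"
    and \<mu> \<nu> lam :: "'a \<Rightarrow> complex"
  assumes "cstar_dynamical_system \<sigma>"
    and "is_plf \<mu>" and "is_plf \<nu>" and "is_plf lam"
    and "plf_null lam \<subseteq> plf_null \<mu>" and "plf_null lam \<subseteq> plf_null \<nu>"
    and "is_kms_plf \<sigma> lam"
  shows "(positive_cone (AC lam) \<and> hereditary (AC lam)) \<and>
    (positive_cone (SG lam) \<and> hereditary (SG lam)) \<and>
    ac_part lam (\<lambda>a. \<mu> a + \<nu> a) = (\<lambda>a. ac_part lam \<mu> a + ac_part lam \<nu> a) \<and>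
    s_part lam (\<lambda>a. \<mu> a + \<nu> a) = (\<lambda>a. s_part lam \<mu> a + s_part lam \<nu> a) \<and>
    (\<mu> \<preceq>\<^sub>+ \<nu> \<longrightarrow> ac_part lam \<mu> \<preceq>\<^sub>+ ac_part lam \<nu> \<and> s_part lam \<mu> \<preceq>\<^sub>+ s_part lam \<nu>) \<and>
    (wc_part lam \<mu> = ac_part lam \<mu> \<and> ws_part lam \<mu> = s_part lam \<mu>)"
proof -
  \<comment> \<open>The witness is the boundary value \<open>f \<i>\<close> of the strip
    extension.\<close>
  have "\<exists>a'. \<forall>b. lam (a * b) = lam (b * a')" for a
    using assms(7) unfolding is_kms_plf_def by blast
  then obtain K where K: "0 < K" "\<And>a. gns_norm lam (star a) \<le> K * gns_norm lam a"
    using kms_star_bounded[OF assms(4)] by blast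
  interpret star_bounded_plf lam K
    by unfold_locales (fact assms(4) K)+
  have "wc_part lam \<mu> = ac_part lam \<mu>" "ws_part lam \<mu> = s_part lam \<mu>"
    unfolding wc_part_def ws_part_def weak_star_decomposition_iff[OF assms(2,5)] by auto
  then show ?thesis
    using positive_cone_AC hereditary_AC positive_cone_SG hereditary_SG
      ac_s_part_plus[OF assms(2,3,5,6)] ac_s_part_mono[OF assms(2,3,5,6)] by blast
qed

end
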